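(* Let $M$ be an invariant submanifold of an SQ-Sasakian manifold $M^*$, with structure $(\phi,\xi,\eta,g)$ and structure function $\beta$, equipped with the semisymmetric metric connection $\widetilde{\bar\nabla}$. Then the following statements are equivalent: (i) $M$ is totally geodesic; (ii) $M$ is parallel with respect to the semisymmetric metric connection, with $\beta^2+1\neq 0$; (iii) $M$ is semiparallel with respect to the semisymmetric metric connection, with $\beta^2+1\neq 0$; (iv) $M$ is Chaki-pseudo parallel with respect to the semisymmetric metric connection with associated $1$-form $\alpha$ satisfying $\{\alpha(\xi)+1\}^2+\beta^2\neq 0$; (v) $M$ is Deszcz-pseudo parallel with respect to the semisymmetric metric connection with associated function $L_h$ satisfying $(L_h+\beta^2)^2+\beta^2\neq 0$.
   Context: An almost contact metric manifold $(\phi,\xi,\eta,g)$ is a smooth manifold with a $(1,1)$-tensor $\phi$, a vector field $\xi$, a $1$-form $\eta$ and a Riemannian metric $g$ such that $\phi^2X=-X+\eta(X)\xi$, $\phi\xi=0$, $\eta(\xi)=1$, $g(X,\xi)=\eta(X)$, $\eta(\phi X)=0$, $g(\phi X,\phi Y)=g(X,Y)-\eta(X)\eta(Y)$, $g(\phi X,Y)=-g(X,\phi Y)$. Its fundamental $2$-form is $\Phi(X,Y)=g(X,\phi Y)$. It is normal if $[\phi X,\phi Y]+\phi^2[X,Y]-\phi[\phi X,Y]-\phi[X,\phi Y]+2d\eta(X,Y)\xi=0$. An SQ-Sasakian manifold $M^*$ (of dimension $2n+1>3$) is a normal almost contact metric manifold with $d\Phi=0$ and $\bar\nabla_X\xi=-\beta\phi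 X$ for a smooth function $\beta$ (the structure function) with $\xi\beta=0$, where $\bar\nabla$ is the Levi-Civita connection. The semisymmetric metric connection on $M^*$ is $\widetilde{\bar\nabla}_XY=\bar\nabla_XY+\eta(Y)X-g(X,Y)\xi$. $M$ is a submanifold of dimension $2m+1$, $m<n$, with induced metric $g$. It is invariant if $\xi$ is tangent to $M$ and $\phi(TM)\subset TM$ at every point of $M$. Let $h$ be the second fundamental form with respect to $\bar\nabla$; $M$ is totally geodesic if $h=0$. For $X,Y$ tangent to $M$ and $V$ normal to $M$, write $\widetilde{\bar\nabla}_XY=\widetilde\nabla_XY+\widetilde h(X,Y)$ (tangential plus normal part) and let $\widetilde\nabla^\perp_XV$ be the normal part of $\widetilde{\bar\nabla}_XV$. Put $(\widetilde\nabla_X\widetilde h)(Y,Z)=\widetilde\nabla^\perp_X(\widetilde h(Y,Z))-\widetilde h(\widetilde\nabla_XY,Z)-\widetilde h(Y,\widetilde\nabla_XZ)$. $M$ is Chaki-pseudo parallel with respect to the semisymmetric metric connection if there is a nowhere vanishing $1$-form $\alpha$ on $M$ with $(\widetilde\nabla_X\widetilde h)(Y,Z)=2\alpha(X)\widetilde h(Y,Z)+\alpha(Y)\widetilde h(X,Z)+\alpha(Z)\widetilde h(X,Y)$ for all $X,Y,Z$ tangent to $M$. It is parallel with respect to the semisymmetric metric connection if $\widetilde\nabla\widetilde h=0$. Let $\widetilde R,\widetilde R^\perp$ be the curvature tensors of $\widetilde\nabla,\widetilde\nabla^\perp$ (convention $R(X,Y)=\nabla_X\nabla_Y-\nabla_Y\nabla_X-\nabla_{[X,Y]}$),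 and put $(\widetilde{\bar R}(X,Y)\cdot\widetilde h)(Z,U)=\widetilde R^\perp(X,Y)\widetilde h(Z,U)-\widetilde h(\widetilde R(X,Y)Z,U)-\widetilde h(Z,\widetilde R(X,Y)U)$, $Q(g,\widetilde h)(Z,U;X,Y)=g(Y,Z)\widetilde h(X,U)-g(X,Z)\widetilde h(Y,U)+g(Y,U)\widetilde h(X,Z)-g(X,U)\widetilde h(Y,Z)$. $M$ is Deszcz-pseudo parallel with respect to the semisymmetric metric connection if $(\widetilde{\bar R}(X,Y)\cdot\widetilde h)(Z,U)=L_hQ(g,\widetilde h)(Z,U;X,Y)$ for all $X,Y,Z,U$ tangent to $M$, where $L_h$ is some function on $W=\{x\in M:(h-Hg)_x\neq0\}$, $H$ being the mean curvature vector. It is semiparallel with respect to the semisymmetric metric connection if this holds with $L_h=0$. Conditions "$\neq0$" on functions are understood pointwise where the functions are defined.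
   Formalization: The implication (iii) ⇒ (i) is stated only when β vanishes nowhere on M; for β = 0 (cosymplectic case) it is false, since there are semiparallel invariant submanifolds that are not totally geodesic. All other implications are stated in full. *)

theory Defs
  imports "HOL-Analysis.Analysis" "HOL-Library.Function_Algebras"
begin

section \<open>Smooth manifolds\<close>

text \<open>For open \<open>S\<close> in a Euclidean space, \<open>Ck_on k S f\<close> says that \<open>f\<close> is of class \<open>C\<close> to the
  power \<open>k\<close>: all iterated directional derivatives up to order \<open>k\<close> exist as Frechet derivatives
  and are continuous.\<close>

primrec Ck_on :: "nat \<Rightarrow> 'e::real_normed_vector set \<Rightarrow> ('e \<Rightarrow> 'f::real_normed_vector) \<Rightarrow> bool" where
  "Ck_on 0 S f \<longleftrightarrow> continuous_on S f"
| "Ck_on (Suc k) S f \<longleftrightarrow>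
     (\<forall>x\<in>S. f differentiable (at x)) \<and> (\<forall>v. Ck_on k S (\<lambda>x. frechet_derivative f (at x) v))"

definition smooth_on :: "'e::real_normed_vector set \<Rightarrow> ('e \<Rightarrow> 'f::real_normed_vector) \<Rightarrow> bool" where
  "smooth_on S f \<longleftrightarrow> (\<forall>k. Ck_on k S f)"

text \<open>A chart is a domain together with a coordinate map; the coordinate map is irrelevant outside
  the domain.\<close>

type_synonym ('a, 'e) chart = "'a set \<times> ('a \<Rightarrow> 'e)"

record ('a, 'e) manifold =
  topo :: "'a topology"
  atlas :: "('a, 'e) chart set"

abbreviation points :: "('a, 'e) manifold \<Rightarrow> 'a set" where
  "points M \<equiv> topspace (topo M)"

definition chart_inv :: "('a, 'e) chart \<Rightarrow> 'e \<Rightarrow> 'a" where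
  "chart_inv c = inv_into (fst c) (snd c)"

definition smooth_manifold :: "('a, 'e::euclidean_space) manifold \<Rightarrow> bool" where
  "smooth_manifold M \<longleftrightarrow>
     Hausdorff_space (topo M) \<and> second_countable (topo M) \<and>
     (\<Union>c\<in>atlas M. fst c) = points M \<and>
     (\<forall>c\<in>atlas M. openin (topo M) (fst c) \<and> open (snd c ` fst c) \<and>
        homeomorphic_map (subtopology (topo M) (fst c)) (top_of_set (snd c ` fst c)) (snd c)) \<and>
     (\<forall>c\<in>atlas M. \<forall>c'\<in>atlas M. smooth_on (snd c ` (fst c \<inter> fst c')) (snd c' \<circ> chart_inv c))"

definition charts_at :: "('a, 'e) manifold \<Rightarrow> 'a \<Rightarrow> ('a, 'e) chart set" where
  "charts_at M p = {c \<in> atlas M. p \<in> fst c}"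

text \<open>Everything below is formulated for functions and vector fields that are smooth on some
  neighbourhood of the point in question; their values elsewhere are arbitrary.\<close>

definition smooth_near :: "('a, 'e::euclidean_space) manifold \<Rightarrow> 'a \<Rightarrow> ('a \<Rightarrow> real) \<Rightarrow> bool" where
  "smooth_near M p u \<longleftrightarrow>
     (\<exists>U. openin (topo M) U \<and> p \<in> U \<and>
        (\<forall>c\<in>atlas M. smooth_on (snd c ` (fst c \<inter> U)) (u \<circ> chart_inv c)))"

text \<open>A tangent vector is the directional derivative operator it induces on functions smooth near
  its base point, extended by \<open>0\<close> to all other functions so that equality of tangent vectors is
  equality of operators.\<close>

type_synonym 'a tvec = "('a \<Rightarrow> real) \<Rightarrow> real"

definition tscale :: "real \<Rightarrow> 'a tvec \<Rightarrow> 'a tvec"  (infixr "*\<^sub>T" 75) where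
  "r *\<^sub>T v = (\<lambda>u. r * v u)"

definition coord_vec :: "('a, 'e::euclidean_space) manifold \<Rightarrow> ('a, 'e) chart \<Rightarrow> 'a \<Rightarrow> 'e \<Rightarrow> 'a tvec" where
  "coord_vec M c p e =
     (\<lambda>u. if smooth_near M p u then frechet_derivative (u \<circ> chart_inv c) (at (snd c p)) e else 0)"

definition tangent_space :: "('a, 'e::euclidean_space) manifold \<Rightarrow> 'a \<Rightarrow> 'a tvec set" where
  "tangent_space M p = {coord_vec M c p e | c e. c \<in> charts_at M p}"

text \<open>\<open>W\<close> is, near \<open>p \<in> M\<close>, a smooth vector field along \<open>i : M \<rightarrow> N\<close>, i.e. a smooth local section of
  the pullback of \<open>TN\<close>. For \<open>i = id\<close> this is an ordinary vector field near \<open>p\<close>.\<close>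

definition along_near ::
  "('b, 'f::euclidean_space) manifold \<Rightarrow> ('a, 'e::euclidean_space) manifold \<Rightarrow> ('b \<Rightarrow> 'a) \<Rightarrow> 'b \<Rightarrow>
   ('b \<Rightarrow> 'a tvec) \<Rightarrow> bool" where
  "along_near M N i p W \<longleftrightarrow>
     (\<exists>U. openin (topo M) U \<and> p \<in> U \<and>
        (\<forall>q\<in>U. W q \<in> tangent_space N (i q) \<and>
           (\<forall>u. smooth_near N (i q) u \<longrightarrow> smooth_near M q (\<lambda>r. W r u))))"

abbreviation field_near ::
  "('a, 'e::euclidean_space) manifold \<Rightarrow> 'a \<Rightarrow> ('a \<Rightarrow> 'a tvec) \<Rightarrow> bool" where
  "field_near M p X \<equiv> along_near M M id p X"

definition bracket ::
  "('a, 'e::euclidean_space) manifold \<Rightarrow> ('a \<Rightarrow> 'a tvec) \<Rightarrow> ('a \<Rightarrow> 'a tvec) \<Rightarrow> 'a \<Rightarrow> 'a tvec" where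
  "bracket M X Y p =
     (\<lambda>u. if smooth_near M p u then X p (\<lambda>q. Y q u) - Y p (\<lambda>q. X q u) else 0)"

definition smooth_map ::
  "('b, 'f::euclidean_space) manifold \<Rightarrow> ('a, 'e::euclidean_space) manifold \<Rightarrow> ('b \<Rightarrow> 'a) \<Rightarrow> bool" where
  "smooth_map M N i \<longleftrightarrow>
     (\<forall>p\<in>points M. i p \<in> points N \<and> (\<forall>u. smooth_near N (i p) u \<longrightarrow> smooth_near M p (u \<circ> i)))"

definition push ::
  "('a, 'e::euclidean_space) manifold \<Rightarrow> ('b \<Rightarrow> 'a) \<Rightarrow> 'b \<Rightarrow> 'b tvec \<Rightarrow> 'a tvec" where
  "push N i p v = (\<lambda>u. if smooth_near N (i p) u then v (u \<circ> i) else 0)"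

definition immersion ::
  "('b, 'f::euclidean_space) manifold \<Rightarrow> ('a, 'e::euclidean_space) manifold \<Rightarrow> ('b \<Rightarrow> 'a) \<Rightarrow> bool" where
  "immersion M N i \<longleftrightarrow>
     smooth_map M N i \<and> (\<forall>p\<in>points M. inj_on (push N i p) (tangent_space M p))"

section \<open>Tensors and connections\<close>

definition lin_form :: "'a tvec set \<Rightarrow> ('a tvec \<Rightarrow> real) \<Rightarrow> bool" where
  "lin_form T f \<longleftrightarrow>
     (\<forall>v\<in>T. \<forall>w\<in>T. f (v + w) = f v + f w) \<and> (\<forall>r. \<forall>v\<in>T. f (r *\<^sub>T v) = r * f v)"

definition lin_map :: "'a tvec set \<Rightarrow> ('a tvec \<Rightarrow> 'a tvec) \<Rightarrow> bool" where
  "lin_map T f \<longleftrightarrow>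
     (\<forall>v\<in>T. \<forall>w\<in>T. f (v + w) = f v + f w) \<and> (\<forall>r. \<forall>v\<in>T. f (r *\<^sub>T v) = r *\<^sub>T f v)"

definition one_form ::
  "('a, 'e::euclidean_space) manifold \<Rightarrow> ('a \<Rightarrow> 'a tvec \<Rightarrow> real) \<Rightarrow> bool" where
  "one_form M \<alpha> \<longleftrightarrow>
     (\<forall>p\<in>points M. lin_form (tangent_space M p) (\<alpha> p) \<and>
        (\<forall>X. field_near M p X \<longrightarrow> smooth_near M p (\<lambda>q. \<alpha> q (X q))))"

definition tensor11 ::
  "('a, 'e::euclidean_space) manifold \<Rightarrow> ('a \<Rightarrow> 'a tvec \<Rightarrow> 'a tvec) \<Rightarrow> bool" where
  "tensor11 M \<phi> \<longleftrightarrow>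
     (\<forall>p\<in>points M. lin_map (tangent_space M p) (\<phi> p) \<and>
        (\<forall>v\<in>tangent_space M p. \<phi> p v \<in> tangent_space M p) \<and>
        (\<forall>X. field_near M p X \<longrightarrow> field_near M p (\<lambda>q. \<phi> q (X q))))"

definition riemannian_metric ::
  "('a, 'e::euclidean_space) manifold \<Rightarrow> ('a \<Rightarrow> 'a tvec \<Rightarrow> 'a tvec \<Rightarrow> real) \<Rightarrow> bool" where
  "riemannian_metric M g \<longleftrightarrow>
     (\<forall>p\<in>points M.
        (\<forall>v\<in>tangent_space M p. lin_form (tangent_space M p) (g p v) \<and>
           (\<forall>w\<in>tangent_space M p. g p v w = g p w v) \<and> (v \<noteq> 0 \<longrightarrow> g p v v > 0)) \<and>
        (\<forall>X Y. field_near M p X \<longrightarrow> field_near M p Y \<longrightarrow> smooth_near M p (\<lambda>q. g q (X q) (Y q))))"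

text \<open>A connection is written \<open>D p v Y\<close>, the covariant derivative at \<open>p\<close> of the vector field \<open>Y\<close> in
  the direction of the tangent vector \<open>v\<close> at \<open>p\<close>. Since \<open>u\<close> in the Leibniz rule need only be
  smooth near \<open>p\<close>, the rule forces \<open>D p v Y\<close> to depend only on the germ of \<open>Y\<close> at \<open>p\<close>.\<close>

type_synonym 'a conn = "'a \<Rightarrow> 'a tvec \<Rightarrow> ('a \<Rightarrow> 'a tvec) \<Rightarrow> 'a tvec"

definition affine_connection :: "('a, 'e::euclidean_space) manifold \<Rightarrow> 'a conn \<Rightarrow> bool" where
  "affine_connection M D \<longleftrightarrow>
     (\<forall>p\<in>points M.
        (\<forall>Y. field_near M p Y \<longrightarrow>
           (\<forall>v\<in>tangent_space M p. D p v Y \<in> tangent_space M p) \<and>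
           lin_map (tangent_space M p) (\<lambda>v. D p v Y)) \<and>
        (\<forall>v\<in>tangent_space M p.
           (\<forall>Y Z. field_near M p Y \<longrightarrow> field_near M p Z \<longrightarrow>
              D p v (\<lambda>q. Y q + Z q) = D p v Y + D p v Z) \<and>
           (\<forall>u Y. smooth_near M p u \<longrightarrow> field_near M p Y \<longrightarrow>
              D p v (\<lambda>q. u q *\<^sub>T Y q) = v u *\<^sub>T Y p + u p *\<^sub>T D p v Y)) \<and>
        (\<forall>X Y. field_near M p X \<longrightarrow> field_near M p Y \<longrightarrow> field_near M p (\<lambda>q. D q (X q) Y)))"

definition levi_civita ::
  "('a, 'e::euclidean_space) manifold \<Rightarrow> ('a \<Rightarrow> 'a tvec \<Rightarrow> 'a tvec \<Rightarrow> real) \<Rightarrow> 'a conn \<Rightarrow> bool" where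
  "levi_civita M g D \<longleftrightarrow>
     affine_connection M D \<and>
     (\<forall>p\<in>points M. \<forall>X Y. field_near M p X \<longrightarrow> field_near M p Y \<longrightarrow>
        D p (X p) Y - D p (Y p) X = bracket M X Y p \<and>
        (\<forall>v\<in>tangent_space M p.
           v (\<lambda>q. g q (X q) (Y q)) = g p (D p v X) (Y p) + g p (X p) (D p v Y)))"

text \<open>The connection induced by \<open>D\<close> on vector fields along \<open>i\<close>: with \<open>W = \<Sum>b. W\<^sup>b \<partial>\<^sub>b\<close> in a chart around
  \<open>i p\<close>, where \<open>W\<^sup>b = W x\<^sup>b\<close> for the coordinate functions \<open>x\<^sup>b\<close>, put
  \<open>D\<^sub>v W = \<Sum>b. v(W\<^sup>b) \<partial>\<^sub>b + W\<^sup>b D\<^bsub>di v\<^esub> \<partial>\<^sub>b\<close>. It is the only connection with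
  \<open>D\<^sub>v (Z \<circ> i) = D\<^bsub>di v\<^esub> Z\<close> for all vector fields \<open>Z\<close> on \<open>N\<close>, so the choice of chart is immaterial.\<close>

definition pullback_conn ::
  "('a, 'e::euclidean_space) manifold \<Rightarrow> ('b \<Rightarrow> 'a) \<Rightarrow> 'a conn \<Rightarrow>
   'b \<Rightarrow> 'b tvec \<Rightarrow> ('b \<Rightarrow> 'a tvec) \<Rightarrow> 'a tvec" where
  "pullback_conn N i D p v W =
     (let c = (SOME c. c \<in> charts_at N (i p)) in
      \<Sum>b\<in>Basis.
        v (\<lambda>q. W q (\<lambda>r. snd c r \<bullet> b)) *\<^sub>T coord_vec N c (i p) b +
        W p (\<lambda>r. snd c r \<bullet> b) *\<^sub>T D (i p) (push N i p v) (\<lambda>r. coord_vec N c r b))"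

text \<open>Curvature of a connection on a vector bundle over \<open>M\<close>; \<open>S\<close> is a section of that bundle.\<close>

definition curvature ::
  "('b, 'f::euclidean_space) manifold \<Rightarrow>
   ('b \<Rightarrow> 'b tvec \<Rightarrow> ('b \<Rightarrow> 'a tvec) \<Rightarrow> 'a tvec) \<Rightarrow>
   ('b \<Rightarrow> 'b tvec) \<Rightarrow> ('b \<Rightarrow> 'b tvec) \<Rightarrow> ('b \<Rightarrow> 'a tvec) \<Rightarrow> 'b \<Rightarrow> 'a tvec" where
  "curvature M C X Y S p =
     C p (X p) (\<lambda>q. C q (Y q) S) - C p (Y p) (\<lambda>q. C q (X q) S) - C p (bracket M X Y p) S"

section \<open>SQ-Sasakian manifolds\<close>

definition almost_contact_metric ::
  "('a, 'e::euclidean_space) manifold \<Rightarrow> ('a \<Rightarrow> 'a tvec \<Rightarrow> 'a tvec) \<Rightarrow> ('a \<Rightarrow> 'a tvec) \<Rightarrow>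
   ('a \<Rightarrow> 'a tvec \<Rightarrow> real) \<Rightarrow> ('a \<Rightarrow> 'a tvec \<Rightarrow> 'a tvec \<Rightarrow> real) \<Rightarrow> bool" where
  "almost_contact_metric N \<phi> \<xi> \<eta> g \<longleftrightarrow>
     smooth_manifold N \<and> tensor11 N \<phi> \<and> (\<forall>p\<in>points N. field_near N p \<xi>) \<and>
     one_form N \<eta> \<and> riemannian_metric N g \<and>
     (\<forall>p\<in>points N. \<phi> p (\<xi> p) = 0 \<and> \<eta> p (\<xi> p) = 1 \<and>
        (\<forall>v\<in>tangent_space N p.
           \<phi> p (\<phi> p v) = - v + \<eta> p v *\<^sub>T \<xi> p \<and> g p v (\<xi> p) = \<eta> p v \<and> \<eta> p (\<phi> p v) = 0 \<and>
           (\<forall>w\<in>tangent_space N p.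
              g p (\<phi> p v) (\<phi> p w) = g p v w - \<eta> p v * \<eta> p w \<and>
              g p (\<phi> p v) w = - g p v (\<phi> p w))))"

text \<open>Exterior derivatives are normalized with the factors \<open>1/2\<close> and \<open>1/3\<close>, as usual in contact
  geometry; this is the convention for which the term \<open>2 d\<eta>\<close> in the normality condition
  is correct.\<close>

definition ext_deriv1 ::
  "('a, 'e::euclidean_space) manifold \<Rightarrow> ('a \<Rightarrow> 'a tvec \<Rightarrow> real) \<Rightarrow>
   ('a \<Rightarrow> 'a tvec) \<Rightarrow> ('a \<Rightarrow> 'a tvec) \<Rightarrow> 'a \<Rightarrow> real" where
  "ext_deriv1 N \<omega> X Y p =
     (X p (\<lambda>q. \<omega> q (Y q)) - Y p (\<lambda>q. \<omega> q (X q)) - \<omega> p (bracket N X Y p)) / 2"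

definition ext_deriv2 ::
  "('a, 'e::euclidean_space) manifold \<Rightarrow> ('a \<Rightarrow> 'a tvec \<Rightarrow> 'a tvec \<Rightarrow> real) \<Rightarrow>
   ('a \<Rightarrow> 'a tvec) \<Rightarrow> ('a \<Rightarrow> 'a tvec) \<Rightarrow> ('a \<Rightarrow> 'a tvec) \<Rightarrow> 'a \<Rightarrow> real" where
  "ext_deriv2 N \<omega> X Y Z p =
     (X p (\<lambda>q. \<omega> q (Y q) (Z q)) + Y p (\<lambda>q. \<omega> q (Z q) (X q)) + Z p (\<lambda>q. \<omega> q (X q) (Y q))
      - \<omega> p (bracket N X Y p) (Z p) - \<omega> p (bracket N Y Z p) (X p) - \<omega> p (bracket N Z X p) (Y p)) / 3"

definition fundamental_form ::
  "('a \<Rightarrow> 'a tvec \<Rightarrow> 'a tvec) \<Rightarrow> ('a \<Rightarrow> 'a tvec \<Rightarrow> 'a tvec \<Rightarrow> real) \<Rightarrow>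
   'a \<Rightarrow> 'a tvec \<Rightarrow> 'a tvec \<Rightarrow> real" where
  "fundamental_form \<phi> g p v w = g p v (\<phi> p w)"

definition normal_structure ::
  "('a, 'e::euclidean_space) manifold \<Rightarrow> ('a \<Rightarrow> 'a tvec \<Rightarrow> 'a tvec) \<Rightarrow> ('a \<Rightarrow> 'a tvec) \<Rightarrow>
   ('a \<Rightarrow> 'a tvec \<Rightarrow> real) \<Rightarrow> bool" where
  "normal_structure N \<phi> \<xi> \<eta> \<longleftrightarrow>
     (\<forall>p\<in>points N. \<forall>X Y. field_near N p X \<longrightarrow> field_near N p Y \<longrightarrow>
        bracket N (\<lambda>q. \<phi> q (X q)) (\<lambda>q. \<phi> q (Y q)) p
        + \<phi> p (\<phi> p (bracket N X Y p))
        - \<phi> p (bracket N (\<lambda>q. \<phi> q (X q)) Y p)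
        - \<phi> p (bracket N X (\<lambda>q. \<phi> q (Y q)) p)
        + (2 * ext_deriv1 N \<eta> X Y p) *\<^sub>T \<xi> p = 0)"

text \<open>The argument \<open>D\<close> is the Levi-Civita connection of \<open>g\<close>, which is unique on smooth fields.\<close>

definition sq_sasakian ::
  "('a, 'e::euclidean_space) manifold \<Rightarrow> ('a \<Rightarrow> 'a tvec \<Rightarrow> 'a tvec) \<Rightarrow> ('a \<Rightarrow> 'a tvec) \<Rightarrow>
   ('a \<Rightarrow> 'a tvec \<Rightarrow> real) \<Rightarrow> ('a \<Rightarrow> 'a tvec \<Rightarrow> 'a tvec \<Rightarrow> real) \<Rightarrow> 'a conn \<Rightarrow> ('a \<Rightarrow> real) \<Rightarrow> bool" where
  "sq_sasakian N \<phi> \<xi> \<eta> g D \<beta> \<longleftrightarrow>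
     almost_contact_metric N \<phi> \<xi> \<eta> g \<and> normal_structure N \<phi> \<xi> \<eta> \<and> levi_civita N g D \<and>
     (\<forall>p\<in>points N.
        (\<forall>X Y Z. field_near N p X \<longrightarrow> field_near N p Y \<longrightarrow> field_near N p Z \<longrightarrow>
           ext_deriv2 N (fundamental_form \<phi> g) X Y Z p = 0) \<and>
        smooth_near N p \<beta> \<and> \<xi> p \<beta> = 0 \<and>
        (\<forall>v\<in>tangent_space N p. D p v \<xi> = - (\<beta> p *\<^sub>T \<phi> p v)))"

definition semisymmetric_conn ::
  "('a \<Rightarrow> 'a tvec) \<Rightarrow> ('a \<Rightarrow> 'a tvec \<Rightarrow> real) \<Rightarrow> ('a \<Rightarrow> 'a tvec \<Rightarrow> 'a tvec \<Rightarrow> real) \<Rightarrow>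
   'a conn \<Rightarrow> 'a conn" where
  "semisymmetric_conn \<xi> \<eta> g D p v Y = D p v Y + \<eta> p (Y p) *\<^sub>T v - g p v (Y p) *\<^sub>T \<xi> p"

section \<open>Submanifolds\<close>

text \<open>\<open>M\<close> is a submanifold of \<open>N\<close> via the immersion \<open>i\<close>, and \<open>g\<close> is the metric of \<open>N\<close>. Tangent vectors
  of \<open>M\<close> at \<open>p\<close> are viewed in \<open>N\<close> through the differential \<open>push N i p\<close>.\<close>

definition induced_metric ::
  "('a, 'e::euclidean_space) manifold \<Rightarrow> ('b \<Rightarrow> 'a) \<Rightarrow> ('a \<Rightarrow> 'a tvec \<Rightarrow> 'a tvec \<Rightarrow> real) \<Rightarrow>
   'b \<Rightarrow> 'b tvec \<Rightarrow> 'b tvec \<Rightarrow> real" where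
  "induced_metric N i g p v w = g (i p) (push N i p v) (push N i p w)"

definition invariant_submanifold ::
  "('b, 'f::euclidean_space) manifold \<Rightarrow> ('a, 'e::euclidean_space) manifold \<Rightarrow> ('b \<Rightarrow> 'a) \<Rightarrow>
   ('a \<Rightarrow> 'a tvec \<Rightarrow> 'a tvec) \<Rightarrow> ('a \<Rightarrow> 'a tvec) \<Rightarrow> bool" where
  "invariant_submanifold M N i \<phi> \<xi> \<longleftrightarrow>
     smooth_manifold M \<and> immersion M N i \<and>
     (\<forall>p\<in>points M. \<xi> (i p) \<in> push N i p ` tangent_space M p \<and>
        \<phi> (i p) ` (push N i p ` tangent_space M p) \<subseteq> push N i p ` tangent_space M p)"

definition tan_part ::
  "('b, 'f::euclidean_space) manifold \<Rightarrow> ('a, 'e::euclidean_space) manifold \<Rightarrow> ('b \<Rightarrow> 'a) \<Rightarrow>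
   ('a \<Rightarrow> 'a tvec \<Rightarrow> 'a tvec \<Rightarrow> real) \<Rightarrow> 'b \<Rightarrow> 'a tvec \<Rightarrow> 'b tvec" where
  "tan_part M N i g p w =
     (THE v. v \<in> tangent_space M p \<and>
        (\<forall>v'\<in>tangent_space M p. g (i p) (w - push N i p v) (push N i p v') = 0))"

definition nor_part ::
  "('b, 'f::euclidean_space) manifold \<Rightarrow> ('a, 'e::euclidean_space) manifold \<Rightarrow> ('b \<Rightarrow> 'a) \<Rightarrow>
   ('a \<Rightarrow> 'a tvec \<Rightarrow> 'a tvec \<Rightarrow> real) \<Rightarrow> 'b \<Rightarrow> 'a tvec \<Rightarrow> 'a tvec" where
  "nor_part M N i g p w = w - push N i p (tan_part M N i g p w)"

text \<open>For a connection \<open>D\<close> on \<open>N\<close> (the Levi-Civita or the semisymmetric metric one): the induced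
  connection on \<open>M\<close>, the second fundamental form and the normal connection. \<open>sff \<dots> D p v Y\<close> is
  the value at \<open>p\<close> of the second fundamental form on \<open>v\<close> and \<open>Y\<close>.\<close>

definition ind_conn ::
  "('b, 'f::euclidean_space) manifold \<Rightarrow> ('a, 'e::euclidean_space) manifold \<Rightarrow> ('b \<Rightarrow> 'a) \<Rightarrow>
   ('a \<Rightarrow> 'a tvec \<Rightarrow> 'a tvec \<Rightarrow> real) \<Rightarrow> 'a conn \<Rightarrow> 'b conn" where
  "ind_conn M N i g D p v Y =
     tan_part M N i g p (pullback_conn N i D p v (\<lambda>q. push N i q (Y q)))"

definition sff ::
  "('b, 'f::euclidean_space) manifold \<Rightarrow> ('a, 'e::euclidean_space) manifold \<Rightarrow> ('b \<Rightarrow> 'a) \<Rightarrow>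
   ('a \<Rightarrow> 'a tvec \<Rightarrow> 'a tvec \<Rightarrow> real) \<Rightarrow> 'a conn \<Rightarrow> 'b \<Rightarrow> 'b tvec \<Rightarrow> ('b \<Rightarrow> 'b tvec) \<Rightarrow> 'a tvec" where
  "sff M N i g D p v Y =
     nor_part M N i g p (pullback_conn N i D p v (\<lambda>q. push N i q (Y q)))"

definition normal_conn ::
  "('b, 'f::euclidean_space) manifold \<Rightarrow> ('a, 'e::euclidean_space) manifold \<Rightarrow> ('b \<Rightarrow> 'a) \<Rightarrow>
   ('a \<Rightarrow> 'a tvec \<Rightarrow> 'a tvec \<Rightarrow> real) \<Rightarrow> 'a conn \<Rightarrow> 'b \<Rightarrow> 'b tvec \<Rightarrow> ('b \<Rightarrow> 'a tvec) \<Rightarrow> 'a tvec" where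
  "normal_conn M N i g D p v V = nor_part M N i g p (pullback_conn N i D p v V)"

definition totally_geodesic ::
  "('b, 'f::euclidean_space) manifold \<Rightarrow> ('a, 'e::euclidean_space) manifold \<Rightarrow> ('b \<Rightarrow> 'a) \<Rightarrow>
   ('a \<Rightarrow> 'a tvec \<Rightarrow> 'a tvec \<Rightarrow> real) \<Rightarrow> 'a conn \<Rightarrow> bool" where
  "totally_geodesic M N i g D \<longleftrightarrow>
     (\<forall>p\<in>points M. \<forall>X Y. field_near M p X \<longrightarrow> field_near M p Y \<longrightarrow> sff M N i g D p (X p) Y = 0)"

text \<open>Trace of the second fundamental form over an orthonormal basis, divided by the dimension of
  \<open>M\<close>. The basis is indexed by \<open>Basis :: 'f set\<close> merely because this set has the right
  cardinality; its members are vector fields near \<open>p\<close> since \<open>sff\<close> takes a field as its second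
  argument.\<close>

definition orthonormal_at ::
  "('b, 'f::euclidean_space) manifold \<Rightarrow> ('a, 'e::euclidean_space) manifold \<Rightarrow> ('b \<Rightarrow> 'a) \<Rightarrow>
   ('a \<Rightarrow> 'a tvec \<Rightarrow> 'a tvec \<Rightarrow> real) \<Rightarrow> 'b \<Rightarrow> ('f \<Rightarrow> 'b \<Rightarrow> 'b tvec) \<Rightarrow> bool" where
  "orthonormal_at M N i g p E \<longleftrightarrow>
     (\<forall>a\<in>Basis. field_near M p (E a) \<and>
        (\<forall>b\<in>Basis. induced_metric N i g p (E a p) (E b p) = (if a = b then 1 else 0)))"

definition mean_curvature ::
  "('b, 'f::euclidean_space) manifold \<Rightarrow> ('a, 'e::euclidean_space) manifold \<Rightarrow> ('b \<Rightarrow> 'a) \<Rightarrow>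
   ('a \<Rightarrow> 'a tvec \<Rightarrow> 'a tvec \<Rightarrow> real) \<Rightarrow> 'a conn \<Rightarrow> 'b \<Rightarrow> 'a tvec" where
  "mean_curvature M N i g D p =
     (let E = (SOME E. orthonormal_at M N i g p E) in
      (1 / real DIM('f)) *\<^sub>T (\<Sum>b\<in>(Basis :: 'f set). sff M N i g D p (E b p) (E b)))"

definition non_umbilical_set ::
  "('b, 'f::euclidean_space) manifold \<Rightarrow> ('a, 'e::euclidean_space) manifold \<Rightarrow> ('b \<Rightarrow> 'a) \<Rightarrow>
   ('a \<Rightarrow> 'a tvec \<Rightarrow> 'a tvec \<Rightarrow> real) \<Rightarrow> 'a conn \<Rightarrow> 'b set" where
  "non_umbilical_set M N i g D =
     {p \<in> points M. \<exists>X Y. field_near M p X \<and> field_near M p Y \<and>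
        sff M N i g D p (X p) Y \<noteq>
          induced_metric N i g p (X p) (Y p) *\<^sub>T mean_curvature M N i g D p}"

definition cov_deriv_sff ::
  "('b, 'f::euclidean_space) manifold \<Rightarrow> ('a, 'e::euclidean_space) manifold \<Rightarrow> ('b \<Rightarrow> 'a) \<Rightarrow>
   ('a \<Rightarrow> 'a tvec \<Rightarrow> 'a tvec \<Rightarrow> real) \<Rightarrow> 'a conn \<Rightarrow>
   ('b \<Rightarrow> 'b tvec) \<Rightarrow> ('b \<Rightarrow> 'b tvec) \<Rightarrow> ('b \<Rightarrow> 'b tvec) \<Rightarrow> 'b \<Rightarrow> 'a tvec" where
  "cov_deriv_sff M N i g D X Y Z p =
     normal_conn M N i g D p (X p) (\<lambda>q. sff M N i g D q (Y q) Z)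
     - sff M N i g D p (ind_conn M N i g D p (X p) Y) Z
     - sff M N i g D p (Y p) (\<lambda>q. ind_conn M N i g D q (X q) Z)"

definition parallel_sff ::
  "('b, 'f::euclidean_space) manifold \<Rightarrow> ('a, 'e::euclidean_space) manifold \<Rightarrow> ('b \<Rightarrow> 'a) \<Rightarrow>
   ('a \<Rightarrow> 'a tvec \<Rightarrow> 'a tvec \<Rightarrow> real) \<Rightarrow> 'a conn \<Rightarrow> bool" where
  "parallel_sff M N i g D \<longleftrightarrow>
     (\<forall>p\<in>points M. \<forall>X Y Z. field_near M p X \<longrightarrow> field_near M p Y \<longrightarrow> field_near M p Z \<longrightarrow>
        cov_deriv_sff M N i g D X Y Z p = 0)"

definition chaki_pseudo_parallel ::
  "('b, 'f::euclidean_space) manifold \<Rightarrow> ('a, 'e::euclidean_space) manifold \<Rightarrow> ('b \<Rightarrow> 'a) \<Rightarrow>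
   ('a \<Rightarrow> 'a tvec \<Rightarrow> 'a tvec \<Rightarrow> real) \<Rightarrow> 'a conn \<Rightarrow> ('b \<Rightarrow> 'b tvec \<Rightarrow> real) \<Rightarrow> bool" where
  "chaki_pseudo_parallel M N i g D \<alpha> \<longleftrightarrow>
     one_form M \<alpha> \<and> (\<forall>p\<in>points M. \<exists>v\<in>tangent_space M p. \<alpha> p v \<noteq> 0) \<and>
     (\<forall>p\<in>points M. \<forall>X Y Z. field_near M p X \<longrightarrow> field_near M p Y \<longrightarrow> field_near M p Z \<longrightarrow>
        cov_deriv_sff M N i g D X Y Z p =
          (2 * \<alpha> p (X p)) *\<^sub>T sff M N i g D p (Y p) Z
          + \<alpha> p (Y p) *\<^sub>T sff M N i g D p (X p) Z
          + \<alpha> p (Z p) *\<^sub>T sff M N i g D p (X p) Y)"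

definition curv_dot_sff ::
  "('b, 'f::euclidean_space) manifold \<Rightarrow> ('a, 'e::euclidean_space) manifold \<Rightarrow> ('b \<Rightarrow> 'a) \<Rightarrow>
   ('a \<Rightarrow> 'a tvec \<Rightarrow> 'a tvec \<Rightarrow> real) \<Rightarrow> 'a conn \<Rightarrow>
   ('b \<Rightarrow> 'b tvec) \<Rightarrow> ('b \<Rightarrow> 'b tvec) \<Rightarrow> ('b \<Rightarrow> 'b tvec) \<Rightarrow> ('b \<Rightarrow> 'b tvec) \<Rightarrow> 'b \<Rightarrow> 'a tvec" where
  "curv_dot_sff M N i g D X Y Z U p =
     curvature M (normal_conn M N i g D) X Y (\<lambda>q. sff M N i g D q (Z q) U) p
     - sff M N i g D p (curvature M (ind_conn M N i g D) X Y Z p) U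
     - sff M N i g D p (Z p) (curvature M (ind_conn M N i g D) X Y U)"

definition Q_sff ::
  "('b, 'f::euclidean_space) manifold \<Rightarrow> ('a, 'e::euclidean_space) manifold \<Rightarrow> ('b \<Rightarrow> 'a) \<Rightarrow>
   ('a \<Rightarrow> 'a tvec \<Rightarrow> 'a tvec \<Rightarrow> real) \<Rightarrow> 'a conn \<Rightarrow>
   ('b \<Rightarrow> 'b tvec) \<Rightarrow> ('b \<Rightarrow> 'b tvec) \<Rightarrow> ('b \<Rightarrow> 'b tvec) \<Rightarrow> ('b \<Rightarrow> 'b tvec) \<Rightarrow> 'b \<Rightarrow> 'a tvec" where
  "Q_sff M N i g D Z U X Y p =
     induced_metric N i g p (Y p) (Z p) *\<^sub>T sff M N i g D p (X p) U
     - induced_metric N i g p (X p) (Z p) *\<^sub>T sff M N i g D p (Y p) U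
     + induced_metric N i g p (Y p) (U p) *\<^sub>T sff M N i g D p (X p) Z
     - induced_metric N i g p (X p) (U p) *\<^sub>T sff M N i g D p (Y p) Z"

definition semiparallel_sff ::
  "('b, 'f::euclidean_space) manifold \<Rightarrow> ('a, 'e::euclidean_space) manifold \<Rightarrow> ('b \<Rightarrow> 'a) \<Rightarrow>
   ('a \<Rightarrow> 'a tvec \<Rightarrow> 'a tvec \<Rightarrow> real) \<Rightarrow> 'a conn \<Rightarrow> bool" where
  "semiparallel_sff M N i g D \<longleftrightarrow>
     (\<forall>p\<in>points M. \<forall>X Y Z U. field_near M p X \<longrightarrow> field_near M p Y \<longrightarrow> field_near M p Z \<longrightarrow>
        field_near M p U \<longrightarrow> curv_dot_sff M N i g D X Y Z U p = 0)"

text \<open>The function \<open>L\<close> is only defined on the set \<open>W\<close> where the Levi-Civita second fundamental form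
  is not umbilical, so the equation is imposed there. \<open>W\<close> does not depend on the connection \<open>D\<close>
  for which pseudo-parallelity is considered and is therefore an argument of its own.\<close>

definition deszcz_pseudo_parallel ::
  "('b, 'f::euclidean_space) manifold \<Rightarrow> ('a, 'e::euclidean_space) manifold \<Rightarrow> ('b \<Rightarrow> 'a) \<Rightarrow>
   ('a \<Rightarrow> 'a tvec \<Rightarrow> 'a tvec \<Rightarrow> real) \<Rightarrow> 'b set \<Rightarrow> 'a conn \<Rightarrow> ('b \<Rightarrow> real) \<Rightarrow> bool" where
  "deszcz_pseudo_parallel M N i g W D L \<longleftrightarrow>
     (\<forall>p\<in>W. \<forall>X Y Z U. field_near M p X \<longrightarrow> field_near M p Y \<longrightarrow> field_near M p Z \<longrightarrow>
        field_near M p U \<longrightarrow>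
        curv_dot_sff M N i g D X Y Z U p = L p *\<^sub>T Q_sff M N i g D Z U X Y p)"

end

(*  By the formulas for the semisymmetric connection its second fundamental form equals the
    Levi-Civita one, h. Since the Levi-Civita derivative of xi along M is the tangent vector
    - beta phi X, we have h(X, xi) = 0, and h is symmetric because the pullback connection is
    torsion-free. Setting one argument of the covariant derivative of h equal to xi gives
    beta h(phi X, Y) - h(X, Y), and setting X = U = xi in the curvature condition gives
    beta^2 h(Y, Z) + beta h(phi Y, Z), because normality makes phi parallel along xi. Each of the
    conditions therefore reads a h(X, Y) + b h(phi X, Y) = 0; replacing X by phi X turns this into a
    linear system of determinant a^2 + b^2, which the respective hypothesis makes nonzero.
    Where h is umbilical, h(xi, xi) = 0 forces the mean curvature, hence h, to vanish.

    For the converse it must be known that covariant derivatives of smooth fields on M are smooth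
    fields on M: a field along the immersion that is smooth and tangent to M has smooth
    coefficients with respect to the coordinate fields, by Gram-Schmidt elimination applied to the
    columns of the Jacobian. *)

theory Submission
  imports Defs
begin

section \<open>Calculus of smooth functions\<close>

text \<open>The second argument of the second fundamental form is a field, and
  \<open>cov_deriv_sff\<close> and the curvature term insert covariant derivatives there, so the
  symmetry of h is available only once such a derivative is known to be smooth. This is why, towards
  total geodesicity, every condition is tested with \<xi> in the last slot: the derivative -\<beta>
  \<phi> X + X - \<eta>(X) \<xi> of \<xi> and the curvature term R(\<xi>, Y) \<xi> are explicit
  smooth expressions. The coefficients of the linear relation are a = \<alpha>(\<xi>) + 1, b =
  -\<beta> in the Chaki case, with 0 in place of \<alpha>(\<xi>) for parallelity, and a = L +
  \<beta>^2, b = \<beta> in the Deszcz case, with L = 0 for semiparallelity. In this last case the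
  determinant is \<beta>^2 (\<beta>^2 + 1); its second factor is positive, so it is nonzero exactly
  where \<beta> is, and the implication from semiparallelity is stated for \<beta> without zeros on
  M.\<close>

lemma Ck_on_subset: "Ck_on k S f \<Longrightarrow> T \<subseteq> S \<Longrightarrow> Ck_on k T f"
  by (induction k arbitrary: f) (auto intro: continuous_on_subset)

lemma has_derivative_cong_open:
  assumes "open S" "x \<in> S" "\<And>y. y \<in> S \<Longrightarrow> f y = g y"
  shows "(f has_derivative D) (at x) \<longleftrightarrow> (g has_derivative D) (at x)"
  using assms by (metis has_derivative_transform_within_open)

text \<open>\<open>frechet_derivative\<close> is a choice among the derivatives at the point. Both
  functions have the same derivatives there, so the choices agree even where no derivative
  exists.\<close>

lemma frechet_derivative_cong_open:
  assumes "open S" "x \<in> S" "\<And>y. y \<in> S \<Longrightarrow> f y = g y"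
  shows "frechet_derivative f (at x) = frechet_derivative g (at x)"
  unfolding frechet_derivative_def using has_derivative_cong_open[OF assms] by simp

lemma differentiable_cong_open:
  assumes "open S" "x \<in> S" "\<And>y. y \<in> S \<Longrightarrow> f y = g y"
  shows "f differentiable (at x) \<longleftrightarrow> g differentiable (at x)"
  unfolding differentiable_def using has_derivative_cong_open[OF assms] by simp

text \<open>Derivative formulas hold only on \<open>S\<close>; in the inductions below this lemma
  carries the class of the formula over to the actual derivative.\<close>

lemma Ck_on_cong:
  assumes "open S" "\<And>y. y \<in> S \<Longrightarrow> f y = g y" "Ck_on k S f"
  shows "Ck_on k S g"
  using assms(2,3)
proof (induction k arbitrary: f g)
  case 0
  then show ?case using continuous_on_cong by (metis Ck_on.simps(1))
next
  case (Suc k)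
  have "Ck_on k S (\<lambda>x. frechet_derivative g (at x) v)" for v
  proof (rule Suc.IH)
    show "Ck_on k S (\<lambda>x. frechet_derivative f (at x) v)" using Suc.prems by simp
    show "frechet_derivative f (at x) v = frechet_derivative g (at x) v" if "x \<in> S" for x
      using frechet_derivative_cong_open[OF \<open>open S\<close> that] Suc.prems(1) by metis
  qed
  moreover have "g differentiable (at x)" if "x \<in> S" for x
    using differentiable_cong_open[OF \<open>open S\<close> that] Suc.prems that by (metis Ck_on.simps(2))
  ultimately show ?case by simp
qed

lemma Ck_on_continuous: "Ck_on k S f \<Longrightarrow> continuous_on S f"
  by (cases k)
    (auto intro: continuous_at_imp_continuous_on differentiable_imp_continuous_within)

lemma Ck_on_Suc_D: "Ck_on (Suc k) S f \<Longrightarrow> Ck_on k S f"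
proof (induction k arbitrary: f)
  case 0
  then show ?case using Ck_on_continuous by (metis Ck_on.simps(1))
qed auto

lemma Ck_on_const: "Ck_on k S (\<lambda>x. c)"
  by (induction k arbitrary: c) (auto simp: frechet_derivative_const)

lemma frechet_derivative_add:
  assumes "f differentiable (at x)" "g differentiable (at x)"
  shows "frechet_derivative (\<lambda>x. f x + g x) (at x) v =
    frechet_derivative f (at x) v + frechet_derivative g (at x) v"
proof -
  have "((\<lambda>x. f x + g x) has_derivative
      (\<lambda>v. frechet_derivative f (at x) v + frechet_derivative g (at x) v)) (at x)"
    using assms by (intro has_derivative_add) (simp_all add: frechet_derivative_works[symmetric])
  then show ?thesis using frechet_derivative_at by metis
qed

lemma Ck_on_add:
  assumes "Ck_on k S f" "Ck_on k S g" "open S"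
  shows "Ck_on k S (\<lambda>x. f x + g x)"
  using assms(1,2)
proof (induction k arbitrary: f g)
  case (Suc k)
  have "Ck_on k S (\<lambda>x. frechet_derivative (\<lambda>x. f x + g x) (at x) v)" for v
    by (rule Ck_on_cong[OF \<open>open S\<close>, of "\<lambda>x. frechet_derivative f (at x) v + frechet_derivative g (at x) v"])
      (use Suc in \<open>auto simp: frechet_derivative_add\<close>)
  then show ?case using Suc.prems by simp
qed (auto intro: continuous_intros)

lemma Ck_on_sum:
  assumes "\<And>j. j \<in> J \<Longrightarrow> Ck_on k S (f j)" "open S"
  shows "Ck_on k S (\<lambda>x. \<Sum>j\<in>J. f j x)"
  using assms(1)
  by (induction J rule: infinite_finite_induct) (auto intro: Ck_on_const Ck_on_add assms(2))

lemma frechet_derivative_mult_real: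
  fixes f g :: "'e::real_normed_vector \<Rightarrow> real"
  assumes "f differentiable (at x)" "g differentiable (at x)"
  shows "frechet_derivative (\<lambda>x. f x * g x) (at x) v =
    f x * frechet_derivative g (at x) v + frechet_derivative f (at x) v * g x"
proof -
  have "((\<lambda>x. f x * g x) has_derivative
      (\<lambda>v. f x * frechet_derivative g (at x) v + frechet_derivative f (at x) v * g x)) (at x)"
    using assms by (intro has_derivative_mult) (simp_all add: frechet_derivative_works[symmetric])
  then show ?thesis using frechet_derivative_at by metis
qed

lemma Ck_on_mult:
  fixes f g :: "'e::real_normed_vector \<Rightarrow> real"
  assumes "Ck_on k S f" "Ck_on k S g" "open S"
  shows "Ck_on k S (\<lambda>x. f x * g x)"
  using assms(1,2)
proof (induction k arbitrary: f g)
  case (Suc k)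
  have "Ck_on k S (\<lambda>x. frechet_derivative (\<lambda>x. f x * g x) (at x) v)" for v
    by (rule Ck_on_cong[OF \<open>open S\<close>,
          of "\<lambda>x. f x * frechet_derivative g (at x) v + frechet_derivative f (at x) v * g x"])
      (use Suc Ck_on_Suc_D[OF Suc.prems(1)] Ck_on_Suc_D[OF Suc.prems(2)] in
        \<open>auto simp: frechet_derivative_mult_real intro!: Ck_on_add assms(3)\<close>)
  then show ?case using Suc.prems by simp
qed (auto intro: continuous_intros)

text \<open>The derivative of 1/f is -f'/f^2, in which 1/f occurs only to the order already reached,
  so the induction closes.\<close>

lemma Ck_on_inverse:
  fixes f :: "'e::real_normed_vector \<Rightarrow> real"
  assumes "Ck_on k S f" "open S" "\<And>x. x \<in> S \<Longrightarrow> f x \<noteq> 0"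
  shows "Ck_on k S (\<lambda>x. inverse (f x))"
  using assms(1)
proof (induction k)
  case 0
  then show ?case using assms(3) by (auto intro: continuous_intros)
next
  case (Suc k)
  have IH: "Ck_on k S (\<lambda>x. inverse (f x))" using Suc Ck_on_Suc_D by blast
  have d: "((\<lambda>x. inverse (f x)) has_derivative
      (\<lambda>v. - (inverse (f x) * frechet_derivative f (at x) v * inverse (f x)))) (at x)" if "x \<in> S" for x
    using Suc.prems that assms(3)
    by (intro Deriv.has_derivative_inverse) (simp_all add: frechet_derivative_works[symmetric])
  have "Ck_on k S (\<lambda>x. frechet_derivative (\<lambda>x. inverse (f x)) (at x) v)" for v
  proof (rule Ck_on_cong[OF \<open>open S\<close>])
    show "Ck_on k S (\<lambda>x. (-1) * (inverse (f x) * frechet_derivative f (at x) v * inverse (f x)))"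
      using IH Suc.prems by (intro Ck_on_mult Ck_on_const assms(2)) auto
    show "(-1) * (inverse (f x) * frechet_derivative f (at x) v * inverse (f x)) =
      frechet_derivative (\<lambda>x. inverse (f x)) (at x) v" if "x \<in> S" for x
      using frechet_derivative_at[OF d[OF that]] by (metis mult_minus1)
  qed
  moreover have "(\<lambda>x. inverse (f x)) differentiable (at x)" if "x \<in> S" for x
    using d[OF that] unfolding differentiable_def by blast
  ultimately show ?case by simp
qed

text \<open>Chain rule with the inner function resolved into components: the derivative becomes a
  finite sum of products of real functions, to which \<open>Ck_on_sum\<close> and
  \<open>Ck_on_mult\<close> apply.\<close>

lemma frechet_derivative_componentwise:
  fixes F :: "'e::euclidean_space \<Rightarrow> real" and f :: "'d::real_normed_vector \<Rightarrow> 'e"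
  assumes F: "F differentiable (at (f x))" and f: "\<And>b. b \<in> Basis \<Longrightarrow> (\<lambda>x. f x \<bullet> b) differentiable (at x)"
  shows "((\<lambda>x. F (f x)) has_derivative
      (\<lambda>v. \<Sum>b\<in>Basis. frechet_derivative F (at (f x)) b * frechet_derivative (\<lambda>x. f x \<bullet> b) (at x) v)) (at x)"
proof -
  let ?f' = "\<lambda>v. \<Sum>b\<in>Basis. frechet_derivative (\<lambda>x. f x \<bullet> b) (at x) v *\<^sub>R b"
  have "(f has_derivative ?f') (at x)"
    unfolding has_derivative_componentwise_within[of f ?f']
    using f by (auto simp: inner_sum_left inner_Basis if_distrib frechet_derivative_works
        cong: if_cong)
  then have "(F \<circ> f has_derivative frechet_derivative F (at (f x)) \<circ> ?f') (at x)"
    using F by (intro diff_chain_at) (auto simp: frechet_derivative_works[symmetric])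
  moreover have lin: "linear (frechet_derivative F (at (f x)))"
    using F by (rule linear_frechet_derivative)
  have "frechet_derivative F (at (f x)) \<circ> ?f' = (\<lambda>v. \<Sum>b\<in>Basis. frechet_derivative F (at (f x)) b * frechet_derivative (\<lambda>x. f x \<bullet> b) (at x) v)"
    by (simp add: fun_eq_iff linear_sum[OF lin] linear_scale[OF lin] mult.commute)
  ultimately show ?thesis by (simp add: o_def)
qed

text \<open>Induction with \<open>F\<close> general and \<open>f\<close> fixed: the derivative
  contains partial derivatives of \<open>F\<close>, again composed with \<open>f\<close>.\<close>

lemma Ck_on_compose:
  fixes F :: "'e::euclidean_space \<Rightarrow> real" and f :: "'d::real_normed_vector \<Rightarrow> 'e"
  assumes "Ck_on k T F" "\<And>b. b \<in> Basis \<Longrightarrow> Ck_on k S (\<lambda>x. f x \<bullet> b)" "open S" "f ` S \<subseteq> T"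
  shows "Ck_on k S (\<lambda>x. F (f x))"
  using assms(1,2)
proof (induction k arbitrary: F)
  case 0
  have "continuous_on S f" using 0 continuous_on_componentwise[of S f] by simp
  then show ?case using 0 assms(4) continuous_on_compose2 by (metis Ck_on.simps(1))
next
  case (Suc k)
  have IH: "Ck_on k S (\<lambda>x. G (f x))" if "Ck_on k T G" for G :: "'e \<Rightarrow> real"
    using Suc.IH[OF that] Suc.prems(2) Ck_on_Suc_D by blast
  have d: "((\<lambda>x. F (f x)) has_derivative
      (\<lambda>v. \<Sum>b\<in>Basis. frechet_derivative F (at (f x)) b * frechet_derivative (\<lambda>x. f x \<bullet> b) (at x) v)) (at x)"
    if "x \<in> S" for x
    using Suc.prems that assms(4) by (intro frechet_derivative_componentwise) auto
  have "Ck_on k S (\<lambda>x. frechet_derivative (\<lambda>x. F (f x)) (at x) v)" for v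
  proof (rule Ck_on_cong[OF \<open>open S\<close>])
    show "Ck_on k S (\<lambda>x. \<Sum>b\<in>Basis. frechet_derivative F (at (f x)) b * frechet_derivative (\<lambda>x. f x \<bullet> b) (at x) v)"
      using Suc.prems by (intro Ck_on_sum Ck_on_mult assms(3) IH) auto
    show "(\<Sum>b\<in>Basis. frechet_derivative F (at (f x)) b * frechet_derivative (\<lambda>x. f x \<bullet> b) (at x) v) =
      frechet_derivative (\<lambda>x. F (f x)) (at x) v" if "x \<in> S" for x
      using frechet_derivative_at[OF d[OF that]] by metis
  qed
  moreover have "(\<lambda>x. F (f x)) differentiable (at x)" if "x \<in> S" for x
    using d[OF that] unfolding differentiable_def by blast
  ultimately show ?case by simp
qed

lemma Ck_on_inner:
  fixes f :: "'d::real_normed_vector \<Rightarrow> 'e::real_inner"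
  assumes "Ck_on k S f" "open S"
  shows "Ck_on k S (\<lambda>x. f x \<bullet> b)"
  using assms(1)
proof (induction k arbitrary: f)
  case (Suc k)
  have d: "((\<lambda>x. f x \<bullet> b) has_derivative (\<lambda>v. frechet_derivative f (at x) v \<bullet> b)) (at x)" if "x \<in> S" for x
    using Suc.prems that by (intro has_derivative_inner_left) (simp add: frechet_derivative_works[symmetric])
  have "Ck_on k S (\<lambda>x. frechet_derivative (\<lambda>x. f x \<bullet> b) (at x) v)" for v
  proof (rule Ck_on_cong[OF \<open>open S\<close>])
    show "Ck_on k S (\<lambda>x. frechet_derivative f (at x) v \<bullet> b)" using Suc by simp
    show "frechet_derivative f (at x) v \<bullet> b = frechet_derivative (\<lambda>x. f x \<bullet> b) (at x) v" if "x \<in> S" for x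
      using frechet_derivative_at[OF d[OF that]] by metis
  qed
  moreover have "(\<lambda>x. f x \<bullet> b) differentiable (at x)" if "x \<in> S" for x
    using d[OF that] unfolding differentiable_def by blast
  ultimately show ?case by simp
qed (auto intro: continuous_intros)

lemma smooth_on_differentiable: "smooth_on S f \<Longrightarrow> x \<in> S \<Longrightarrow> f differentiable (at x)"
  unfolding smooth_on_def by (metis Ck_on.simps(2))

lemma smooth_on_frechet: "smooth_on S f \<Longrightarrow> smooth_on S (\<lambda>x. frechet_derivative f (at x) v)"
  unfolding smooth_on_def by (metis Ck_on.simps(2))

lemma smooth_on_continuous: "smooth_on S f \<Longrightarrow> continuous_on S f"
  unfolding smooth_on_def by (metis Ck_on.simps(1))

section \<open>Smooth functions and tangent vectors on a manifold\<close>

text \<open>Neighbourhood statements are phrased with this filter so that finitely many of them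
  combine by elimination. Outside the space the filter is trivial, hence the side conditions that
  \<open>p\<close> is a point.\<close>

abbreviation near :: "('a, 'e) manifold \<Rightarrow> 'a \<Rightarrow> 'a filter" where
  "near M p \<equiv> nhdsin (topo M) p"

lemma near_openI: "openin (topo M) U \<Longrightarrow> p \<in> U \<Longrightarrow> (\<And>q. q \<in> U \<Longrightarrow> P q) \<Longrightarrow> eventually P (near M p)"
  by (auto simp: eventually_nhdsin)

lemma near_obtain:
  assumes "eventually P (near M p)" "p \<in> points M"
  obtains U where "openin (topo M) U" "p \<in> U" "\<forall>q\<in>U. P q"
proof -
  have "\<exists>U. openin (topo M) U \<and> p \<in> U \<and> (\<forall>q\<in>U. P q)"
    using assms by (simp add: eventually_nhdsin)
  then show ?thesis by (elim exE conjE) (rule that)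
qed

lemma near_self: "eventually P (near M p) \<Longrightarrow> p \<in> points M \<Longrightarrow> P p"
  by (auto simp: eventually_nhdsin)

lemma near_near:
  "eventually P (near M p) \<Longrightarrow> p \<in> points M \<Longrightarrow> \<forall>\<^sub>F q in near M p. eventually P (near M q)"
proof -
  assume "eventually P (near M p)" "p \<in> points M"
  then obtain U where U: "openin (topo M) U" "p \<in> U" "\<forall>q\<in>U. P q" by (rule near_obtain)
  show ?thesis
  proof (rule near_openI[OF U(1,2)])
    fix q assume "q \<in> U"
    then show "eventually P (near M q)" using U(3) by (intro near_openI[OF U(1)]) simp_all
  qed
qed

lemma near_points: "\<forall>\<^sub>F q in near M p. q \<in> points M"
  by (cases "p \<in> points M") (auto intro: near_openI[OF openin_topspace])

lemma sum_fun_apply: "(\<Sum>j\<in>J. f j) x = (\<Sum>j\<in>J. f j x)"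
  by (induction J rule: infinite_finite_induct) auto

lemma tscale_apply [simp]: "(r *\<^sub>T v) u = r * v u"
  by (simp add: tscale_def)

locale smooth_mfd =
  fixes M :: "('a, 'e::euclidean_space) manifold"
  assumes smooth_manifold: "smooth_manifold M"
begin

lemma charts_at_points: "c \<in> charts_at M p \<Longrightarrow> p \<in> points M"
  using smooth_manifold unfolding smooth_manifold_def charts_at_def by blast

lemma charts_at_atlas: "c \<in> charts_at M p \<Longrightarrow> c \<in> atlas M \<and> p \<in> fst c"
  by (simp add: charts_at_def)

lemma chart_exists: "p \<in> points M \<Longrightarrow> \<exists>c. c \<in> charts_at M p"
  using smooth_manifold unfolding smooth_manifold_def charts_at_def by blast

lemma chart_domain_open: "c \<in> atlas M \<Longrightarrow> openin (topo M) (fst c)"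
  using smooth_manifold unfolding smooth_manifold_def by blast

lemma chart_homeomorphic:
  "c \<in> atlas M \<Longrightarrow>
    homeomorphic_map (subtopology (topo M) (fst c)) (top_of_set (snd c ` fst c)) (snd c)"
  using smooth_manifold unfolding smooth_manifold_def by blast

lemma chart_domain_subset: "c \<in> atlas M \<Longrightarrow> fst c \<subseteq> points M"
  using chart_domain_open openin_subset by blast

lemma chart_inj: "c \<in> atlas M \<Longrightarrow> inj_on (snd c) (fst c)"
  using chart_homeomorphic[of c] chart_domain_subset[of c]
  by (auto simp: homeomorphic_eq_everything_map inf.absorb2)

lemma chart_inv_snd: "c \<in> charts_at M p \<Longrightarrow> chart_inv c (snd c p) = p"
  by (simp add: chart_inv_def charts_at_def chart_inj)

lemma chart_inv_mem: "c \<in> atlas M \<Longrightarrow> q \<in> fst c \<Longrightarrow> chart_inv c (snd c q) = q"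
  by (simp add: chart_inv_def chart_inj)

lemma open_chart_image:
  assumes "c \<in> atlas M" "openin (topo M) U"
  shows "open (snd c ` (fst c \<inter> U))"
proof -
  have "openin (subtopology (topo M) (fst c)) (fst c \<inter> U)"
    using assms openin_subtopology_Int2 by blast
  then have "openin (top_of_set (snd c ` fst c)) (snd c ` (fst c \<inter> U))"
    using homeomorphic_imp_open_map[OF chart_homeomorphic[OF assms(1)]] by (simp add: open_map_def)
  moreover have "open (snd c ` fst c)"
    using assms(1) smooth_manifold unfolding smooth_manifold_def by blast
  ultimately show ?thesis using openin_open_trans by blast
qed

lemma open_chart_vimage:
  assumes "c \<in> atlas M" "open S"
  shows "openin (topo M) {q \<in> fst c. snd c q \<in> S}"
proof -
  have "continuous_map (subtopology (topo M) (fst c)) (top_of_set (snd c ` fst c)) (snd c)"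
    using homeomorphic_imp_continuous_map[OF chart_homeomorphic[OF assms(1)]] .
  moreover have "openin (top_of_set (snd c ` fst c)) (snd c ` fst c \<inter> S)"
    using assms(2) by (simp add: openin_open_Int)
  ultimately have "openin (subtopology (topo M) (fst c))
      {q \<in> topspace (subtopology (topo M) (fst c)). snd c q \<in> snd c ` fst c \<inter> S}"
    by (rule openin_continuous_map_preimage)
  moreover have "{q \<in> topspace (subtopology (topo M) (fst c)). snd c q \<in> snd c ` fst c \<inter> S} =
      {q \<in> fst c. snd c q \<in> S}"
    using chart_domain_subset[OF assms(1)] by auto
  ultimately show ?thesis
    using openin_trans_full chart_domain_open[OF assms(1)] by metis
qed

lemma chart_near:
  assumes "c \<in> charts_at M p" "open S" "snd c p \<in> S"
  shows "\<forall>\<^sub>F q in near M p. c \<in> charts_at M q \<and> snd c q \<in> S"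
  using assms by (intro near_openI[OF open_chart_vimage]) (auto simp: charts_at_def)

lemma charts_at_near: "c \<in> charts_at M p \<Longrightarrow> \<forall>\<^sub>F q in near M p. c \<in> charts_at M q"
  using chart_near[of c p UNIV] by simp

lemma transition_smooth:
  assumes "c \<in> atlas M" "c' \<in> atlas M"
  shows "smooth_on (snd c ` (fst c \<inter> fst c')) (snd c' \<circ> chart_inv c)"
  using smooth_manifold assms unfolding smooth_manifold_def by blast

section \<open>Functions smooth near a point\<close>

lemma smooth_near_points: "smooth_near M p u \<Longrightarrow> p \<in> points M"
  unfolding smooth_near_def using openin_subset by blast

text \<open>One chart suffices: on the preimage \<open>U\<close> of \<open>S\<close>, the expression
  in any other chart is the given one composed with a smooth transition map.\<close>

lemma smooth_near_chart:
  assumes c: "c \<in> charts_at M p"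
  shows "smooth_near M p u \<longleftrightarrow>
    (\<exists>S. open S \<and> snd c p \<in> S \<and> S \<subseteq> snd c ` fst c \<and> smooth_on S (u \<circ> chart_inv c))"
proof
  assume "smooth_near M p u"
  then obtain U where U: "openin (topo M) U" "p \<in> U" "smooth_on (snd c ` (fst c \<inter> U)) (u \<circ> chart_inv c)"
    using c unfolding smooth_near_def charts_at_def by blast
  then show "\<exists>S. open S \<and> snd c p \<in> S \<and> S \<subseteq> snd c ` fst c \<and> smooth_on S (u \<circ> chart_inv c)"
    using c open_chart_image[of c U] charts_at_atlas[OF c]
    by (intro exI[of _ "snd c ` (fst c \<inter> U)"]) auto
next
  assume "\<exists>S. open S \<and> snd c p \<in> S \<and> S \<subseteq> snd c ` fst c \<and> smooth_on S (u \<circ> chart_inv c)"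
  then obtain S where S: "open S" "snd c p \<in> S" "smooth_on S (u \<circ> chart_inv c)" by blast
  have ca: "c \<in> atlas M" "p \<in> fst c" using c by (auto simp: charts_at_def)
  define U where "U = {q \<in> fst c. snd c q \<in> S}"
  have U: "openin (topo M) U" unfolding U_def using open_chart_vimage ca S by blast
  have "smooth_on (snd c' ` (fst c' \<inter> U)) (u \<circ> chart_inv c')" if c': "c' \<in> atlas M" for c'
    unfolding smooth_on_def
  proof
    fix k
    let ?R = "snd c' ` (fst c' \<inter> U)"
    have opn: "open ?R" using open_chart_image[OF c' U] .
    have inv: "chart_inv c' x \<in> fst c' \<inter> U" if "x \<in> ?R" for x
      using that by (auto simp: chart_inv_mem[OF c'])
    have "Ck_on k ?R (\<lambda>x. (u \<circ> chart_inv c) ((snd c \<circ> chart_inv c') x))"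
    proof (rule Ck_on_compose[of k S])
      show "Ck_on k S (u \<circ> chart_inv c)" using S(3) by (simp add: smooth_on_def)
      show "Ck_on k ?R (\<lambda>x. (snd c \<circ> chart_inv c') x \<bullet> b)" for b
      proof (rule Ck_on_inner[OF _ opn])
        have "Ck_on k (snd c' ` (fst c' \<inter> fst c)) (snd c \<circ> chart_inv c')"
          using transition_smooth[OF c' ca(1)] by (simp add: smooth_on_def)
        then show "Ck_on k ?R (snd c \<circ> chart_inv c')"
          by (rule Ck_on_subset) (auto simp: U_def)
      qed
      show "(snd c \<circ> chart_inv c') ` ?R \<subseteq> S"
        using inv by (auto simp: U_def)
    qed (rule opn)
    then show "Ck_on k ?R (u \<circ> chart_inv c')"
    proof (rule Ck_on_cong[OF opn, rotated])
      show "(u \<circ> chart_inv c) ((snd c \<circ> chart_inv c') x) = (u \<circ> chart_inv c') x" if "x \<in> ?R" for x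
        using inv[OF that] chart_inv_mem[OF ca(1)] by (simp add: U_def)
    qed
  qed
  then show "smooth_near M p u"
    unfolding smooth_near_def using U ca S by (intro exI[of _ U]) (auto simp: U_def)
qed

lemma smooth_near_near: "smooth_near M p u \<Longrightarrow> \<forall>\<^sub>F q in near M p. smooth_near M q u"
  unfolding smooth_near_def by (elim exE) (rule near_openI, auto)

lemma smooth_near_cong:
  assumes "smooth_near M p u" "\<forall>\<^sub>F q in near M p. u q = w q"
  shows "smooth_near M p w"
proof -
  obtain U where U: "openin (topo M) U" "p \<in> U"
      "\<And>c. c \<in> atlas M \<Longrightarrow> smooth_on (snd c ` (fst c \<inter> U)) (u \<circ> chart_inv c)"
    using assms(1) unfolding smooth_near_def by blast
  obtain V where V: "openin (topo M) V" "p \<in> V" "\<forall>q\<in>V. u q = w q"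
    using assms(2) smooth_near_points[OF assms(1)] by (rule near_obtain)
  have UV: "openin (topo M) (U \<inter> V)" using U V by blast
  have "smooth_on (snd c ` (fst c \<inter> (U \<inter> V))) (w \<circ> chart_inv c)" if c: "c \<in> atlas M" for c
    unfolding smooth_on_def
  proof
    fix k
    have "Ck_on k (snd c ` (fst c \<inter> (U \<inter> V))) (u \<circ> chart_inv c)"
      using U(3)[OF c] unfolding smooth_on_def by (blast intro: Ck_on_subset)
    then show "Ck_on k (snd c ` (fst c \<inter> (U \<inter> V))) (w \<circ> chart_inv c)"
      by (rule Ck_on_cong[OF open_chart_image[OF c UV], rotated])
        (auto simp: chart_inv_mem[OF c] V(3))
  qed
  then show ?thesis unfolding smooth_near_def using UV U V by (intro exI[of _ "U \<inter> V"]) auto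
qed

lemma smooth_near_common_domain:
  assumes c: "c \<in> charts_at M p" and "finite J" "\<And>j. j \<in> J \<Longrightarrow> smooth_near M p (f j)"
  shows "\<exists>S. open S \<and> snd c p \<in> S \<and> S \<subseteq> snd c ` fst c \<and> (\<forall>j\<in>J. smooth_on S (f j \<circ> chart_inv c))"
proof -
  have "\<forall>j\<in>J. \<exists>S. open S \<and> snd c p \<in> S \<and> S \<subseteq> snd c ` fst c \<and> smooth_on S (f j \<circ> chart_inv c)"
    using assms(3) smooth_near_chart[OF c] by blast
  then obtain S where S: "\<And>j. j \<in> J \<Longrightarrow> open (S j) \<and> snd c p \<in> S j \<and> S j \<subseteq> snd c ` fst c \<and>
      smooth_on (S j) (f j \<circ> chart_inv c)"
    by metis
  let ?T = "(snd c ` fst c) \<inter> (\<Inter>j\<in>J. S j)"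
  have "open ((\<Inter>j\<in>J. S j))" using S assms(2) by blast
  moreover have "open (snd c ` fst c)"
    using open_chart_image[of c "topspace (topo M)"] charts_at_atlas[OF c] chart_domain_subset[of c]
    by (simp add: inf.absorb1)
  ultimately have "open ?T" by blast
  moreover have "snd c p \<in> ?T" using S charts_at_atlas[OF c] by auto
  moreover have "smooth_on ?T (f j \<circ> chart_inv c)" if "j \<in> J" for j
  proof -
    have "?T \<subseteq> S j" using that by auto
    then show ?thesis using S[OF that] Ck_on_subset unfolding smooth_on_def by metis
  qed
  ultimately show ?thesis by (intro exI[of _ ?T]) auto
qed

lemma smooth_near_binary:
  assumes u: "smooth_near M p u" and w: "smooth_near M p w"
    and op: "\<And>k S. open S \<Longrightarrow> \<forall>f g. Ck_on k S f \<longrightarrow> Ck_on k S g \<longrightarrow> Ck_on k S (\<lambda>x::'e. op (f x :: real) (g x))"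
  shows "smooth_near M p (\<lambda>q. op (u q) (w q))"
proof -
  obtain c where c: "c \<in> charts_at M p" using chart_exists smooth_near_points u by blast
  \<comment> \<open>The pair is treated as a family indexed by \<open>bool\<close>, so that the
    common domain of a finite family can be used.\<close>
  let ?f = "\<lambda>b. if b then u else w"
  have "smooth_near M p (?f b)" for b using u w by (cases b) auto
  from smooth_near_common_domain[OF c finite this, of UNIV "\<lambda>b. b"] obtain S
    where S: "open S" "snd c p \<in> S" "S \<subseteq> snd c ` fst c"
      "\<And>b. smooth_on S (?f b \<circ> chart_inv c)"
    by auto
  have "smooth_on S (u \<circ> chart_inv c)" "smooth_on S (w \<circ> chart_inv c)"
    using S(4)[of True] S(4)[of False] by auto
  then have "smooth_on S ((\<lambda>q. op (u q) (w q)) \<circ> chart_inv c)"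
    using op[OF S(1)] by (simp add: smooth_on_def o_def)
  then show ?thesis using smooth_near_chart[OF c] S by blast
qed

lemma smooth_near_add: "smooth_near M p u \<Longrightarrow> smooth_near M p w \<Longrightarrow> smooth_near M p (\<lambda>q. u q + w q)"
  by (rule smooth_near_binary) (auto intro: Ck_on_add)

lemma smooth_near_mult: "smooth_near M p u \<Longrightarrow> smooth_near M p w \<Longrightarrow> smooth_near M p (\<lambda>q. u q * w q)"
  by (rule smooth_near_binary) (auto intro: Ck_on_mult)

lemma smooth_near_const: "p \<in> points M \<Longrightarrow> smooth_near M p (\<lambda>q. r)"
  unfolding smooth_near_def
  by (intro exI[of _ "points M"]) (auto simp: smooth_on_def o_def Ck_on_const)

lemma smooth_near_minus: "smooth_near M p u \<Longrightarrow> smooth_near M p (\<lambda>q. - u q)"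
  using smooth_near_mult[OF smooth_near_const[of p "-1"], of u] smooth_near_points by simp

lemma smooth_near_diff: "smooth_near M p u \<Longrightarrow> smooth_near M p w \<Longrightarrow> smooth_near M p (\<lambda>q. u q - w q)"
  using smooth_near_add[OF _ smooth_near_minus, of p u w] by simp

lemma smooth_near_sum:
  "p \<in> points M \<Longrightarrow> (\<And>j. j \<in> J \<Longrightarrow> smooth_near M p (f j)) \<Longrightarrow> smooth_near M p (\<lambda>q. \<Sum>j\<in>J. f j q)"
  by (induction J rule: infinite_finite_induct) (auto intro: smooth_near_const smooth_near_add)

text \<open>\<open>F\<close> is smooth only on \<open>T\<close>, as is the case for inversion and
  for functions written in chart coordinates. The second conclusion is a form of continuity of
  \<open>f\<close> at \<open>p\<close>, which the smooth components provide.\<close>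

lemma smooth_near_compose:
  fixes f :: "'a \<Rightarrow> 'd::euclidean_space"
  assumes p: "p \<in> points M" and f: "\<And>b. b \<in> Basis \<Longrightarrow> smooth_near M p (\<lambda>q. f q \<bullet> b)"
    and F: "smooth_on T F" "open T" "f p \<in> T"
  shows "smooth_near M p (\<lambda>q. F (f q) :: real)" and "\<forall>\<^sub>F q in near M p. f q \<in> T"
proof -
  obtain c where c: "c \<in> charts_at M p" using chart_exists p by blast
  obtain S where S: "open S" "snd c p \<in> S" "S \<subseteq> snd c ` fst c"
      "\<And>b. b \<in> Basis \<Longrightarrow> smooth_on S ((\<lambda>q. f q \<bullet> b) \<circ> chart_inv c)"
    using smooth_near_common_domain[OF c, of "Basis :: 'd set" "\<lambda>b q. f q \<bullet> b"] f by auto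
  have "continuous_on S (f \<circ> chart_inv c)"
    using S(4) smooth_on_continuous by (subst continuous_on_componentwise) (fastforce simp: o_def)
  then have opn: "open (S \<inter> (f \<circ> chart_inv c) -` T)"
    using S(1) F(2) continuous_open_preimage by blast
  let ?S = "S \<inter> (f \<circ> chart_inv c) -` T"
  have "smooth_on ?S ((\<lambda>q. F (f q)) \<circ> chart_inv c)"
    unfolding smooth_on_def
  proof
    fix k
    have "Ck_on k ?S (\<lambda>x. F ((f \<circ> chart_inv c) x))"
    proof (rule Ck_on_compose[of k T])
      show "Ck_on k ?S (\<lambda>x. (f \<circ> chart_inv c) x \<bullet> b)" if "b \<in> Basis" for b
        using S(4)[OF that] unfolding smooth_on_def o_def by (blast intro: Ck_on_subset)
    qed (use F opn in \<open>auto simp: smooth_on_def\<close>)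
    then show "Ck_on k ?S ((\<lambda>q. F (f q)) \<circ> chart_inv c)" by (simp add: o_def)
  qed
  moreover have mem: "snd c p \<in> ?S" using S F(3) chart_inv_snd[OF c] by simp
  ultimately show "smooth_near M p (\<lambda>q. F (f q))"
    using smooth_near_chart[OF c] S(3) opn by blast
  show "\<forall>\<^sub>F q in near M p. f q \<in> T"
    using chart_near[OF c opn mem] by eventually_elim (auto dest: chart_inv_snd)
qed

lemma smooth_near_inverse:
  assumes "smooth_near M p u" "u p \<noteq> 0"
  shows "smooth_near M p (\<lambda>q. inverse (u q))"
proof -
  have "smooth_on (- {0}) (\<lambda>x::real. x)"
    unfolding smooth_on_def
  proof
    show "Ck_on k (- {0}) (\<lambda>x::real. x)" for k
    proof (cases k)
      case (Suc j)
      have "frechet_derivative (\<lambda>x::real. x) (at x) = (\<lambda>x. x)" for x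
        using frechet_derivative_at[OF has_derivative_ident] by metis
      then show ?thesis using Suc by (simp add: Ck_on_const)
    qed auto
  qed
  then have "smooth_on (- {0}) (inverse :: real \<Rightarrow> real)"
    unfolding smooth_on_def using Ck_on_inverse[of _ "- {0}" "\<lambda>x. x"] by auto
  from smooth_near_compose(1)[OF smooth_near_points[OF assms(1)] _ this, of u] assms
  show ?thesis by (simp add: open_Compl)
qed

lemma smooth_near_coord:
  assumes c: "c \<in> charts_at M p"
  shows "smooth_near M p (\<lambda>q. snd c q \<bullet> b)"
proof -
  have ca: "c \<in> atlas M" "p \<in> fst c" using c by (auto simp: charts_at_def)
  have "smooth_on (snd c' ` (fst c' \<inter> fst c)) ((\<lambda>q. snd c q \<bullet> b) \<circ> chart_inv c')" if "c' \<in> atlas M" for c'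
    using transition_smooth[OF that ca(1)] Ck_on_inner[OF _ open_chart_image[OF that chart_domain_open[OF ca(1)]]]
    unfolding smooth_on_def o_def by blast
  then show ?thesis unfolding smooth_near_def
    using ca chart_domain_open by (intro exI[of _ "fst c"]) auto
qed

lemma smooth_near_differentiable:
  assumes "c \<in> charts_at M p" "smooth_near M p u"
  shows "(u \<circ> chart_inv c) differentiable (at (snd c p))"
proof -
  obtain S where "snd c p \<in> S" "smooth_on S (u \<circ> chart_inv c)"
    using iffD1[OF smooth_near_chart[OF assms(1)] assms(2)] by (elim exE conjE)
  then show ?thesis by (intro smooth_on_differentiable)
qed

lemma coord_vec_apply:
  "smooth_near M p u \<Longrightarrow> coord_vec M c p e u = frechet_derivative (u \<circ> chart_inv c) (at (snd c p)) e"
  by (simp add: coord_vec_def)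

lemma smooth_near_partial:
  assumes c: "c \<in> charts_at M p" and u: "smooth_near M p u"
  shows "smooth_near M p (\<lambda>q. frechet_derivative (u \<circ> chart_inv c) (at (snd c q)) e)"
proof -
  obtain S where S: "open S" "snd c p \<in> S" "smooth_on S (u \<circ> chart_inv c)"
    using u smooth_near_chart[OF c] by blast
  show ?thesis
    using smooth_near_compose(1)[OF charts_at_points[OF c] smooth_near_coord[OF c]
        smooth_on_frechet[OF S(3)] S(1,2)] .
qed

lemma smooth_near_coord_vec:
  assumes c: "c \<in> charts_at M p" and u: "smooth_near M p u"
  shows "smooth_near M p (\<lambda>q. coord_vec M c q e u)"
proof (rule smooth_near_cong[OF smooth_near_partial[OF c u]])
  show "\<forall>\<^sub>F q in near M p. frechet_derivative (u \<circ> chart_inv c) (at (snd c q)) e = coord_vec M c q e u"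
    using smooth_near_near[OF u] by eventually_elim (simp add: coord_vec_apply)
qed

section \<open>Tangent vectors in coordinates\<close>

lemma coord_vec_mem: "c \<in> charts_at M p \<Longrightarrow> coord_vec M c p e \<in> tangent_space M p"
  unfolding tangent_space_def by (rule CollectI, intro exI conjI, rule refl)

lemma tangent_cases:
  assumes "v \<in> tangent_space M p"
  obtains c e where "c \<in> charts_at M p" "v = coord_vec M c p e"
proof -
  have "\<exists>c e. v = coord_vec M c p e \<and> c \<in> charts_at M p"
    using assms by (simp only: tangent_space_def mem_Collect_eq)
  then show ?thesis using that by (elim exE conjE)
qed

lemma tangent_points: "v \<in> tangent_space M p \<Longrightarrow> p \<in> points M"
  by (erule tangent_cases) (rule charts_at_points)

lemma tangent_nonsmooth: "v \<in> tangent_space M p \<Longrightarrow> \<not> smooth_near M p u \<Longrightarrow> v u = 0"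
  by (erule tangent_cases) (simp add: coord_vec_def)

text \<open>A derivative sees only the germ of a smooth function. If \<open>u\<close> is not smooth
  near \<open>p\<close>, then neither is \<open>w\<close>, and both values are 0 by the convention
  on non-smooth functions.\<close>

lemma tangent_cong:
  assumes v: "v \<in> tangent_space M p" and uw: "\<forall>\<^sub>F q in near M p. u q = w q"
  shows "v u = v w"
proof (cases "smooth_near M p u")
  case True
  obtain c e where c: "c \<in> charts_at M p" "v = coord_vec M c p e" using v by (rule tangent_cases)
  have ca: "c \<in> atlas M" "p \<in> fst c" using c by (auto simp: charts_at_def)
  have p: "p \<in> points M" using charts_at_points c(1) .
  obtain U where U: "openin (topo M) U" "p \<in> U" "\<forall>q\<in>U. u q = w q"
    using uw p by (rule near_obtain)
  have "frechet_derivative (u \<circ> chart_inv c) (at (snd c p)) = frechet_derivative (w \<circ> chart_inv c) (at (snd c p))"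
    by (rule frechet_derivative_cong_open[OF open_chart_image[OF ca(1) U(1)]])
      (use ca U in \<open>auto simp: chart_inv_mem[OF ca(1)]\<close>)
  then show ?thesis using True smooth_near_cong[OF True uw] c by (simp add: coord_vec_apply)
next
  case False
  have "\<forall>\<^sub>F q in near M p. w q = u q" using uw by eventually_elim simp
  then have "\<not> smooth_near M p w"
    using False smooth_near_cong[of p w u] by auto
  then show ?thesis using False tangent_nonsmooth[OF v] by simp
qed

text \<open>The chain rule behind the coordinate computations: \<open>f\<close> is the coordinate
  map of a chart, possibly preceded by a map between manifolds, and \<open>F\<close> is a function
  expressed in that chart.\<close>

lemma tangent_compose:
  fixes f :: "'a \<Rightarrow> 'd::euclidean_space"
  assumes v: "v \<in> tangent_space M p" and f: "\<And>b. b \<in> Basis \<Longrightarrow> smooth_near M p (\<lambda>q. f q \<bullet> b)"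
    and F: "smooth_on T F" "open T" "f p \<in> T"
  shows "v (\<lambda>q. F (f q)) = (\<Sum>b\<in>Basis. frechet_derivative F (at (f p)) b * v (\<lambda>q. f q \<bullet> b))"
proof -
  obtain c e where c: "c \<in> charts_at M p" "v = coord_vec M c p e" using v by (rule tangent_cases)
  have p: "p \<in> points M" using charts_at_points c by blast
  have inv: "chart_inv c (snd c p) = p" using chart_inv_snd c by blast
  let ?G = "\<lambda>e. \<Sum>b\<in>Basis. frechet_derivative F (at ((f \<circ> chart_inv c) (snd c p))) b *
        frechet_derivative (\<lambda>x. (f \<circ> chart_inv c) x \<bullet> b) (at (snd c p)) e"
  have "((\<lambda>x. F ((f \<circ> chart_inv c) x)) has_derivative ?G) (at (snd c p))"
    using smooth_near_differentiable[OF c(1) f] smooth_on_differentiable[OF F(1,3)] inv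
    by (intro frechet_derivative_componentwise) (auto simp: o_def)
  then have "frechet_derivative (\<lambda>x. F ((f \<circ> chart_inv c) x)) (at (snd c p)) = ?G"
    by (rule frechet_derivative_at[symmetric])
  then show ?thesis
    using smooth_near_compose(1)[OF p f F] f inv
    by (simp add: c(2) coord_vec_apply o_def)
qed

lemma tangent_const:
  assumes v: "v \<in> tangent_space M p"
  shows "v (\<lambda>q. r) = 0"
proof -
  obtain c e where "c \<in> charts_at M p" "v = coord_vec M c p e" using v by (rule tangent_cases)
  then show ?thesis
    using smooth_near_const charts_at_points
    by (simp add: coord_vec_apply o_def frechet_derivative_const)
qed

lemma tangent_add:
  assumes v: "v \<in> tangent_space M p" and u: "smooth_near M p u" "smooth_near M p w"
  shows "v (\<lambda>q. u q + w q) = v u + v w"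
proof -
  obtain c e where c: "c \<in> charts_at M p" "v = coord_vec M c p e" using v by (rule tangent_cases)
  show ?thesis
    using frechet_derivative_add[OF smooth_near_differentiable[OF c(1) u(1)] smooth_near_differentiable[OF c(1) u(2)]]
      smooth_near_add[OF u] u by (simp add: c(2) coord_vec_apply o_def)
qed

lemma tangent_mult:
  assumes v: "v \<in> tangent_space M p" and u: "smooth_near M p u" "smooth_near M p w"
  shows "v (\<lambda>q. u q * w q) = u p * v w + v u * w p"
proof -
  obtain c e where c: "c \<in> charts_at M p" "v = coord_vec M c p e" using v by (rule tangent_cases)
  show ?thesis
    using frechet_derivative_mult_real[OF smooth_near_differentiable[OF c(1) u(1)] smooth_near_differentiable[OF c(1) u(2)]]
      smooth_near_mult[OF u] u chart_inv_snd[OF c(1)] by (simp add: c(2) coord_vec_apply o_def)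
qed

lemma tangent_minus:
  assumes v: "v \<in> tangent_space M p" and u: "smooth_near M p u"
  shows "v (\<lambda>q. - u q) = - v u"
  using tangent_mult[OF v smooth_near_const[OF tangent_points[OF v], of "-1"] u] tangent_const[OF v] by simp

lemma tangent_sum:
  assumes v: "v \<in> tangent_space M p" and "\<And>j. j \<in> J \<Longrightarrow> smooth_near M p (f j)"
  shows "v (\<lambda>q. \<Sum>j\<in>J. f j q) = (\<Sum>j\<in>J. v (f j))"
  using assms(2)
proof (induction J rule: infinite_finite_induct)
  case (insert x F)
  have "smooth_near M p (f x)" "smooth_near M p (\<lambda>q. \<Sum>j\<in>F. f j q)"
    using insert.prems by (auto intro!: smooth_near_sum tangent_points[OF v])
  then show ?case using insert tangent_add[OF v, of "f x" "\<lambda>q. \<Sum>j\<in>F. f j q"] by simp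
qed (auto simp: tangent_const[OF v])

lemma coord_vec_linear:
  assumes c: "c \<in> charts_at M p"
  shows "coord_vec M c p (e + e') = coord_vec M c p e + coord_vec M c p e'"
    and "coord_vec M c p (r *\<^sub>R e) = r *\<^sub>T coord_vec M c p e"
    and "coord_vec M c p 0 = 0"
proof -
  have lin: "linear (frechet_derivative (u \<circ> chart_inv c) (at (snd c p)))" if "smooth_near M p u" for u
    using smooth_near_differentiable[OF c that] linear_frechet_derivative by blast
  show "coord_vec M c p (e + e') = coord_vec M c p e + coord_vec M c p e'"
    using linear_add[OF lin] by (auto simp: fun_eq_iff coord_vec_def)
  show "coord_vec M c p (r *\<^sub>R e) = r *\<^sub>T coord_vec M c p e"
    using linear_scale[OF lin] by (auto simp: fun_eq_iff coord_vec_def)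
  show "coord_vec M c p 0 = 0"
    using linear_0[OF lin] by (auto simp: fun_eq_iff coord_vec_def)
qed

lemma coord_vec_sum:
  assumes c: "c \<in> charts_at M p"
  shows "coord_vec M c p (\<Sum>j\<in>J. r j *\<^sub>R e j) = (\<Sum>j\<in>J. r j *\<^sub>T coord_vec M c p (e j))"
  by (induction J rule: infinite_finite_induct) (auto simp: coord_vec_linear[OF c])

text \<open>Near \<open>p\<close> a smooth \<open>u\<close> is its coordinate expression composed
  with the chart map, so the chain rule writes \<open>v u\<close> through the values of
  \<open>v\<close> on coordinates, whichever chart \<open>v\<close> came from.\<close>

lemma tangent_expand:
  assumes c: "c \<in> charts_at M p" and v: "v \<in> tangent_space M p"
  shows "v = coord_vec M c p (\<Sum>b\<in>Basis. v (\<lambda>q. snd c q \<bullet> b) *\<^sub>R b)"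
    and "v = (\<Sum>b\<in>Basis. v (\<lambda>q. snd c q \<bullet> b) *\<^sub>T coord_vec M c p b)"
proof -
  show "v = (\<Sum>b\<in>Basis. v (\<lambda>q. snd c q \<bullet> b) *\<^sub>T coord_vec M c p b)"
  proof
    fix u
    show "v u = (\<Sum>b\<in>Basis. v (\<lambda>q. snd c q \<bullet> b) *\<^sub>T coord_vec M c p b) u"
    proof (cases "smooth_near M p u")
      case True
      then obtain S where S: "open S" "snd c p \<in> S" "smooth_on S (u \<circ> chart_inv c)"
        using smooth_near_chart[OF c] by blast
      have "v u = v (\<lambda>q. (u \<circ> chart_inv c) (snd c q))"
        by (rule tangent_cong[OF v]) (use charts_at_near[OF c] in \<open>eventually_elim, simp add: chart_inv_snd\<close>)
      then show ?thesis
        using tangent_compose[OF v smooth_near_coord[OF c] S(3,1,2)] True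
        by (simp add: sum_fun_apply coord_vec_apply mult.commute)
    qed (simp add: tangent_nonsmooth[OF v] sum_fun_apply coord_vec_def)
  qed
  then show "v = coord_vec M c p (\<Sum>b\<in>Basis. v (\<lambda>q. snd c q \<bullet> b) *\<^sub>R b)"
    unfolding coord_vec_sum[OF c] .
qed

text \<open>The definition takes the union over all charts at \<open>p\<close>. That a single chart
  already yields everything is what gives the union its vector space structure.\<close>

lemma tangent_space_chart:
  assumes c: "c \<in> charts_at M p"
  shows "tangent_space M p = range (coord_vec M c p)"
proof (intro set_eqI iffI)
  fix v
  show "v \<in> range (coord_vec M c p)" if "v \<in> tangent_space M p"
    by (rule range_eqI, rule tangent_expand(1)[OF c that])
  show "v \<in> tangent_space M p" if "v \<in> range (coord_vec M c p)"
    using that coord_vec_mem[OF c] by (elim rangeE) simp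
qed

lemma tangent_closed:
  shows tangent_add_mem: "v \<in> tangent_space M p \<Longrightarrow> w \<in> tangent_space M p \<Longrightarrow> v + w \<in> tangent_space M p"
    and tangent_scale_mem: "v \<in> tangent_space M p \<Longrightarrow> r *\<^sub>T v \<in> tangent_space M p"
    and tangent_zero_mem: "p \<in> points M \<Longrightarrow> 0 \<in> tangent_space M p"
proof -
  show "v + w \<in> tangent_space M p" if vw: "v \<in> tangent_space M p" "w \<in> tangent_space M p"
  proof -
    obtain c where c: "c \<in> charts_at M p" using chart_exists[OF tangent_points[OF vw(1)]] by (elim exE)
    obtain e e' where "v = coord_vec M c p e" "w = coord_vec M c p e'"
      using vw unfolding tangent_space_chart[OF c] by (elim rangeE)
    then show ?thesis using coord_vec_mem[OF c, of "e + e'"] by (simp add: coord_vec_linear[OF c])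
  qed
  show "r *\<^sub>T v \<in> tangent_space M p" if vw: "v \<in> tangent_space M p"
  proof -
    obtain c where c: "c \<in> charts_at M p" using chart_exists[OF tangent_points[OF vw]] by (elim exE)
    obtain e where "v = coord_vec M c p e"
      using vw unfolding tangent_space_chart[OF c] by (elim rangeE)
    then show ?thesis using coord_vec_mem[OF c, of "r *\<^sub>R e"] by (simp add: coord_vec_linear[OF c])
  qed
  show "0 \<in> tangent_space M p" if "p \<in> points M"
    using chart_exists[OF that] coord_vec_mem[of _ p 0] by (auto simp: coord_vec_linear)
qed

lemma tangent_minus_mem: "v \<in> tangent_space M p \<Longrightarrow> - v \<in> tangent_space M p"
proof -
  have "- v = (-1) *\<^sub>T v" by (simp add: fun_eq_iff)
  then show "v \<in> tangent_space M p \<Longrightarrow> - v \<in> tangent_space M p" using tangent_scale_mem by metis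
qed

lemma tangent_diff_mem: "v \<in> tangent_space M p \<Longrightarrow> w \<in> tangent_space M p \<Longrightarrow> v - w \<in> tangent_space M p"
  using tangent_add_mem tangent_minus_mem by (metis diff_conv_add_uminus)

lemma tangent_sum_mem:
  "p \<in> points M \<Longrightarrow> (\<And>j. j \<in> J \<Longrightarrow> f j \<in> tangent_space M p) \<Longrightarrow> (\<Sum>j\<in>J. f j) \<in> tangent_space M p"
  by (induction J rule: infinite_finite_induct) (auto intro: tangent_closed)

lemma coord_vec_coord:
  assumes c: "c \<in> charts_at M p"
  shows "coord_vec M c p e (\<lambda>q. snd c q \<bullet> b) = e \<bullet> b"
proof -
  have ca: "c \<in> atlas M" "p \<in> fst c" using c by (auto simp: charts_at_def)
  have "((\<lambda>x. x \<bullet> b) has_derivative (\<lambda>e. e \<bullet> b)) (at (snd c p))"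
    by (intro has_derivative_inner_left has_derivative_ident)
  moreover have "open (snd c ` (fst c \<inter> points M))" using open_chart_image[OF ca(1)] openin_topspace by blast
  moreover have "snd c p \<in> snd c ` (fst c \<inter> points M)"
    using ca charts_at_points[OF c] by blast
  ultimately have "((\<lambda>q. snd c q \<bullet> b) \<circ> chart_inv c has_derivative (\<lambda>e. e \<bullet> b)) (at (snd c p))"
    by (subst has_derivative_cong_open[of _ _ _ "\<lambda>x. x \<bullet> b"]) (auto simp: chart_inv_mem[OF ca(1)])
  then show ?thesis
    using frechet_derivative_at smooth_near_coord[OF c] coord_vec_apply by metis
qed

end

section \<open>Vector fields along smooth maps\<close>

lemma push_linear:
  "push N i p (v + w) = push N i p v + push N i p w"
  "push N i p (r *\<^sub>T v) = r *\<^sub>T push N i p v"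
  "push N i p 0 = 0"
  "push N i p (v - w) = push N i p v - push N i p w"
  "push N i p (- v) = - push N i p v"
  by (auto simp: push_def fun_eq_iff)

context smooth_mfd
begin

section \<open>Smooth dependence of coefficients on the base point\<close>

lemma smooth_near_inner:
  fixes f h :: "'a \<Rightarrow> 'd::euclidean_space"
  assumes p: "p \<in> points M" and "\<And>b. b \<in> Basis \<Longrightarrow> smooth_near M p (\<lambda>q. f q \<bullet> b)"
    "\<And>b. b \<in> Basis \<Longrightarrow> smooth_near M p (\<lambda>q. h q \<bullet> b)"
  shows "smooth_near M p (\<lambda>q. f q \<bullet> h q)"
proof -
  have "(\<lambda>q. f q \<bullet> h q) = (\<lambda>q. \<Sum>b\<in>Basis. (f q \<bullet> b) * (h q \<bullet> b))"
    by (rule ext) (rule euclidean_inner)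
  then show ?thesis using assms by (auto intro!: smooth_near_sum smooth_near_mult)
qed

lemma smooth_near_nonzero:
  assumes "smooth_near M p u" "u p \<noteq> (0::real)"
  shows "\<forall>\<^sub>F q in near M p. u q \<noteq> 0"
proof -
  \<comment> \<open>The constant function is a placeholder: only the continuity statement of the
    composition lemma is wanted, for the open set of nonzero reals.\<close>
  have "smooth_on (- {0}) (\<lambda>x::real. 0::real)" by (simp add: smooth_on_def Ck_on_const)
  from smooth_near_compose(2)[OF smooth_near_points[OF assms(1)] _ this, of u] assms
  show ?thesis by (simp add: open_Compl)
qed

text \<open>The coefficients of a smooth vector with respect to a smooth linearly independent family are
  smooth: eliminate one vector \<open>s a\<close> of the family by projecting to its orthogonal complement. At
  points where \<open>s a\<close> vanishes, the convention \<open>inverse 0 = 0\<close> makes this the identity map, so the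
  projected equation holds everywhere.\<close>

lemma smooth_near_coefficients:
  fixes s :: "'j \<Rightarrow> 'a \<Rightarrow> 'd::euclidean_space"
  assumes p: "p \<in> points M" and "finite J"
    and "\<And>j b. j \<in> J \<Longrightarrow> b \<in> Basis \<Longrightarrow> smooth_near M p (\<lambda>q. s j q \<bullet> b)"
    and "\<And>b. b \<in> Basis \<Longrightarrow> smooth_near M p (\<lambda>q. w q \<bullet> b)"
    and "\<forall>\<^sub>F q in near M p. (\<Sum>j\<in>J. y j q *\<^sub>R s j q) = w q"
    and "\<And>r. (\<Sum>j\<in>J. r j *\<^sub>R s j p) = 0 \<Longrightarrow> \<forall>j\<in>J. r j = 0"
  shows "\<forall>j\<in>J. smooth_near M p (y j)"
  using assms(2-)
proof (induction J arbitrary: s w rule: finite_induct)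
  case (insert a A)
  note s = insert.prems(1) and w = insert.prems(2)
  have sa: "smooth_near M p (\<lambda>q. s a q \<bullet> b)" if "b \<in> Basis" for b using s that by simp
  have sap: "s a p \<noteq> 0"
  proof
    assume "s a p = 0"
    \<comment> \<open>A vanishing member of the family would satisfy the nontrivial relation with
      coefficient 1 at \<open>a\<close> and 0 elsewhere.\<close>
    then have "(\<Sum>j\<in>insert a A. (if j = a then 1 else 0) *\<^sub>R s j p) = 0"
      by (intro sum.neutral) auto
    from insert.prems(4)[OF this] show False by auto
  qed
  define n where "n q = inverse (s a q \<bullet> s a q)" for q
  have n: "smooth_near M p n"
    unfolding n_def using sap
    by (intro smooth_near_inverse smooth_near_inner[OF p sa sa]) auto
  define P where "P q v = v - ((v \<bullet> s a q) * n q) *\<^sub>R s a q" for q v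
  have P_smooth: "smooth_near M p (\<lambda>q. P q (f q) \<bullet> b)"
    if f: "\<And>b. b \<in> Basis \<Longrightarrow> smooth_near M p (\<lambda>q. f q \<bullet> b)" and b: "b \<in> Basis" for f b
    unfolding P_def inner_diff_left inner_scaleR_left
    by (intro smooth_near_diff smooth_near_mult smooth_near_inner[OF p f sa] f[OF b] sa[OF b] n)
  have P_sum: "P q (\<Sum>j\<in>A. r j *\<^sub>R f j) = (\<Sum>j\<in>A. r j *\<^sub>R P q (f j))" for q r and f :: "'j \<Rightarrow> 'd"
    unfolding P_def
    by (simp add: inner_sum_left sum_distrib_right scaleR_sum_left sum_subtractf scaleR_diff_right mult.assoc)
  have P_a: "P q (r *\<^sub>R s a q) = 0" for q r
    by (cases "s a q = 0") (simp_all add: P_def n_def)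
  have P_add: "P q (v + v') = P q v + P q v'" for q v v'
    by (simp add: P_def algebra_simps inner_add_left)
  have IH: "\<forall>j\<in>A. smooth_near M p (y j)"
  proof (rule insert.IH[of "\<lambda>j q. P q (s j q)" "\<lambda>q. P q (w q)"])
    show "smooth_near M p (\<lambda>q. P q (s j q) \<bullet> b)" if "j \<in> A" "b \<in> Basis" for j b
      using that s by (intro P_smooth) auto
    show "smooth_near M p (\<lambda>q. P q (w q) \<bullet> b)" if "b \<in> Basis" for b
      using that w by (intro P_smooth) auto
    show "\<forall>\<^sub>F q in near M p. (\<Sum>j\<in>A. y j q *\<^sub>R P q (s j q)) = P q (w q)"
      using insert.prems(3)
    proof eventually_elim
      case (elim q)
      show ?case unfolding elim[symmetric] sum.insert[OF insert.hyps] P_add P_a P_sum by simp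
    qed
    show "\<forall>j\<in>A. r j = 0" if r: "(\<Sum>j\<in>A. r j *\<^sub>R P p (s j p)) = 0" for r
    proof -
      let ?v = "\<Sum>j\<in>A. r j *\<^sub>R s j p"
      \<comment> \<open>A relation among the projected vectors lifts to the whole family: the
        coefficient of \<open>s a\<close> is chosen to cancel the component that the projection
        removed.\<close>
      let ?r = "\<lambda>j. if j = a then - ((?v \<bullet> s a p) * n p) else r j"
      have "P p ?v = 0" using r unfolding P_sum .
      moreover have "(\<Sum>j\<in>A. ?r j *\<^sub>R s j p) = ?v" using insert.hyps by (intro sum.cong) auto
      ultimately have "(\<Sum>j\<in>insert a A. ?r j *\<^sub>R s j p) = 0"
        using insert.hyps by (simp add: P_def)
      from insert.prems(4)[OF this] insert.hyps show ?thesis by (metis insertCI)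
    qed
  qed
  \<comment> \<open>The remaining coefficient is recovered by taking the inner product of the
    equation with \<open>s a\<close> and dividing by the squared norm of \<open>s a\<close>.\<close>
  have "smooth_near M p (\<lambda>q. (w q \<bullet> s a q - (\<Sum>j\<in>A. y j q * (s j q \<bullet> s a q))) * n q)"
    using IH s
    by (intro smooth_near_diff smooth_near_mult smooth_near_inner[OF p w sa]
        smooth_near_inner[OF p _ sa] smooth_near_sum n p) auto
  then have "smooth_near M p (y a)"
  proof (rule smooth_near_cong)
    have "smooth_near M p (\<lambda>q. s a q \<bullet> s a q)" by (rule smooth_near_inner[OF p sa sa])
    from smooth_near_nonzero[OF this] have "\<forall>\<^sub>F q in near M p. s a q \<bullet> s a q \<noteq> 0" using sap by simp
    then show "\<forall>\<^sub>F q in near M p. (w q \<bullet> s a q - (\<Sum>j\<in>A. y j q * (s j q \<bullet> s a q))) * n q = y a q"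
      using insert.prems(3)
    proof eventually_elim
      case (elim q)
      have "w q \<bullet> s a q = y a q * (s a q \<bullet> s a q) + (\<Sum>j\<in>A. y j q * (s j q \<bullet> s a q))"
        unfolding elim(2)[symmetric] sum.insert[OF insert.hyps] by (simp add: inner_add_left inner_sum_left)
      then show ?case using elim(1) by (simp add: n_def)
    qed
  qed
  then show ?case using IH by simp
qed simp

end

section \<open>Smooth maps and their differentials\<close>

locale smooth_mfd_map = M: smooth_mfd M + N: smooth_mfd N
  for M :: "('b, 'f::euclidean_space) manifold" and N :: "('a, 'e::euclidean_space) manifold" +
  fixes i :: "'b \<Rightarrow> 'a"
  assumes smooth_map: "smooth_map M N i"
begin

lemma map_points: "p \<in> points M \<Longrightarrow> i p \<in> points N"
  using smooth_map by (simp add: smooth_map_def)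

lemma map_smooth: "p \<in> points M \<Longrightarrow> smooth_near N (i p) u \<Longrightarrow> smooth_near M p (\<lambda>q. u (i q))"
  using smooth_map by (simp add: smooth_map_def o_def)

text \<open>Continuity of \<open>i\<close> is not assumed; it follows from pulling back functions that are \<open>0\<close> on a
  neighbourhood and \<open>1\<close> elsewhere, which are smooth near the point.\<close>

lemma map_near:
  assumes p: "p \<in> points M" and P: "eventually P (near N (i p))"
  shows "\<forall>\<^sub>F q in near M p. P (i q)"
proof -
  define u :: "'a \<Rightarrow> real" where "u x = (if P x then 0 else 1)" for x
  have "smooth_near N (i p) u"
    by (rule N.smooth_near_cong[OF N.smooth_near_const[OF map_points[OF p], of 0]])
      (use P in \<open>eventually_elim, simp add: u_def\<close>)
  then have u: "smooth_near M p (\<lambda>q. u (i q) - 1)"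
    using p by (intro M.smooth_near_diff M.smooth_near_const map_smooth)
  have "P (i p)" by (rule near_self[OF P map_points[OF p]])
  then have "\<forall>\<^sub>F q in near M p. u (i q) - 1 \<noteq> 0"
    by (intro M.smooth_near_nonzero[OF u]) (simp add: u_def)
  then show ?thesis by eventually_elim (simp add: u_def split: if_splits)
qed

lemma push_apply: "smooth_near N (i p) u \<Longrightarrow> push N i p v u = v (\<lambda>q. u (i q))"
  by (simp add: push_def o_def)

text \<open>By the chain rule the pushed vector is the coordinate vector with components
  \<open>v\<close> applied to the coordinates of \<open>i\<close>. Continuity of \<open>i\<close> is
  needed for \<open>u\<close> after \<open>i\<close> to be expressible in the chart \<open>d\<close>
  near \<open>p\<close>.\<close>

lemma push_mem:
  assumes v: "v \<in> tangent_space M p"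
  shows "push N i p v \<in> tangent_space N (i p)"
proof -
  have p: "p \<in> points M" using M.tangent_points[OF v] .
  obtain d where d: "d \<in> charts_at N (i p)" using N.chart_exists[OF map_points[OF p]] by (elim exE)
  have "push N i p v = coord_vec N d (i p) (\<Sum>b\<in>Basis. v (\<lambda>q. snd d (i q) \<bullet> b) *\<^sub>R b)"
  proof
    fix u
    show "push N i p v u = coord_vec N d (i p) (\<Sum>b\<in>Basis. v (\<lambda>q. snd d (i q) \<bullet> b) *\<^sub>R b) u"
    proof (cases "smooth_near N (i p) u")
      case True
      obtain S where S: "open S" "snd d (i p) \<in> S" "smooth_on S (u \<circ> chart_inv d)"
        using iffD1[OF N.smooth_near_chart[OF d] True] by (elim exE conjE)
      have "v (\<lambda>q. u (i q)) = v (\<lambda>q. (u \<circ> chart_inv d) (snd d (i q)))"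
        by (rule M.tangent_cong[OF v])
          (use map_near[OF p N.charts_at_near[OF d]] in \<open>eventually_elim, simp add: N.chart_inv_snd\<close>)
      then show ?thesis
        using M.tangent_compose[OF v map_smooth[OF p N.smooth_near_coord[OF d]] S(3,1,2)] True
        by (simp add: push_apply N.coord_vec_sum[OF d] sum_fun_apply N.coord_vec_apply mult.commute)
    qed (simp add: push_def coord_vec_def)
  qed
  then show ?thesis using N.coord_vec_mem[OF d] by simp
qed

section \<open>Smooth fields along a map\<close>

lemma along_points: "along_near M N i p W \<Longrightarrow> p \<in> points M"
  unfolding along_near_def by (elim exE conjE) (erule (1) subsetD[OF openin_subset])

lemma along_near_iff:
  "along_near M N i p W \<longleftrightarrow> p \<in> points M \<and>
    (\<forall>\<^sub>F q in near M p. W q \<in> tangent_space N (i q) \<and>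
      (\<forall>u. smooth_near N (i q) u \<longrightarrow> smooth_near M q (\<lambda>r. W r u)))"
  using along_points[of p W] by (auto simp: eventually_nhdsin along_near_def)

lemma along_near_near: "along_near M N i p W \<Longrightarrow> \<forall>\<^sub>F q in near M p. along_near M N i q W"
  unfolding along_near_iff using near_near near_points eventually_conj by fastforce

lemma along_mem: "along_near M N i p W \<Longrightarrow> W p \<in> tangent_space N (i p)"
  unfolding along_near_iff using near_self by fastforce

lemma along_smooth:
  "along_near M N i p W \<Longrightarrow> smooth_near N (i p) u \<Longrightarrow> smooth_near M p (\<lambda>r. W r u)"
  unfolding along_near_iff using near_self by fastforce

text \<open>\<open>R\<close> collects what is known at all points near \<open>p\<close>, typically
  that the ingredients of \<open>W\<close> are smooth there; smoothness of \<open>W\<close> then has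
  to be shown at a single point only.\<close>

lemma along_nearI:
  assumes "p \<in> points M" "\<forall>\<^sub>F q in near M p. W q \<in> tangent_space N (i q)"
    and "\<And>u q. q \<in> points M \<Longrightarrow> smooth_near N (i q) u \<Longrightarrow> R q \<Longrightarrow> smooth_near M q (\<lambda>r. W r u)"
    and "eventually R (near M p)"
  shows "along_near M N i p W"
  unfolding along_near_iff
proof (intro conjI assms(1))
  show "\<forall>\<^sub>F q in near M p. W q \<in> tangent_space N (i q) \<and>
      (\<forall>u. smooth_near N (i q) u \<longrightarrow> smooth_near M q (\<lambda>r. W r u))"
    using assms(2,4) near_points[of M p] by eventually_elim (simp add: assms(3))
qed

lemma along_cong:
  assumes W: "along_near M N i p W" and eq: "\<forall>\<^sub>F q in near M p. W q = W' q"
  shows "along_near M N i p W'"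
proof (rule along_nearI)
  show p: "p \<in> points M" using along_points[OF W] .
  show "\<forall>\<^sub>F q in near M p. W' q \<in> tangent_space N (i q)"
    using along_near_near[OF W] eq by eventually_elim (auto dest: along_mem)
  show "\<forall>\<^sub>F q in near M p. along_near M N i q W \<and> (\<forall>\<^sub>F r in near M q. W r = W' r)"
    using along_near_near[OF W] near_near[OF eq p] by eventually_elim simp
  show "smooth_near M q (\<lambda>r. W' r u)"
    if u: "smooth_near N (i q) u" and q: "along_near M N i q W \<and> (\<forall>\<^sub>F r in near M q. W r = W' r)" for q u
  proof (rule M.smooth_near_cong)
    show "smooth_near M q (\<lambda>r. W r u)" using along_smooth u q by simp
    show "\<forall>\<^sub>F r in near M q. W r u = W' r u" using conjunct2[OF q] by eventually_elim simp
  qed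
qed

lemma along_add:
  assumes "along_near M N i p W" "along_near M N i p W'"
  shows "along_near M N i p (\<lambda>q. W q + W' q)"
proof (rule along_nearI)
  show "p \<in> points M" using along_points assms by simp
  show *: "\<forall>\<^sub>F q in near M p. along_near M N i q W \<and> along_near M N i q W'"
    using assms[THEN along_near_near] by eventually_elim simp
  show "\<forall>\<^sub>F q in near M p. W q + W' q \<in> tangent_space N (i q)"
    using * by eventually_elim (auto intro: N.tangent_add_mem along_mem)
qed (auto intro: M.smooth_near_add along_smooth)

lemma along_scale:
  assumes "smooth_near M p f" "along_near M N i p W"
  shows "along_near M N i p (\<lambda>q. f q *\<^sub>T W q)"
proof (rule along_nearI)
  show "p \<in> points M" using along_points assms by simp
  show *: "\<forall>\<^sub>F q in near M p. smooth_near M q f \<and> along_near M N i q W"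
    using M.smooth_near_near[OF assms(1)] along_near_near[OF assms(2)] by eventually_elim simp
  show "\<forall>\<^sub>F q in near M p. f q *\<^sub>T W q \<in> tangent_space N (i q)"
    using * by eventually_elim (auto intro: N.tangent_scale_mem along_mem)
qed (auto intro: M.smooth_near_mult along_smooth)

lemma along_zero: "p \<in> points M \<Longrightarrow> along_near M N i p (\<lambda>q. 0)"
proof (rule along_nearI)
  show "\<forall>\<^sub>F q in near M p. 0 \<in> tangent_space N (i q)"
    using near_points by eventually_elim (auto intro: N.tangent_zero_mem map_points)
  show "\<forall>\<^sub>F q in near M p. True" by simp
qed (auto intro: M.smooth_near_const)

lemma along_minus: "along_near M N i p W \<Longrightarrow> along_near M N i p (\<lambda>q. - W q)"
proof -
  have "(\<lambda>q. - W q) = (\<lambda>q. (-1) *\<^sub>T W q)" by (simp add: fun_eq_iff)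
  then show "along_near M N i p W \<Longrightarrow> along_near M N i p (\<lambda>q. - W q)"
    using along_scale[OF M.smooth_near_const[OF along_points]] by simp
qed

lemma along_diff:
  "along_near M N i p W \<Longrightarrow> along_near M N i p W' \<Longrightarrow> along_near M N i p (\<lambda>q. W q - W' q)"
  using along_add[OF _ along_minus, of p W W'] by simp

lemma along_sum:
  "p \<in> points M \<Longrightarrow> (\<And>j. j \<in> J \<Longrightarrow> along_near M N i p (W j)) \<Longrightarrow> along_near M N i p (\<lambda>q. \<Sum>j\<in>J. W j q)"
  by (induction J rule: infinite_finite_induct) (auto intro: along_zero along_add)

lemma along_component:
  "along_near M N i p W \<Longrightarrow> d \<in> charts_at N (i p) \<Longrightarrow> smooth_near M p (\<lambda>q. W q (\<lambda>r. snd d r \<bullet> b))"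
  using along_smooth N.smooth_near_coord by simp

lemma along_expand:
  assumes W: "along_near M N i p W" and d: "d \<in> charts_at N (i p)"
  shows "\<forall>\<^sub>F q in near M p. (\<Sum>b\<in>Basis. W q (\<lambda>r. snd d r \<bullet> b) *\<^sub>T coord_vec N d (i q) b) = W q"
  using along_near_near[OF W] map_near[OF along_points[OF W] N.charts_at_near[OF d]]
proof eventually_elim
  case (elim q)
  show ?case by (rule N.tangent_expand(2)[symmetric, OF elim(2) along_mem[OF elim(1)]])
qed

end

lemma (in smooth_mfd) smooth_mfd_map_id: "smooth_mfd_map M M id"
  by unfold_locales (simp add: smooth_map_def)

text \<open>Vector fields on \<open>M\<close> are fields along the identity, so every rule for
  fields along a map becomes a rule for vector fields under the prefix \<open>self\<close>.\<close>

sublocale smooth_mfd \<subseteq> self: smooth_mfd_map M M id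
  by (rule smooth_mfd_map_id)

context smooth_mfd
begin

lemma field_mem: "field_near M p X \<Longrightarrow> X p \<in> tangent_space M p"
  using self.along_mem by fastforce

lemma field_smooth: "field_near M p X \<Longrightarrow> smooth_near M p u \<Longrightarrow> smooth_near M p (\<lambda>r. X r u)"
  using self.along_smooth by fastforce

lemma coord_field:
  assumes c: "c \<in> charts_at M p"
  shows "field_near M p (\<lambda>q. coord_vec M c q e)"
proof (rule self.along_nearI)
  show "p \<in> points M" using charts_at_points[OF c] .
  show *: "\<forall>\<^sub>F q in near M p. c \<in> charts_at M q" using charts_at_near[OF c] .
  show "\<forall>\<^sub>F q in near M p. coord_vec M c q e \<in> tangent_space M (id q)"
    using * by eventually_elim (simp add: coord_vec_mem)
qed (simp add: smooth_near_coord_vec)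

lemma field_extend:
  assumes v: "v \<in> tangent_space M p"
  obtains X where "field_near M p X" "X p = v"
proof -
  obtain c e where c: "c \<in> charts_at M p" "v = coord_vec M c p e" using v by (rule tangent_cases)
  show ?thesis by (rule that[OF coord_field[OF c(1), of e]]) (simp add: c(2))
qed

end

context smooth_mfd_map
begin

lemma along_field:
  assumes p: "p \<in> points M" and Z: "field_near N (i p) Z"
  shows "along_near M N i p (\<lambda>q. Z (i q))"
proof (rule along_nearI[OF p])
  show *: "\<forall>\<^sub>F q in near M p. field_near N (i q) Z"
    by (rule map_near[OF p N.self.along_near_near[OF Z]])
  show "\<forall>\<^sub>F q in near M p. Z (i q) \<in> tangent_space N (i q)"
    using * by eventually_elim (rule N.field_mem)
  show "smooth_near M q (\<lambda>r. Z (i r) u)"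
    if "q \<in> points M" "smooth_near N (i q) u" "field_near N (i q) Z" for q u
    by (rule map_smooth[OF that(1) N.field_smooth[OF that(3,2)]])
qed

lemma along_push:
  assumes Y: "field_near M p Y"
  shows "along_near M N i p (\<lambda>q. push N i q (Y q))"
proof (rule along_nearI)
  show "p \<in> points M" using M.self.along_points[OF Y] .
  show *: "\<forall>\<^sub>F q in near M p. field_near M q Y" by (rule M.self.along_near_near[OF Y])
  show "\<forall>\<^sub>F q in near M p. push N i q (Y q) \<in> tangent_space N (i q)"
    using * by eventually_elim (intro push_mem M.field_mem)
  show "smooth_near M q (\<lambda>r. push N i r (Y r) u)"
    if q: "q \<in> points M" and u: "smooth_near N (i q) u" and Yq: "field_near M q Y" for q u
  proof (rule M.smooth_near_cong)
    show "smooth_near M q (\<lambda>r. Y r (\<lambda>q. u (i q)))"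
      by (rule M.field_smooth[OF Yq map_smooth[OF q u]])
    \<comment> \<open>By its convention on non-smooth functions, \<open>push\<close> agrees with
      this formula only at points where \<open>u\<close> is smooth near the image; those form a
      neighbourhood by continuity of \<open>i\<close>.\<close>
    show "\<forall>\<^sub>F r in near M q. Y r (\<lambda>q. u (i q)) = push N i r (Y r) u"
      using map_near[OF q N.smooth_near_near[OF u]] by eventually_elim (simp add: push_apply)
  qed
qed

lemma along_push_near:
  assumes Y: "field_near M p Y" and u: "smooth_near N (i p) u"
  shows "\<forall>\<^sub>F q in near M p. push N i q (Y q) u = Y q (\<lambda>r. u (i r))"
  using map_near[OF M.self.along_points[OF Y] N.smooth_near_near[OF u]]
  by eventually_elim (simp add: push_apply)

end

section \<open>Tangent fields along an immersion\<close>

locale immersed_mfd = smooth_mfd_map +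
  assumes immersion: "immersion M N i"
begin

lemma push_inj:
  assumes "v \<in> tangent_space M p" "w \<in> tangent_space M p" "push N i p v = push N i p w"
  shows "v = w"
proof -
  have "inj_on (push N i p) (tangent_space M p)"
    using immersion M.tangent_points[OF assms(1)] by (simp add: immersion_def)
  then show ?thesis using assms by (auto dest: inj_onD)
qed

lemma field_of_push:
  assumes W: "along_near M N i p W"
    and Y: "\<forall>\<^sub>F q in near M p. Y q \<in> tangent_space M q \<and> push N i q (Y q) = W q"
  shows "field_near M p Y"
proof -
  have p: "p \<in> points M" using along_points[OF W] .
  obtain c where c: "c \<in> charts_at M p" using M.chart_exists[OF p] by (elim exE)
  obtain d where d: "d \<in> charts_at N (i p)" using N.chart_exists[OF map_points[OF p]] by (elim exE)
  \<comment> \<open>In the charts \<open>c\<close> and \<open>d\<close>, \<open>y\<close> holds the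
    coordinates of \<open>Y\<close>, \<open>s a\<close> is the column of the Jacobian of
    \<open>i\<close> in direction \<open>a\<close>, and \<open>w\<close> holds the coordinates of
    \<open>W\<close>. The hypothesis on \<open>Y\<close> says that the Jacobian maps
    \<open>y\<close> to \<open>w\<close>.\<close>
  define y where "y a q = Y q (\<lambda>r. snd c r \<bullet> a)" for a q
  define s where "s a q = (\<Sum>b\<in>Basis. coord_vec M c q a (\<lambda>r. snd d (i r) \<bullet> b) *\<^sub>R b)" for a q
  define w where "w q = (\<Sum>b\<in>Basis. W q (\<lambda>r. snd d r \<bullet> b) *\<^sub>R b)" for q
  have sb: "s a q \<bullet> b = coord_vec M c q a (\<lambda>r. snd d (i r) \<bullet> b)" if "b \<in> Basis" for a b q
    using that by (simp add: s_def)
  have dsm: "smooth_near M p (\<lambda>r. snd d (i r) \<bullet> b)" for b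
    by (rule map_smooth[OF p N.smooth_near_coord[OF d]])
  have Yx: "\<forall>\<^sub>F q in near M p. (\<Sum>a\<in>Basis. y a q *\<^sub>T coord_vec M c q a) = Y q"
    using Y M.charts_at_near[OF c]
  proof eventually_elim
    case (elim q)
    show ?case unfolding y_def by (rule M.tangent_expand(2)[symmetric, OF elim(2) conjunct1[OF elim(1)]])
  qed
  have "\<forall>a\<in>Basis. smooth_near M p (y a)"
  proof (rule M.smooth_near_coefficients[OF p finite_Basis, of s w])
    show "smooth_near M p (\<lambda>q. s a q \<bullet> b)" if "b \<in> Basis" for a b
      using M.smooth_near_coord_vec[OF c dsm] by (simp add: sb[OF that])
    show "smooth_near M p (\<lambda>q. w q \<bullet> b)" if "b \<in> Basis" for b
      using that along_component[OF W d] by (simp add: w_def)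
    show "\<forall>\<^sub>F q in near M p. (\<Sum>a\<in>Basis. y a q *\<^sub>R s a q) = w q"
      using Y Yx map_near[OF p N.charts_at_near[OF d]]
    proof eventually_elim
      case (elim q)
      have "W q (\<lambda>r. snd d r \<bullet> b) = (\<Sum>a\<in>Basis. y a q * coord_vec M c q a (\<lambda>r. snd d (i r) \<bullet> b))" for b
      proof -
        have "W q (\<lambda>r. snd d r \<bullet> b) = Y q (\<lambda>r. snd d (i r) \<bullet> b)"
          using push_apply[OF N.smooth_near_coord[OF elim(3)]] elim(1) by metis
        then show ?thesis by (simp add: elim(2)[symmetric] sum_fun_apply)
      qed
      note W = this
      have "(\<Sum>a\<in>Basis. y a q *\<^sub>R s a q) =
          (\<Sum>a\<in>Basis. \<Sum>b\<in>Basis. (y a q * coord_vec M c q a (\<lambda>r. snd d (i r) \<bullet> b)) *\<^sub>R b)"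
        by (simp add: s_def scaleR_sum_right)
      also have "\<dots> = (\<Sum>b\<in>Basis. \<Sum>a\<in>Basis. (y a q * coord_vec M c q a (\<lambda>r. snd d (i r) \<bullet> b)) *\<^sub>R b)"
        by (rule sum.swap)
      also have "\<dots> = w q" by (simp add: w_def W scaleR_sum_left)
      finally show ?case .
    qed
    show "\<forall>a\<in>Basis. r a = 0" if r: "(\<Sum>a\<in>Basis. r a *\<^sub>R s a p) = 0" for r
    proof -
      \<comment> \<open>A linear relation among the columns at \<open>p\<close> is a tangent vector
        killed by the differential, so injectivity of the differential makes the columns
        independent.\<close>
      define v where "v = (\<Sum>a\<in>Basis. r a *\<^sub>T coord_vec M c p a)"
      have v: "v \<in> tangent_space M p"
        unfolding v_def by (intro M.tangent_sum_mem p M.tangent_scale_mem M.coord_vec_mem c)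
      have "push N i p v (\<lambda>q. snd d q \<bullet> b) = 0" if b: "b \<in> Basis" for b
      proof -
        have "push N i p v (\<lambda>q. snd d q \<bullet> b) = (\<Sum>a\<in>Basis. r a *\<^sub>R s a p) \<bullet> b"
          using sb[OF b]
          by (simp add: push_apply[OF N.smooth_near_coord[OF d]] v_def sum_fun_apply inner_sum_left)
        then show ?thesis using r by simp
      qed
      then have "push N i p v = 0"
        by (subst N.tangent_expand(1)[OF d push_mem[OF v]]) (simp add: N.coord_vec_linear(3)[OF d])
      then have "v = 0"
        using push_inj[OF v M.tangent_zero_mem[OF p]] by (simp add: push_linear)
      have "r a = 0" if a: "a \<in> Basis" for a
      proof -
        have "v (\<lambda>q. snd c q \<bullet> a) = (\<Sum>a'\<in>Basis. r a' * (a' \<bullet> a))"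
          by (simp add: v_def sum_fun_apply M.coord_vec_coord[OF c])
        also have "\<dots> = r a" using a by (simp add: inner_Basis if_distrib cong: if_cong)
        finally show ?thesis using \<open>v = 0\<close> by simp
      qed
      then show ?thesis by simp
    qed
  qed
  then have "field_near M p (\<lambda>q. \<Sum>a\<in>Basis. y a q *\<^sub>T coord_vec M c q a)"
    by (intro M.self.along_sum p M.self.along_scale M.coord_field c) auto
  then show ?thesis using M.self.along_cong Yx by blast
qed

end

section \<open>Brackets, connections and their pullbacks\<close>

lemma directional_derivative:
  fixes f :: "'e::real_normed_vector \<Rightarrow> real"
  assumes "f differentiable (at (c + s *\<^sub>R a))"
  shows "DERIV (\<lambda>s. f (c + s *\<^sub>R a)) s :> frechet_derivative f (at (c + s *\<^sub>R a)) a"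
proof -
  let ?f' = "frechet_derivative f (at (c + s *\<^sub>R a))"
  have "((\<lambda>s. c + s *\<^sub>R a) has_derivative (\<lambda>t. t *\<^sub>R a)) (at s)"
    by (auto intro!: derivative_eq_intros)
  then have "(f \<circ> (\<lambda>s. c + s *\<^sub>R a) has_derivative ?f' \<circ> (\<lambda>t. t *\<^sub>R a)) (at s)"
    using assms by (intro diff_chain_at) (simp_all add: frechet_derivative_works[symmetric])
  then show ?thesis
    using linear_scale[OF linear_frechet_derivative[OF assms]]
    by (simp add: has_field_derivative_def o_def mult.commute[of _ "?f' a"])
qed

text \<open>The mean value theorem is used twice: for the increment in direction \<open>b\<close> as
  a function of the parameter along \<open>a\<close>, then for the derivative in direction
  \<open>a\<close> along \<open>b\<close>.\<close>

lemma second_difference: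
  fixes f :: "'e::real_normed_vector \<Rightarrow> real"
  assumes f: "smooth_on S f" and h: "h > 0"
    and S: "\<And>s t. 0 \<le> s \<Longrightarrow> s \<le> h \<Longrightarrow> 0 \<le> t \<Longrightarrow> t \<le> h \<Longrightarrow> x + s *\<^sub>R a + t *\<^sub>R b \<in> S"
  shows "\<exists>s t. 0 \<le> s \<and> s \<le> h \<and> 0 \<le> t \<and> t \<le> h \<and>
    f (x + h *\<^sub>R a + h *\<^sub>R b) - f (x + h *\<^sub>R a) - f (x + h *\<^sub>R b) + f x =
    h * h * frechet_derivative (\<lambda>x. frechet_derivative f (at x) a) (at (x + s *\<^sub>R a + t *\<^sub>R b)) b"
proof -
  let ?f' = "\<lambda>x. frechet_derivative f (at x) a"
  let ?F = "\<lambda>s. f ((x + h *\<^sub>R b) + s *\<^sub>R a) - f (x + s *\<^sub>R a)"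
    and ?F' = "\<lambda>s. ?f' ((x + h *\<^sub>R b) + s *\<^sub>R a) - ?f' (x + s *\<^sub>R a)"
  have "DERIV ?F s :> ?F' s" if "0 \<le> s" "s \<le> h" for s
    using S[of s h] S[of s 0] that h
    by (intro DERIV_diff directional_derivative smooth_on_differentiable[OF f]) (auto simp: algebra_simps)
  then have "\<exists>s>0. s < h \<and> ?F h - ?F 0 = (h - 0) * ?F' s" by (intro MVT2[OF h])
  then obtain s where s: "0 < s" "s < h" and 1: "?F h - ?F 0 = (h - 0) * ?F' s" by (elim exE conjE)
  let ?G = "\<lambda>t. ?f' ((x + s *\<^sub>R a) + t *\<^sub>R b)"
    and ?G' = "\<lambda>t. frechet_derivative ?f' (at ((x + s *\<^sub>R a) + t *\<^sub>R b)) b"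
  have "DERIV ?G t :> ?G' t" if "0 \<le> t" "t \<le> h" for t
    using S[of s t] that s
    by (intro directional_derivative smooth_on_differentiable[OF smooth_on_frechet[OF f]]) auto
  then have "\<exists>t>0. t < h \<and> ?G h - ?G 0 = (h - 0) * ?G' t" by (intro MVT2[OF h])
  then obtain t where t: "0 < t" "t < h" and 2: "?G h - ?G 0 = (h - 0) * ?G' t" by (elim exE conjE)
  have "f (x + h *\<^sub>R a + h *\<^sub>R b) - f (x + h *\<^sub>R a) - f (x + h *\<^sub>R b) + f x =
    h * (?f' ((x + s *\<^sub>R a) + h *\<^sub>R b) - ?f' (x + s *\<^sub>R a))"
    using 1 by (simp add: add.assoc add.commute[of "h *\<^sub>R b"])
  also have "\<dots> = h * h * frechet_derivative ?f' (at (x + s *\<^sub>R a + t *\<^sub>R b)) b"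
    using 2 by simp
  finally show ?thesis using s t by (intro exI[of _ s] exI[of _ t]) auto
qed

text \<open>The second difference is symmetric in \<open>a\<close> and \<open>b\<close>, so the two
  mixed derivatives agree at a pair of points close to \<open>x\<close>. If they differed at
  \<open>x\<close>, continuity would keep each within half the gap of its value there, which
  excludes such a pair.\<close>

lemma smooth_on_partials_commute:
  fixes f :: "'e::real_normed_vector \<Rightarrow> real"
  assumes f: "smooth_on S f" and "open S" "x \<in> S"
  shows "frechet_derivative (\<lambda>x. frechet_derivative f (at x) a) (at x) b =
    frechet_derivative (\<lambda>x. frechet_derivative f (at x) b) (at x) a"
proof (rule ccontr)
  define A where "A = (\<lambda>x. frechet_derivative (\<lambda>x. frechet_derivative f (at x) a) (at x) b)"
  define B where "B = (\<lambda>x. frechet_derivative (\<lambda>x. frechet_derivative f (at x) b) (at x) a)"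
  assume "\<not> ?thesis"
  then have ne: "\<bar>A x - B x\<bar> / 2 > 0" by (simp add: A_def B_def)
  have "continuous_on S A" "continuous_on S B"
    unfolding A_def B_def by (intro smooth_on_continuous smooth_on_frechet f)+
  then have "isCont A x" "isCont B x"
    using assms(2,3) by (auto simp: continuous_on_eq_continuous_at)
  then obtain d1 d2 where d: "d1 > 0" "d2 > 0"
    "\<forall>y. dist y x < d1 \<longrightarrow> dist (A y) (A x) < \<bar>A x - B x\<bar> / 2"
    "\<forall>y. dist y x < d2 \<longrightarrow> dist (B y) (B x) < \<bar>A x - B x\<bar> / 2"
    using ne unfolding continuous_at_eps_delta by metis
  obtain d3 where d3: "d3 > 0" "ball x d3 \<subseteq> S" using assms(2,3) openE by blast
  define d where "d = min d3 (min d1 d2)"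
  have d0: "d > 0" using d d3 by (simp add: d_def)
  \<comment> \<open>With \<open>h = d / (2 * k)\<close> every point of the parallelogram is within
    \<open>d / 2\<close> of \<open>x\<close>; the summand 1 keeps \<open>k\<close> positive when
    both directions vanish.\<close>
  define k where "k = norm a + norm b + 1"
  define h where "h = d / (2 * k)"
  have n: "k > 0" by (simp add: k_def add_nonneg_pos)
  have h: "h > 0" using d0 n by (simp add: h_def)
  have near: "dist (x + s *\<^sub>R a + t *\<^sub>R b) x < d"
    if "0 \<le> s" "s \<le> h" "0 \<le> t" "t \<le> h" for s t
  proof -
    have "dist (x + s *\<^sub>R a + t *\<^sub>R b) x = norm (s *\<^sub>R a + t *\<^sub>R b)" by (simp add: dist_norm add.assoc)
    also have "\<dots> \<le> s * norm a + t * norm b"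
      using that norm_triangle_ineq[of "s *\<^sub>R a" "t *\<^sub>R b"] by simp
    also have "\<dots> \<le> h * norm a + h * norm b" by (intro add_mono mult_right_mono that) auto
    also have "\<dots> \<le> h * k" using h by (simp add: k_def distrib_left)
    also have "\<dots> = d / 2" using n by (simp add: h_def)
    finally show ?thesis using d0 by simp
  qed
  have near': "dist (x + s *\<^sub>R b + t *\<^sub>R a) x < d"
    if "0 \<le> s" "s \<le> h" "0 \<le> t" "t \<le> h" for s t
    using near[of t s] that by (simp add: add.assoc add.commute[of "t *\<^sub>R a"])
  have sub: "y \<in> S" if "dist y x < d" for y
    using that d3 by (auto simp: d_def dist_commute)
  obtain s t where st: "0 \<le> s" "s \<le> h" "0 \<le> t" "t \<le> h"
    "f (x + h *\<^sub>R a + h *\<^sub>R b) - f (x + h *\<^sub>R a) - f (x + h *\<^sub>R b) + f x = h * h * A (x + s *\<^sub>R a + t *\<^sub>R b)"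
    using second_difference[OF f h, of x a b] sub[OF near] unfolding A_def by auto
  obtain s' t' where st': "0 \<le> s'" "s' \<le> h" "0 \<le> t'" "t' \<le> h"
    "f (x + h *\<^sub>R b + h *\<^sub>R a) - f (x + h *\<^sub>R b) - f (x + h *\<^sub>R a) + f x = h * h * B (x + s' *\<^sub>R b + t' *\<^sub>R a)"
    using second_difference[OF f h, of x b a] sub[OF near'] unfolding B_def by auto
  have swap: "x + h *\<^sub>R b + h *\<^sub>R a = x + h *\<^sub>R a + h *\<^sub>R b" by simp
  have "h * h * A (x + s *\<^sub>R a + t *\<^sub>R b) = h * h * B (x + s' *\<^sub>R b + t' *\<^sub>R a)"
    using st(5) st'(5) unfolding swap by linarith
  then have "A (x + s *\<^sub>R a + t *\<^sub>R b) = B (x + s' *\<^sub>R b + t' *\<^sub>R a)" using h by simp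
  moreover have "dist (A (x + s *\<^sub>R a + t *\<^sub>R b)) (A x) < \<bar>A x - B x\<bar> / 2"
    using d near[OF st(1-4)] by (simp add: d_def)
  moreover have "dist (B (x + s' *\<^sub>R b + t' *\<^sub>R a)) (B x) < \<bar>A x - B x\<bar> / 2"
    using d near'[OF st'(1-4)] by (simp add: d_def)
  ultimately show False by (simp add: dist_real_def abs_if split: if_splits)
qed

context smooth_mfd
begin

section \<open>The Lie bracket\<close>

lemma bracket_apply:
  "smooth_near M p u \<Longrightarrow> bracket M X Y p u = X p (\<lambda>q. Y q u) - Y p (\<lambda>q. X q u)"
  by (simp add: bracket_def)

text \<open>The result is split into a first-order part, which is a coordinate vector, and a
  second-order part whose coefficients are the products of the components of \<open>X\<close> and
  \<open>Y\<close>, so that exchanging the fields exchanges only the order of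
  differentiation.\<close>

lemma field_twice:
  assumes c: "c \<in> charts_at M p" and X: "field_near M p X" and Y: "field_near M p Y"
    and u: "smooth_near M p u" and S: "open S" "snd c p \<in> S" "smooth_on S (u \<circ> chart_inv c)"
  shows "X p (\<lambda>q. Y q u) =
    (\<Sum>b\<in>Basis. X p (\<lambda>q. Y q (\<lambda>r. snd c r \<bullet> b)) * coord_vec M c p b u) +
    (\<Sum>b\<in>Basis. \<Sum>a\<in>Basis. Y p (\<lambda>r. snd c r \<bullet> b) * (X p (\<lambda>r. snd c r \<bullet> a) *
      frechet_derivative (\<lambda>x. frechet_derivative (u \<circ> chart_inv c) (at x) b) (at (snd c p)) a))"
proof -
  let ?P = "\<lambda>b x. frechet_derivative (u \<circ> chart_inv c) (at x) b"
  have Xp: "X p \<in> tangent_space M p" using field_mem[OF X] .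
  have Yb: "smooth_near M p (\<lambda>q. Y q (\<lambda>r. snd c r \<bullet> b))" for b
    by (rule field_smooth[OF Y smooth_near_coord[OF c]])
  have P: "smooth_near M p (\<lambda>q. ?P b (snd c q))" for b by (rule smooth_near_partial[OF c u])
  have "\<forall>\<^sub>F q in near M p. Y q u = (\<Sum>b\<in>Basis. Y q (\<lambda>r. snd c r \<bullet> b) * ?P b (snd c q))"
    using self.along_near_near[OF Y] charts_at_near[OF c] smooth_near_near[OF u]
  proof eventually_elim
    case (elim q)
    have "Y q u = (\<Sum>b\<in>Basis. Y q (\<lambda>r. snd c r \<bullet> b) *\<^sub>T coord_vec M c q b) u"
      by (rule fun_cong[OF tangent_expand(2)[OF elim(2) field_mem[OF elim(1)]]])
    then show ?case using elim(3) by (simp add: sum_fun_apply coord_vec_apply)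
  qed
  then have "X p (\<lambda>q. Y q u) = X p (\<lambda>q. \<Sum>b\<in>Basis. Y q (\<lambda>r. snd c r \<bullet> b) * ?P b (snd c q))"
    by (rule tangent_cong[OF Xp])
  also have "\<dots> = (\<Sum>b\<in>Basis. X p (\<lambda>q. Y q (\<lambda>r. snd c r \<bullet> b) * ?P b (snd c q)))"
    by (rule tangent_sum[OF Xp smooth_near_mult[OF Yb P]])
  also have "\<dots> = (\<Sum>b\<in>Basis. Y p (\<lambda>r. snd c r \<bullet> b) * X p (\<lambda>q. ?P b (snd c q)) +
      X p (\<lambda>q. Y q (\<lambda>r. snd c r \<bullet> b)) * ?P b (snd c p))"
    by (intro sum.cong refl tangent_mult[OF Xp] Yb P)
  also have "\<dots> = (\<Sum>b\<in>Basis. Y p (\<lambda>r. snd c r \<bullet> b) * (\<Sum>a\<in>Basis. X p (\<lambda>r. snd c r \<bullet> a) *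
      frechet_derivative (?P b) (at (snd c p)) a) +
      X p (\<lambda>q. Y q (\<lambda>r. snd c r \<bullet> b)) * ?P b (snd c p))"
    by (simp add: tangent_compose[OF Xp smooth_near_coord[OF c] smooth_on_frechet[OF S(3)] S(1,2)] mult.commute)
  finally show ?thesis
    by (simp add: sum.distrib sum_distrib_left coord_vec_apply[OF u] add.commute)
qed

text \<open>Symmetry of second derivatives cancels the second-order parts of the two iterated
  derivatives; what remains is the coordinate vector \<open>e\<close>.\<close>

lemma bracket_mem:
  assumes X: "field_near M p X" and Y: "field_near M p Y"
  shows "bracket M X Y p \<in> tangent_space M p"
proof -
  have p: "p \<in> points M" using self.along_points[OF X] .
  obtain c where c: "c \<in> charts_at M p" using chart_exists[OF p] by (elim exE)
  define e where "e = (\<Sum>b\<in>Basis. (X p (\<lambda>q. Y q (\<lambda>r. snd c r \<bullet> b)) - Y p (\<lambda>q. X q (\<lambda>r. snd c r \<bullet> b))) *\<^sub>R b)"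
  have "bracket M X Y p = coord_vec M c p e"
  proof
    fix u
    show "bracket M X Y p u = coord_vec M c p e u"
    proof (cases "smooth_near M p u")
      case u: True
      obtain S where S: "open S" "snd c p \<in> S" "smooth_on S (u \<circ> chart_inv c)"
        using iffD1[OF smooth_near_chart[OF c] u] by (elim exE conjE)
      let ?D = "\<lambda>a b. frechet_derivative (\<lambda>x. frechet_derivative (u \<circ> chart_inv c) (at x) b) (at (snd c p)) a"
      have "(\<Sum>b\<in>Basis. \<Sum>a\<in>Basis. Y p (\<lambda>r. snd c r \<bullet> b) * (X p (\<lambda>r. snd c r \<bullet> a) * ?D a b)) =
          (\<Sum>a\<in>Basis. \<Sum>b\<in>Basis. X p (\<lambda>r. snd c r \<bullet> a) * (Y p (\<lambda>r. snd c r \<bullet> b) * ?D b a))"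
        by (subst sum.swap, intro sum.cong refl)
          (simp add: smooth_on_partials_commute[OF S(3,1,2)] mult.left_commute)
      then show ?thesis
        by (simp add: bracket_apply[OF u] field_twice[OF c X Y u S] field_twice[OF c Y X u S]
            e_def coord_vec_sum[OF c] sum_fun_apply left_diff_distrib sum_subtractf)
    qed (simp add: bracket_def coord_vec_def)
  qed
  then show ?thesis using coord_vec_mem[OF c] by simp
qed

lemma bracket_field:
  assumes X: "field_near M p X" and Y: "field_near M p Y"
  shows "field_near M p (bracket M X Y)"
proof (rule self.along_nearI)
  show "p \<in> points M" using self.along_points[OF X] .
  show *: "\<forall>\<^sub>F q in near M p. field_near M q X \<and> field_near M q Y"
    using X[THEN self.along_near_near] Y[THEN self.along_near_near] by eventually_elim simp
  show "\<forall>\<^sub>F q in near M p. bracket M X Y q \<in> tangent_space M (id q)"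
    using * by eventually_elim (simp add: bracket_mem)
  show "smooth_near M q (\<lambda>r. bracket M X Y r u)"
    if "smooth_near M (id q) u" "field_near M q X \<and> field_near M q Y" for u q
  proof (rule smooth_near_cong)
    have u: "smooth_near M q u" using that(1) by simp
    show "smooth_near M q (\<lambda>r. X r (\<lambda>s. Y s u) - Y r (\<lambda>s. X s u))"
      using that(2) by (intro smooth_near_diff field_smooth[of q X] field_smooth[of q Y] u) simp_all
    show "\<forall>\<^sub>F r in near M q. X r (\<lambda>s. Y s u) - Y r (\<lambda>s. X s u) = bracket M X Y r u"
      using smooth_near_near[OF u] by eventually_elim (simp add: bracket_apply)
  qed
qed

text \<open>The components of coordinate fields are constant near \<open>p\<close>, and a tangent
  vector is determined by its values on the coordinates.\<close>

lemma bracket_coord: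
  assumes c: "c \<in> charts_at M p"
  shows "bracket M (\<lambda>q. coord_vec M c q a) (\<lambda>q. coord_vec M c q b) p = 0" (is "?B = 0")
proof -
  have zero: "coord_vec M c p e (\<lambda>q. coord_vec M c q e' (\<lambda>r. snd c r \<bullet> b)) = 0" for e e' b
  proof -
    have "coord_vec M c p e (\<lambda>q. coord_vec M c q e' (\<lambda>r. snd c r \<bullet> b)) = coord_vec M c p e (\<lambda>q. e' \<bullet> b)"
      by (rule tangent_cong[OF coord_vec_mem[OF c]])
        (use charts_at_near[OF c] in \<open>eventually_elim, simp add: coord_vec_coord\<close>)
    then show ?thesis by (simp add: tangent_const[OF coord_vec_mem[OF c]])
  qed
  have "?B (\<lambda>q. snd c q \<bullet> b) = 0" for b
    by (simp add: bracket_apply[OF smooth_near_coord[OF c]] zero)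
  then show ?thesis
    by (subst tangent_expand(1)[OF c bracket_mem[OF coord_field[OF c] coord_field[OF c]]])
      (simp add: coord_vec_linear(3)[OF c])
qed

end

lemma tscale_zero [simp]: "0 *\<^sub>T v = 0" "r *\<^sub>T (0 :: 'a tvec) = 0"
  by (simp_all add: fun_eq_iff)

lemma tscale_one [simp]: "1 *\<^sub>T v = v"
  by (simp add: fun_eq_iff)

lemma tscale_add: "(r + s) *\<^sub>T v = r *\<^sub>T v + s *\<^sub>T v" "r *\<^sub>T (v + w) = r *\<^sub>T v + r *\<^sub>T w"
  by (simp_all add: fun_eq_iff algebra_simps)

lemma tscale_tscale: "r *\<^sub>T s *\<^sub>T v = (r * s) *\<^sub>T v"
  by (simp add: fun_eq_iff)

lemma tscale_sum: "r *\<^sub>T (\<Sum>j\<in>J. f j) = (\<Sum>j\<in>J. r *\<^sub>T f j)"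
  by (simp add: fun_eq_iff sum_fun_apply sum_distrib_left)

section \<open>Affine connections\<close>

locale conn_mfd = smooth_mfd M for M :: "('a, 'e::euclidean_space) manifold" +
  fixes D :: "'a conn"
  assumes conn: "affine_connection M D"
begin

lemma conn_mem: "field_near M p Y \<Longrightarrow> v \<in> tangent_space M p \<Longrightarrow> D p v Y \<in> tangent_space M p"
  using conn tangent_points[of v p] unfolding affine_connection_def by simp

lemma conn_vec_add:
  "field_near M p Y \<Longrightarrow> v \<in> tangent_space M p \<Longrightarrow> w \<in> tangent_space M p \<Longrightarrow>
    D p (v + w) Y = D p v Y + D p w Y"
  using conn tangent_points[of v p] unfolding affine_connection_def lin_map_def by simp

lemma conn_vec_scale:
  "field_near M p Y \<Longrightarrow> v \<in> tangent_space M p \<Longrightarrow> D p (r *\<^sub>T v) Y = r *\<^sub>T D p v Y"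
  using conn tangent_points[of v p] unfolding affine_connection_def lin_map_def by simp

lemma conn_vec_zero: "field_near M p Y \<Longrightarrow> D p 0 Y = 0"
  using conn_vec_scale[of p Y 0 0] tangent_zero_mem[OF self.along_points] by simp

lemma conn_vec_sum:
  assumes Y: "field_near M p Y" and "\<And>j. j \<in> J \<Longrightarrow> v j \<in> tangent_space M p"
  shows "D p (\<Sum>j\<in>J. r j *\<^sub>T v j) Y = (\<Sum>j\<in>J. r j *\<^sub>T D p (v j) Y)"
  using assms(2)
proof (induction J rule: infinite_finite_induct)
  case (insert j J)
  have "(\<Sum>j\<in>J. r j *\<^sub>T v j) \<in> tangent_space M p"
    using insert.prems by (intro tangent_sum_mem tangent_scale_mem self.along_points[OF Y]) auto
  then show ?case
    using insert by (simp add: conn_vec_add[OF Y] conn_vec_scale[OF Y] tangent_scale_mem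
        del: plus_fun_apply zero_fun_apply tscale_apply)
qed (simp_all add: conn_vec_zero[OF Y])

lemma conn_add:
  "field_near M p Y \<Longrightarrow> field_near M p Z \<Longrightarrow> v \<in> tangent_space M p \<Longrightarrow>
    D p v (\<lambda>q. Y q + Z q) = D p v Y + D p v Z"
  using conn tangent_points[of v p] unfolding affine_connection_def by simp

lemma conn_leibniz:
  "smooth_near M p u \<Longrightarrow> field_near M p Y \<Longrightarrow> v \<in> tangent_space M p \<Longrightarrow>
    D p v (\<lambda>q. u q *\<^sub>T Y q) = v u *\<^sub>T Y p + u p *\<^sub>T D p v Y"
  using conn tangent_points[of v p] unfolding affine_connection_def by simp

lemma conn_field:
  "field_near M p X \<Longrightarrow> field_near M p Y \<Longrightarrow> field_near M p (\<lambda>q. D q (X q) Y)"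
  using conn self.along_points[of p X] unfolding affine_connection_def by simp

text \<open>The Leibniz rule with \<open>u\<close> the indicator function of a neighbourhood, which is smooth near \<open>p\<close>.\<close>

lemma conn_cong:
  assumes Y: "field_near M p Y" and eq: "\<forall>\<^sub>F q in near M p. Y q = Y' q" and v: "v \<in> tangent_space M p"
  shows "D p v Y = D p v Y'"
proof -
  have p: "p \<in> points M" using tangent_points[OF v] .
  define u :: "'a \<Rightarrow> real" where "u q = (if Y q = Y' q then 1 else 0)" for q
  have ev: "\<forall>\<^sub>F q in near M p. u q = 1" using eq by eventually_elim (simp add: u_def)
  have u: "smooth_near M p u"
    by (rule smooth_near_cong[OF smooth_near_const[OF p, of 1]]) (use ev in eventually_elim, simp)
  have "v u = 0" using tangent_cong[OF v ev] tangent_const[OF v] by simp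
  moreover have "u p = 1" using near_self[OF ev p] .
  ultimately have 1: "D p v (\<lambda>q. u q *\<^sub>T Z q) = D p v Z" if "field_near M p Z" for Z
    using conn_leibniz[OF u that v] by simp
  \<comment> \<open>This equality is global: where the fields differ, both sides are 0. Hence the
    two covariant derivatives are taken of one and the same function.\<close>
  have "(\<lambda>q. u q *\<^sub>T Y q) = (\<lambda>q. u q *\<^sub>T Y' q)" by (auto simp: u_def)
  then show ?thesis using 1[OF Y] 1[OF self.along_cong[OF Y eq]] by simp
qed

lemma conn_zero: "v \<in> tangent_space M p \<Longrightarrow> D p v (\<lambda>q. 0) = 0"
  using conn_leibniz[OF smooth_near_const[of p 0], of "\<lambda>q. 0" v] self.along_zero[of p]
    tangent_points[of v p] tangent_const[of v p] by simp

lemma conn_sum_leibniz: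
  assumes "\<And>j. j \<in> J \<Longrightarrow> smooth_near M p (f j)" "\<And>j. j \<in> J \<Longrightarrow> field_near M p (Z j)"
    and v: "v \<in> tangent_space M p"
  shows "D p v (\<lambda>q. \<Sum>j\<in>J. f j q *\<^sub>T Z j q) = (\<Sum>j\<in>J. v (f j) *\<^sub>T Z j p + f j p *\<^sub>T D p v (Z j))"
  using assms(1,2)
proof (induction J rule: infinite_finite_induct)
  case (insert j J)
  have 1: "field_near M p (\<lambda>q. f j q *\<^sub>T Z j q)"
    by (intro self.along_scale insert.prems insertI1)
  have 2: "field_near M p (\<lambda>q. \<Sum>j\<in>J. f j q *\<^sub>T Z j q)"
    by (intro self.along_sum self.along_scale tangent_points[OF v] insert.prems insertI2)
  have IH: "D p v (\<lambda>q. \<Sum>j\<in>J. f j q *\<^sub>T Z j q) = (\<Sum>j\<in>J. v (f j) *\<^sub>T Z j p + f j p *\<^sub>T D p v (Z j))"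
    by (intro insert.IH insert.prems insertI2)
  show ?case
    unfolding sum.insert[OF insert.hyps] conn_add[OF 1 2 v] IH
    by (simp only: conn_leibniz[OF insert.prems(1)[OF insertI1] insert.prems(2)[OF insertI1] v])
qed (simp_all add: conn_zero[OF v])

end

section \<open>The pullback of a connection along a smooth map\<close>

context smooth_mfd_map
begin

text \<open>Names the chart chosen inside \<open>pullback_conn\<close>. The choice is made
  separately for each point, without any coherence between points.\<close>

definition base_chart :: "'b \<Rightarrow> ('a, 'e) chart" where
  "base_chart p = (SOME c. c \<in> charts_at N (i p))"

lemma base_chart: "p \<in> points M \<Longrightarrow> base_chart p \<in> charts_at N (i p)"
  unfolding base_chart_def by (rule someI_ex[OF N.chart_exists[OF map_points]])

lemma pullback_conn_eq:
  "pullback_conn N i D p v W = (\<Sum>b\<in>Basis. v (\<lambda>q. W q (\<lambda>r. snd (base_chart p) r \<bullet> b)) *\<^sub>T coord_vec N (base_chart p) (i p) b +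
    W p (\<lambda>r. snd (base_chart p) r \<bullet> b) *\<^sub>T
      D (i p) (push N i p v) (\<lambda>r. coord_vec N (base_chart p) r b))"
  by (simp only: pullback_conn_def base_chart_def Let_def)

lemma pullback_conn_cong:
  assumes v: "v \<in> tangent_space M p" and eq: "\<forall>\<^sub>F q in near M p. W q = W' q"
  shows "pullback_conn N i D p v W = pullback_conn N i D p v W'"
proof -
  have p: "p \<in> points M" using M.tangent_points[OF v] .
  have "W p = W' p" using near_self[OF eq p] .
  moreover have "v (\<lambda>q. W q u) = v (\<lambda>q. W' q u)" for u
    by (rule M.tangent_cong[OF v]) (use eq in \<open>eventually_elim, simp\<close>)
  ultimately show ?thesis unfolding pullback_conn_eq by simp
qed

end

locale pullback_mfd = smooth_mfd_map M N i + N: conn_mfd N D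
  for M :: "('b, 'f::euclidean_space) manifold" and N :: "('a, 'e::euclidean_space) manifold"
    and i :: "'b \<Rightarrow> 'a" and D :: "'a conn"
begin

abbreviation pb :: "'b \<Rightarrow> 'b tvec \<Rightarrow> ('b \<Rightarrow> 'a tvec) \<Rightarrow> 'a tvec" where
  "pb \<equiv> pullback_conn N i D"

lemma pull_mem:
  assumes v: "v \<in> tangent_space M p"
  shows "pb p v W \<in> tangent_space N (i p)"
proof -
  have p: "p \<in> points M" using M.tangent_points[OF v] .
  note c = base_chart[OF p] and pb = pullback_conn_eq[of D]
  show ?thesis unfolding pb
    by (intro N.tangent_sum_mem map_points p N.tangent_add_mem N.tangent_scale_mem N.coord_vec_mem
        N.conn_mem N.coord_field c push_mem v)
qed

lemma pull_vec_linear: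
  assumes v: "v \<in> tangent_space M p"
  shows pull_vec_add: "w \<in> tangent_space M p \<Longrightarrow> pb p (v + w) W = pb p v W + pb p w W"
    and pull_vec_scale: "pb p (r *\<^sub>T v) W = r *\<^sub>T pb p v W"
proof -
  have p: "p \<in> points M" using M.tangent_points[OF v] .
  note c = base_chart[OF p] and pb = pullback_conn_eq[of D]
  show "pb p (v + w) W = pb p v W + pb p w W" if w: "w \<in> tangent_space M p"
    unfolding pb push_linear
    by (simp add: N.conn_vec_add[OF N.coord_field[OF c] push_mem[OF v] push_mem[OF w]]
        fun_eq_iff sum_fun_apply sum.distrib[symmetric] algebra_simps)
  show "pb p (r *\<^sub>T v) W = r *\<^sub>T pb p v W"
    unfolding pb push_linear
    by (simp add: N.conn_vec_scale[OF N.coord_field[OF c] push_mem[OF v]]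
        fun_eq_iff sum_fun_apply sum_distrib_left algebra_simps)
qed

lemma pull_add:
  assumes v: "v \<in> tangent_space M p" and W: "along_near M N i p W" "along_near M N i p W'"
  shows "pb p v (\<lambda>q. W q + W' q) = pb p v W + pb p v W'"
proof -
  have p: "p \<in> points M" using M.tangent_points[OF v] .
  note c = base_chart[OF p] and pb = pullback_conn_eq[of D]
  show ?thesis unfolding pb
    by (simp add: M.tangent_add[OF v along_component[OF W(1) c] along_component[OF W(2) c]]
        fun_eq_iff sum_fun_apply sum.distrib[symmetric] algebra_simps)
qed

lemma pull_leibniz:
  assumes v: "v \<in> tangent_space M p" and f: "smooth_near M p f" and W: "along_near M N i p W"
  shows "pb p v (\<lambda>q. f q *\<^sub>T W q) = v f *\<^sub>T W p + f p *\<^sub>T pb p v W"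
proof -
  have p: "p \<in> points M" using M.tangent_points[OF v] .
  note c = base_chart[OF p] and pb = pullback_conn_eq[of D]
  let ?e = "coord_vec N (base_chart p) (i p)" and ?x = "\<lambda>b r. snd (base_chart p) r \<bullet> b"
  let ?D = "\<lambda>b. D (i p) (push N i p v) (\<lambda>r. coord_vec N (base_chart p) r b)"
  have 1: "v (\<lambda>q. (f q *\<^sub>T W q) (?x b)) *\<^sub>T ?e b + (f p *\<^sub>T W p) (?x b) *\<^sub>T ?D b =
      v f *\<^sub>T W p (?x b) *\<^sub>T ?e b + f p *\<^sub>T (v (\<lambda>q. W q (?x b)) *\<^sub>T ?e b + W p (?x b) *\<^sub>T ?D b)" for b
    by (simp add: M.tangent_mult[OF v f along_component[OF W c]] fun_eq_iff algebra_simps)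
  show ?thesis
    unfolding pb 1 sum.distrib
    by (subst N.tangent_expand(2)[OF c along_mem[OF W]]) (simp only: tscale_sum tscale_add sum.distrib)
qed

text \<open>The components of Z after i are those of Z composed with \<open>i\<close>, and
  \<open>push\<close> differentiates just these compositions; the defining formula of the pullback
  is then the Leibniz expansion of \<open>D\<close> on Z.\<close>

lemma pull_field:
  assumes v: "v \<in> tangent_space M p" and Z: "field_near N (i p) Z"
  shows "pb p v (\<lambda>q. Z (i q)) = D (i p) (push N i p v) Z"
proof -
  have p: "p \<in> points M" using M.tangent_points[OF v] .
  define c where "c = base_chart p"
  note c = base_chart[OF p, folded c_def] and pb = pullback_conn_eq[of D p, folded c_def]
  have Zb: "smooth_near N (i p) (\<lambda>q. Z q (\<lambda>r. snd c r \<bullet> b))" for b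
    by (rule N.field_smooth[OF Z N.smooth_near_coord[OF c]])
  have "\<forall>\<^sub>F q in near N (i p). Z q = (\<Sum>b\<in>Basis. Z q (\<lambda>r. snd c r \<bullet> b) *\<^sub>T coord_vec N c q b)"
    using N.self.along_expand[OF Z, unfolded id_apply, OF c] by eventually_elim simp
  then have "D (i p) (push N i p v) Z =
      D (i p) (push N i p v) (\<lambda>q. \<Sum>b\<in>Basis. Z q (\<lambda>r. snd c r \<bullet> b) *\<^sub>T coord_vec N c q b)"
    by (rule N.conn_cong[OF Z _ push_mem[OF v]])
  also have "\<dots> = pb p v (\<lambda>q. Z (i q))"
    unfolding pb
    by (subst N.conn_sum_leibniz[OF Zb N.coord_field[OF c] push_mem[OF v]])
      (simp add: push_apply[OF Zb])
  finally show ?thesis by simp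
qed

lemma pull_zero: "v \<in> tangent_space M p \<Longrightarrow> pb p v (\<lambda>q. 0) = 0"
  using pull_leibniz[OF _ M.smooth_near_const[of p 0] along_zero] M.tangent_points M.tangent_const by simp

lemma pull_sum_leibniz:
  assumes "\<And>j. j \<in> J \<Longrightarrow> smooth_near M p (f j)" "\<And>j. j \<in> J \<Longrightarrow> field_near N (i p) (Z j)"
    and v: "v \<in> tangent_space M p"
  shows "pb p v (\<lambda>q. \<Sum>j\<in>J. f j q *\<^sub>T Z j (i q)) =
    (\<Sum>j\<in>J. v (f j) *\<^sub>T Z j (i p) + f j p *\<^sub>T D (i p) (push N i p v) (Z j))"
  using assms(1,2)
proof (induction J rule: infinite_finite_induct)
  case (insert j J)
  have p: "p \<in> points M" using M.tangent_points[OF v] .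
  have al: "along_near M N i p (\<lambda>q. Z k (i q))" if "k \<in> insert j J" for k
    by (rule along_field[OF p insert.prems(2)[OF that]])
  have 1: "along_near M N i p (\<lambda>q. f j q *\<^sub>T Z j (i q))"
    by (intro along_scale al insert.prems insertI1)
  have 2: "along_near M N i p (\<lambda>q. \<Sum>j\<in>J. f j q *\<^sub>T Z j (i q))"
    by (intro along_sum along_scale p al insert.prems insertI2)
  have IH: "pb p v (\<lambda>q. \<Sum>j\<in>J. f j q *\<^sub>T Z j (i q)) =
      (\<Sum>j\<in>J. v (f j) *\<^sub>T Z j (i p) + f j p *\<^sub>T D (i p) (push N i p v) (Z j))"
    by (intro insert.IH insert.prems insertI2)
  show ?case
    unfolding sum.insert[OF insert.hyps] pull_add[OF v 1 2] IH
    by (simp only: pull_leibniz[OF v insert.prems(1)[OF insertI1] al[OF insertI1]]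
        pull_field[OF v insert.prems(2)[OF insertI1]])
qed (simp_all add: pull_zero[OF v])

text \<open>Expanding \<open>W\<close> in the chart \<open>d\<close> and applying the Leibniz rule
  and naturality shows that the choice of chart does not matter. Smoothness in the base point can
  only be seen in one fixed chart, since the chosen chart may jump.\<close>

lemma pull_in_chart:
  assumes v: "v \<in> tangent_space M p" and W: "along_near M N i p W" and d: "d \<in> charts_at N (i p)"
  shows "pb p v W = (\<Sum>b\<in>Basis. v (\<lambda>q. W q (\<lambda>r. snd d r \<bullet> b)) *\<^sub>T coord_vec N d (i p) b +
        W p (\<lambda>r. snd d r \<bullet> b) *\<^sub>T D (i p) (push N i p v) (\<lambda>r. coord_vec N d r b))"
proof -
  have "pb p v W = pb p v (\<lambda>q. \<Sum>b\<in>Basis. W q (\<lambda>r. snd d r \<bullet> b) *\<^sub>T coord_vec N d (i q) b)"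
    by (rule pullback_conn_cong[OF v along_expand[OF W d], symmetric])
  also have "\<dots> = (\<Sum>b\<in>Basis. v (\<lambda>q. W q (\<lambda>r. snd d r \<bullet> b)) *\<^sub>T coord_vec N d (i p) b +
        W p (\<lambda>r. snd d r \<bullet> b) *\<^sub>T D (i p) (push N i p v) (\<lambda>r. coord_vec N d r b))"
    by (rule pull_sum_leibniz[OF along_component[OF W d] N.coord_field[OF d] v])
  finally show ?thesis .
qed

lemma pull_smooth:
  assumes X: "field_near M p X" and W: "along_near M N i p W"
  shows "along_near M N i p (\<lambda>q. pb q (X q) W)"
proof -
  have p: "p \<in> points M" using along_points[OF W] .
  obtain d where d: "d \<in> charts_at N (i p)" using N.chart_exists[OF map_points[OF p]] by (elim exE)
  let ?x = "\<lambda>b r. snd d r \<bullet> b"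
  have Wb: "smooth_near M p (\<lambda>q. W q (?x b))" for b by (rule along_component[OF W d])
  \<comment> \<open>Smoothness of \<open>D\<close> is postulated for fields on \<open>N\<close>,
    whereas the pushed direction is only a field along \<open>i\<close>. Its coefficients are
    therefore pulled out, leaving derivatives of coordinate fields in coordinate directions.\<close>
  have "along_near M N i p (\<lambda>q. \<Sum>b\<in>Basis. X q (\<lambda>q. W q (?x b)) *\<^sub>T coord_vec N d (i q) b +
      W q (?x b) *\<^sub>T (\<Sum>a\<in>Basis. push N i q (X q) (?x a) *\<^sub>T
        D (i q) (coord_vec N d (i q) a) (\<lambda>r. coord_vec N d r b)))"
    by (intro along_sum along_add along_scale p M.field_smooth[OF X Wb] Wb
        along_component[OF along_push[OF X] d] along_field[OF p N.coord_field[OF d]]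
        along_field[OF p N.conn_field[OF N.coord_field[OF d] N.coord_field[OF d]]])
  then show ?thesis
  proof (rule along_cong)
    show "\<forall>\<^sub>F q in near M p. (\<Sum>b\<in>Basis. X q (\<lambda>q. W q (?x b)) *\<^sub>T coord_vec N d (i q) b +
      W q (?x b) *\<^sub>T (\<Sum>a\<in>Basis. push N i q (X q) (?x a) *\<^sub>T
        D (i q) (coord_vec N d (i q) a) (\<lambda>r. coord_vec N d r b))) = pb q (X q) W"
      using M.self.along_near_near[OF X] along_near_near[OF W] map_near[OF p N.charts_at_near[OF d]]
    proof eventually_elim
      case (elim q)
      have Xq: "X q \<in> tangent_space M q" using M.field_mem[OF elim(1)] .
      have "D (i q) (push N i q (X q)) Z =
        (\<Sum>a\<in>Basis. push N i q (X q) (?x a) *\<^sub>T D (i q) (coord_vec N d (i q) a) Z)"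
        if Z: "field_near N (i q) Z" for Z
        by (subst N.tangent_expand(2)[OF elim(3) push_mem[OF Xq]])
          (rule N.conn_vec_sum[OF Z N.coord_vec_mem[OF elim(3)]])
      then show ?case
        by (simp add: pull_in_chart[OF Xq elim(2,3)] N.coord_field[OF elim(3)])
    qed
  qed
qed

text \<open>Coordinate fields commute, so without torsion their mutual derivatives are symmetric and
  the double sums cancel. The remaining derivatives of components are those of the pushed
  bracket.\<close>

lemma pull_torsion:
  assumes torsion: "\<And>X Y. field_near N (i p) X \<Longrightarrow> field_near N (i p) Y \<Longrightarrow>
      D (i p) (X (i p)) Y - D (i p) (Y (i p)) X = bracket N X Y (i p)"
    and X: "field_near M p X" and Y: "field_near M p Y"
  shows "pb p (X p) (\<lambda>q. push N i q (Y q)) - pb p (Y p) (\<lambda>q. push N i q (X q)) =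
    push N i p (bracket M X Y p)"
proof -
  have p: "p \<in> points M" using M.self.along_points[OF X] .
  obtain d where d: "d \<in> charts_at N (i p)" using N.chart_exists[OF map_points[OF p]] by (elim exE)
  let ?x = "\<lambda>b r. snd d r \<bullet> b"
  let ?e = "\<lambda>b. coord_vec N d (i p) b" and ?E = "\<lambda>b r. coord_vec N d r b"
  have sym: "D (i p) (?e a) (?E b) = D (i p) (?e b) (?E a)" for a b
    using torsion[OF N.coord_field[OF d, of a] N.coord_field[OF d, of b]] N.bracket_coord[OF d] by simp
  have pb: "pb p (X p) (\<lambda>q. push N i q (Y q)) =
      (\<Sum>b\<in>Basis. X p (\<lambda>q. Y q (\<lambda>r. ?x b (i r))) *\<^sub>T ?e b) +
      (\<Sum>b\<in>Basis. \<Sum>a\<in>Basis. (push N i p (Y p) (?x b) * push N i p (X p) (?x a)) *\<^sub>T D (i p) (?e a) (?E b))"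
    if X: "field_near M p X" and Y: "field_near M p Y" for X Y
  proof -
    have Xp: "X p \<in> tangent_space M p" using M.field_mem[OF X] .
    have 1: "X p (\<lambda>q. push N i q (Y q) (?x b)) = X p (\<lambda>q. Y q (\<lambda>r. ?x b (i r)))" for b
      by (rule M.tangent_cong[OF Xp along_push_near[OF Y N.smooth_near_coord[OF d]]])
    have 2: "D (i p) (push N i p (X p)) (?E b) =
        (\<Sum>a\<in>Basis. push N i p (X p) (?x a) *\<^sub>T D (i p) (?e a) (?E b))" for b
      by (subst N.tangent_expand(2)[OF d push_mem[OF Xp]])
        (rule N.conn_vec_sum[OF N.coord_field[OF d] N.coord_vec_mem[OF d]])
    show ?thesis
      by (simp add: pull_in_chart[OF Xp along_push[OF Y] d] 1 2 sum.distrib tscale_sum tscale_tscale)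
  qed
  have "(\<Sum>b\<in>Basis. \<Sum>a\<in>Basis. (push N i p (Y p) (?x b) * push N i p (X p) (?x a)) *\<^sub>T D (i p) (?e a) (?E b)) =
      (\<Sum>a\<in>Basis. \<Sum>b\<in>Basis. (push N i p (X p) (?x a) * push N i p (Y p) (?x b)) *\<^sub>T D (i p) (?e b) (?E a))"
    by (subst sum.swap, intro sum.cong refl) (simp add: sym mult.commute)
  then have "pb p (X p) (\<lambda>q. push N i q (Y q)) - pb p (Y p) (\<lambda>q. push N i q (X q)) =
      (\<Sum>b\<in>Basis. X p (\<lambda>q. Y q (\<lambda>r. ?x b (i r))) *\<^sub>T ?e b) - (\<Sum>b\<in>Basis. Y p (\<lambda>q. X q (\<lambda>r. ?x b (i r))) *\<^sub>T ?e b)"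
    unfolding pb[OF X Y] pb[OF Y X] by simp
  also have "\<dots> = (\<Sum>b\<in>Basis. push N i p (bracket M X Y p) (?x b) *\<^sub>T ?e b)"
    using map_smooth[OF p N.smooth_near_coord[OF d]]
    by (simp add: push_apply[OF N.smooth_near_coord[OF d]] M.bracket_apply fun_eq_iff sum_fun_apply
        sum_subtractf[symmetric] left_diff_distrib)
  also have "\<dots> = push N i p (bracket M X Y p)"
    by (rule N.tangent_expand(2)[OF d push_mem[OF M.bracket_mem[OF X Y]], symmetric])
  finally show ?thesis .
qed

end

section \<open>Forms, metrics and tensors along a map\<close>

lemma lin_formD:
  assumes "lin_form T f"
  shows lin_form_add: "v \<in> T \<Longrightarrow> w \<in> T \<Longrightarrow> f (v + w) = f v + f w"
    and lin_form_scale: "v \<in> T \<Longrightarrow> f (r *\<^sub>T v) = r * f v"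
  using assms by (simp_all add: lin_form_def)

lemma (in smooth_mfd) lin_form_sum:
  assumes f: "lin_form (tangent_space M p) f" and p: "p \<in> points M"
    and "\<And>j. j \<in> J \<Longrightarrow> v j \<in> tangent_space M p"
  shows "f (\<Sum>j\<in>J. r j *\<^sub>T v j) = (\<Sum>j\<in>J. r j * f (v j))"
  using assms(3)
proof (induction J rule: infinite_finite_induct)
  case (insert j J)
  have 1: "(\<Sum>j\<in>J. r j *\<^sub>T v j) \<in> tangent_space M p"
    by (intro tangent_sum_mem tangent_scale_mem p insert.prems insertI2)
  have 2: "v j \<in> tangent_space M p" by (intro insert.prems insertI1)
  have IH: "f (\<Sum>j\<in>J. r j *\<^sub>T v j) = (\<Sum>j\<in>J. r j * f (v j))"
    by (intro insert.IH insert.prems insertI2)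
  show ?case
    unfolding sum.insert[OF insert.hyps] lin_form_add[OF f tangent_scale_mem[OF 2] 1]
      lin_form_scale[OF f 2] IH by (rule refl)
qed (use lin_form_scale[OF f tangent_zero_mem[OF p], of 0] in simp_all)

lemma lin_mapD:
  assumes "lin_map T f"
  shows lin_map_add: "v \<in> T \<Longrightarrow> w \<in> T \<Longrightarrow> f (v + w) = f v + f w"
    and lin_map_scale: "v \<in> T \<Longrightarrow> f (r *\<^sub>T v) = r *\<^sub>T f v"
  using assms by (simp_all add: lin_map_def)

lemma (in smooth_mfd) lin_map_sum:
  assumes f: "lin_map (tangent_space M p) f" and p: "p \<in> points M"
    and "\<And>j. j \<in> J \<Longrightarrow> v j \<in> tangent_space M p"
  shows "f (\<Sum>j\<in>J. r j *\<^sub>T v j) = (\<Sum>j\<in>J. r j *\<^sub>T f (v j))"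
  using assms(3)
proof (induction J rule: infinite_finite_induct)
  case (insert j J)
  have 1: "(\<Sum>j\<in>J. r j *\<^sub>T v j) \<in> tangent_space M p"
    by (intro tangent_sum_mem tangent_scale_mem p insert.prems insertI2)
  have 2: "v j \<in> tangent_space M p" by (intro insert.prems insertI1)
  have IH: "f (\<Sum>j\<in>J. r j *\<^sub>T v j) = (\<Sum>j\<in>J. r j *\<^sub>T f (v j))"
    by (intro insert.IH insert.prems insertI2)
  show ?case
    unfolding sum.insert[OF insert.hyps] lin_map_add[OF f tangent_scale_mem[OF 2] 1]
      lin_map_scale[OF f 2] IH by (rule refl)
qed (use lin_map_scale[OF f tangent_zero_mem[OF p], of 0] in simp_all)

context smooth_mfd_map
begin

text \<open>The form is indexed by points of \<open>M\<close>, not of \<open>N\<close>, so that the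
  metric with one argument filled by a field along \<open>i\<close> is an instance.\<close>

lemma along_form:
  assumes lin: "\<forall>\<^sub>F q in near M p. lin_form (tangent_space N (i q)) (\<omega> q)"
    and sm: "\<And>Z. field_near N (i p) Z \<Longrightarrow> smooth_near M p (\<lambda>q. \<omega> q (Z (i q)))"
    and W: "along_near M N i p W"
  shows "smooth_near M p (\<lambda>q. \<omega> q (W q))"
proof -
  have p: "p \<in> points M" using along_points[OF W] .
  obtain d where d: "d \<in> charts_at N (i p)" using N.chart_exists[OF map_points[OF p]] by (elim exE)
  have "smooth_near M p (\<lambda>q. \<Sum>b\<in>Basis. W q (\<lambda>r. snd d r \<bullet> b) * \<omega> q (coord_vec N d (i q) b))"
    by (intro M.smooth_near_sum p M.smooth_near_mult along_component[OF W d] sm[OF N.coord_field[OF d]])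
  then show ?thesis
  proof (rule M.smooth_near_cong)
    show "\<forall>\<^sub>F q in near M p. (\<Sum>b\<in>Basis. W q (\<lambda>r. snd d r \<bullet> b) * \<omega> q (coord_vec N d (i q) b)) = \<omega> q (W q)"
      using along_expand[OF W d] map_near[OF p N.charts_at_near[OF d]] near_points[of M p] lin
    proof eventually_elim
      case (elim q)
      show ?case
        by (rule trans[OF N.lin_form_sum[OF elim(4) map_points[OF elim(3)] N.coord_vec_mem[OF elim(2)], symmetric]])
          (rule arg_cong[OF elim(1)])
    qed
  qed
qed

lemma along_one_form:
  assumes \<omega>: "one_form N \<omega>" and W: "along_near M N i p W"
  shows "smooth_near M p (\<lambda>q. \<omega> (i q) (W q))"
proof (rule along_form[OF _ _ W])
  have p: "p \<in> points M" using along_points[OF W] .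
  show "\<forall>\<^sub>F q in near M p. lin_form (tangent_space N (i q)) (\<omega> (i q))"
    using near_points[of M p] by eventually_elim (use \<omega> map_points in \<open>simp add: one_form_def\<close>)
  show "smooth_near M p (\<lambda>q. \<omega> (i q) (Z (i q)))" if Z: "field_near N (i p) Z" for Z
    by (rule map_smooth[OF p, of "\<lambda>x. \<omega> x (Z x)"])
      (use \<omega> map_points[OF p] Z in \<open>simp add: one_form_def\<close>)
qed

text \<open>The two arguments are generalized one after the other from fields on \<open>N\<close> to
  fields along \<open>i\<close>; symmetry of \<open>g\<close> exchanges the slots in
  between.\<close>

lemma along_metric:
  assumes g: "riemannian_metric N g" and W: "along_near M N i p W" and W': "along_near M N i p W'"
  shows "smooth_near M p (\<lambda>q. g (i q) (W q) (W' q))"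
proof -
  have p: "p \<in> points M" using along_points[OF W] .
  have lin: "lin_form (tangent_space N x) (g x v)" if "v \<in> tangent_space N x" for x v
    using g N.tangent_points[OF that] that by (simp add: riemannian_metric_def)
  have sym: "g x v w = g x w v" if "v \<in> tangent_space N x" "w \<in> tangent_space N x" for x v w
    using g N.tangent_points[OF that(1)] that by (simp add: riemannian_metric_def)
  have 1: "smooth_near M p (\<lambda>q. g (i q) (Z (i q)) (V q))"
    if Z: "field_near N (i p) Z" and V: "along_near M N i p V" for Z V
  proof (rule along_form[OF _ _ V])
    show "\<forall>\<^sub>F q in near M p. lin_form (tangent_space N (i q)) (g (i q) (Z (i q)))"
      using map_near[OF p N.self.along_near_near[OF Z]] by eventually_elim (rule lin[OF N.field_mem])
    show "smooth_near M p (\<lambda>q. g (i q) (Z (i q)) (Z' (i q)))" if Z': "field_near N (i p) Z'" for Z'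
      by (rule map_smooth[OF p, of "\<lambda>x. g x (Z x) (Z' x)"])
        (use g map_points[OF p] Z Z' in \<open>simp add: riemannian_metric_def\<close>)
  qed
  show ?thesis
  proof (rule along_form[OF _ _ W'])
    show "\<forall>\<^sub>F q in near M p. lin_form (tangent_space N (i q)) (g (i q) (W q))"
      using along_near_near[OF W] by eventually_elim (rule lin[OF along_mem])
    show "smooth_near M p (\<lambda>q. g (i q) (W q) (Z (i q)))" if Z: "field_near N (i p) Z" for Z
    proof (rule M.smooth_near_cong[OF 1[OF Z W]])
      show "\<forall>\<^sub>F q in near M p. g (i q) (Z (i q)) (W q) = g (i q) (W q) (Z (i q))"
        using along_near_near[OF W] map_near[OF p N.self.along_near_near[OF Z]]
        by eventually_elim (rule sym[OF N.field_mem along_mem])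
    qed
  qed
qed

lemma along_tensor_expand:
  assumes \<phi>: "tensor11 N \<phi>" and W: "along_near M N i p W" and d: "d \<in> charts_at N (i p)"
  shows "\<forall>\<^sub>F q in near M p.
    (\<Sum>b\<in>Basis. W q (\<lambda>r. snd d r \<bullet> b) *\<^sub>T \<phi> (i q) (coord_vec N d (i q) b)) = \<phi> (i q) (W q)"
  using along_expand[OF W d] map_near[OF along_points[OF W] N.charts_at_near[OF d]] near_points[of M p]
proof eventually_elim
  case (elim q)
  have "lin_map (tangent_space N (i q)) (\<phi> (i q))"
    using \<phi> map_points[OF elim(3)] by (simp add: tensor11_def)
  then show ?case
    by (rule trans[OF N.lin_map_sum[OF _ map_points[OF elim(3)] N.coord_vec_mem[OF elim(2)], symmetric]])
      (rule arg_cong[OF elim(1)])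
qed

lemma along_tensor:
  assumes \<phi>: "tensor11 N \<phi>" and W: "along_near M N i p W"
  shows "along_near M N i p (\<lambda>q. \<phi> (i q) (W q))"
proof -
  have p: "p \<in> points M" using along_points[OF W] .
  obtain d where d: "d \<in> charts_at N (i p)" using N.chart_exists[OF map_points[OF p]] by (elim exE)
  have "field_near N (i p) (\<lambda>x. \<phi> x (coord_vec N d x b))" for b
    using \<phi> N.coord_field[OF d] map_points[OF p] by (simp add: tensor11_def)
  then have "along_near M N i p (\<lambda>q. \<Sum>b\<in>Basis. W q (\<lambda>r. snd d r \<bullet> b) *\<^sub>T \<phi> (i q) (coord_vec N d (i q) b))"
    by (intro along_sum p along_scale along_component[OF W d] along_field[OF p])
  then show ?thesis by (rule along_cong[OF _ along_tensor_expand[OF \<phi> W d]])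
qed

end

section \<open>Invariant submanifolds of SQ-Sasakian manifolds\<close>

lemma linear_functional_representation:
  fixes f :: "'e::euclidean_space \<Rightarrow> real"
  assumes "linear f"
  shows "f x = (\<Sum>b\<in>Basis. f b *\<^sub>R b) \<bullet> x"
proof -
  have "f x = f (\<Sum>b\<in>Basis. (x \<bullet> b) *\<^sub>R b)" by (simp add: euclidean_representation)
  also have "\<dots> = (\<Sum>b\<in>Basis. (x \<bullet> b) * f b)"
    by (simp add: linear_sum[OF assms] linear_scale[OF assms])
  also have "\<dots> = (\<Sum>b\<in>Basis. f b *\<^sub>R b) \<bullet> x"
    by (simp only: inner_sum_left inner_scaleR_left inner_commute[of x] mult.commute)
  finally show ?thesis .
qed

locale sq_immersion =
  fixes N :: "('a, 'e::euclidean_space) manifold" and M :: "('b, 'f::euclidean_space) manifold"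
    and i :: "'b \<Rightarrow> 'a"
    and \<phi> :: "'a \<Rightarrow> 'a tvec \<Rightarrow> 'a tvec" and \<xi> :: "'a \<Rightarrow> 'a tvec"
    and \<eta> :: "'a \<Rightarrow> 'a tvec \<Rightarrow> real" and g :: "'a \<Rightarrow> 'a tvec \<Rightarrow> 'a tvec \<Rightarrow> real"
    and \<beta> :: "'a \<Rightarrow> real" and D :: "'a conn"
  assumes sq: "sq_sasakian N \<phi> \<xi> \<eta> g D \<beta>"
    and inv: "invariant_submanifold M N i \<phi> \<xi>"
begin

lemma acm: "almost_contact_metric N \<phi> \<xi> \<eta> g"
  using sq by (simp add: sq_sasakian_def)

lemma levi_civita: "levi_civita N g D"
  using sq by (simp add: sq_sasakian_def)

lemma tensor: "tensor11 N \<phi>" and metric: "riemannian_metric N g" and form: "one_form N \<eta>"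
  using acm by (simp_all add: almost_contact_metric_def)

end

sublocale sq_immersion \<subseteq> immersed_mfd M N i
proof unfold_locales
  show "smooth_manifold N" using acm by (simp add: almost_contact_metric_def)
  show "smooth_manifold M" "immersion M N i" using inv by (simp_all add: invariant_submanifold_def)
  then show "smooth_map M N i" by (simp add: immersion_def)
qed

sublocale sq_immersion \<subseteq> pullback_mfd M N i D
  by unfold_locales (use levi_civita in \<open>simp add: levi_civita_def\<close>)

context sq_immersion
begin

section \<open>Pointwise identities of the contact metric structure\<close>

lemma xi_field: "x \<in> points N \<Longrightarrow> field_near N x \<xi>"
  using acm by (simp add: almost_contact_metric_def)

lemma phi_mem: "v \<in> tangent_space N x \<Longrightarrow> \<phi> x v \<in> tangent_space N x"
  using tensor N.tangent_points[of v x] by (simp add: tensor11_def)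

lemma phi_lin: "x \<in> points N \<Longrightarrow> lin_map (tangent_space N x) (\<phi> x)"
  using tensor by (simp add: tensor11_def)

lemma phi_add: "v \<in> tangent_space N x \<Longrightarrow> w \<in> tangent_space N x \<Longrightarrow> \<phi> x (v + w) = \<phi> x v + \<phi> x w"
  using lin_map_add[OF phi_lin[OF N.tangent_points]] .

lemma phi_scale: "v \<in> tangent_space N x \<Longrightarrow> \<phi> x (r *\<^sub>T v) = r *\<^sub>T \<phi> x v"
  using lin_map_scale[OF phi_lin[OF N.tangent_points]] .

lemma xi_mem: "x \<in> points N \<Longrightarrow> \<xi> x \<in> tangent_space N x"
  using N.field_mem[OF xi_field] .

lemma eta_lin: "x \<in> points N \<Longrightarrow> lin_form (tangent_space N x) (\<eta> x)"
  using form by (simp add: one_form_def)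

lemma eta_add: "v \<in> tangent_space N x \<Longrightarrow> w \<in> tangent_space N x \<Longrightarrow> \<eta> x (v + w) = \<eta> x v + \<eta> x w"
  using lin_form_add[OF eta_lin[OF N.tangent_points]] .

lemma eta_scale: "v \<in> tangent_space N x \<Longrightarrow> \<eta> x (r *\<^sub>T v) = r * \<eta> x v"
  using lin_form_scale[OF eta_lin[OF N.tangent_points]] .

lemma phi_xi: "x \<in> points N \<Longrightarrow> \<phi> x (\<xi> x) = 0"
  and eta_xi: "x \<in> points N \<Longrightarrow> \<eta> x (\<xi> x) = 1"
  using acm by (simp_all add: almost_contact_metric_def)

lemma phi_phi: "v \<in> tangent_space N x \<Longrightarrow> \<phi> x (\<phi> x v) = - v + \<eta> x v *\<^sub>T \<xi> x"
  and g_xi: "v \<in> tangent_space N x \<Longrightarrow> g x v (\<xi> x) = \<eta> x v"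
  and eta_phi: "v \<in> tangent_space N x \<Longrightarrow> \<eta> x (\<phi> x v) = 0"
  using acm N.tangent_points[of v x] by (simp_all add: almost_contact_metric_def)

lemma g_lin: "v \<in> tangent_space N x \<Longrightarrow> lin_form (tangent_space N x) (g x v)"
  using metric N.tangent_points[of v x] by (simp add: riemannian_metric_def)

lemma g_sym: "v \<in> tangent_space N x \<Longrightarrow> w \<in> tangent_space N x \<Longrightarrow> g x v w = g x w v"
  using metric N.tangent_points[of v x] by (simp add: riemannian_metric_def)

lemma g_pos: "v \<in> tangent_space N x \<Longrightarrow> v \<noteq> 0 \<Longrightarrow> g x v v > 0"
  using metric N.tangent_points[of v x] by (simp add: riemannian_metric_def)

lemma g_xi_left: "v \<in> tangent_space N x \<Longrightarrow> g x (\<xi> x) v = \<eta> x v"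
  using g_sym[OF xi_mem[OF N.tangent_points], of v x v] g_xi by simp

lemma
  assumes "v \<in> tangent_space N x" "w \<in> tangent_space N x"
  shows g_add_left: "u \<in> tangent_space N x \<Longrightarrow> g x (v + w) u = g x v u + g x w u"
    and g_scale_left: "u \<in> tangent_space N x \<Longrightarrow> g x (r *\<^sub>T v) u = r * g x v u"
    and g_diff_left: "u \<in> tangent_space N x \<Longrightarrow> g x (v - w) u = g x v u - g x w u"
proof -
  have *: "g x (v + w) u = g x v u + g x w u"
    if u: "u \<in> tangent_space N x" "v \<in> tangent_space N x" "w \<in> tangent_space N x" for u v w
    using g_sym[OF N.tangent_add_mem[OF u(2,3)] u(1)] g_sym[OF u(2,1)] g_sym[OF u(3,1)]
      lin_form_add[OF g_lin[OF u(1)] u(2,3)] by simp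
  show "g x (v + w) u = g x v u + g x w u" if "u \<in> tangent_space N x" using *[OF that assms] .
  show "g x (r *\<^sub>T v) u = r * g x v u" if u: "u \<in> tangent_space N x"
    using g_sym[OF N.tangent_scale_mem[OF assms(1)] u] g_sym[OF assms(1) u]
      lin_form_scale[OF g_lin[OF u] assms(1)] by simp
  show "g x (v - w) u = g x v u - g x w u" if u: "u \<in> tangent_space N x"
    using *[OF u N.tangent_diff_mem[OF assms] assms(2)] by simp
qed

lemma D_xi: "v \<in> tangent_space N x \<Longrightarrow> D x v \<xi> = - (\<beta> x *\<^sub>T \<phi> x v)"
  using sq N.tangent_points[of v x] by (simp add: sq_sasakian_def)

lemma D_xi_xi: "x \<in> points N \<Longrightarrow> D x (\<xi> x) \<xi> = 0"
  by (simp add: D_xi[OF xi_mem] phi_xi)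

lemma beta_smooth: "x \<in> points N \<Longrightarrow> smooth_near N x \<beta>"
  and xi_beta: "x \<in> points N \<Longrightarrow> \<xi> x \<beta> = 0"
  using sq by (simp_all add: sq_sasakian_def)

lemma D_torsion:
  "field_near N x X \<Longrightarrow> field_near N x Y \<Longrightarrow> D x (X x) Y - D x (Y x) X = bracket N X Y x"
  using levi_civita N.self.along_points[of x X] by (simp add: levi_civita_def)

lemma D_metric:
  "field_near N x X \<Longrightarrow> field_near N x Y \<Longrightarrow> v \<in> tangent_space N x \<Longrightarrow>
    v (\<lambda>q. g q (X q) (Y q)) = g x (D x v X) (Y x) + g x (X x) (D x v Y)"
  using levi_civita N.self.along_points[of x X] by (simp add: levi_civita_def)

lemma phi_field: "field_near N x Y \<Longrightarrow> field_near N x (\<lambda>q. \<phi> q (Y q))"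
  using tensor N.self.along_points[of x Y] by (simp add: tensor11_def)

text \<open>Normality with \<open>X = \<xi>\<close> gives \<open>\<phi> ((D\<^sub>\<xi> \<phi>) Y) \<in> span \<xi>\<close>; metric compatibility removes the
  remaining \<open>\<xi>\<close>-component.\<close>

lemma phi_parallel_xi:
  assumes Y: "field_near N x Y"
  shows "D x (\<xi> x) (\<lambda>q. \<phi> q (Y q)) = \<phi> x (D x (\<xi> x) Y)"
proof -
  have x: "x \<in> points N" using N.self.along_points[OF Y] .
  let ?pY = "\<lambda>q. \<phi> q (Y q)" and ?pxi = "\<lambda>q. \<phi> q (\<xi> q)"
  have pY: "field_near N x ?pY" and pxi: "field_near N x ?pxi" and xif: "field_near N x \<xi>"
    using phi_field Y xi_field x by auto
  have xi: "\<xi> x \<in> tangent_space N x" and Yx: "Y x \<in> tangent_space N x" and pYx: "\<phi> x (Y x) \<in> tangent_space N x"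
    using xi_mem[OF x] N.field_mem[OF Y] N.field_mem[OF pY] by auto
  define A where "A = D x (\<xi> x) ?pY"
  define B where "B = D x (\<xi> x) Y"
  have A: "A \<in> tangent_space N x" and B: "B \<in> tangent_space N x"
    unfolding A_def B_def by (intro N.conn_mem pY Y xi)+
  note mem = A B xi Yx pYx phi_mem N.tangent_add_mem N.tangent_diff_mem N.tangent_scale_mem N.tangent_minus_mem
  \<comment> \<open>The brackets with \<phi>\<xi> in the normality condition vanish, because
    \<phi>\<xi> is the zero field near \<open>x\<close> and \<open>D\<close> has no torsion.\<close>
  have zero: "\<forall>\<^sub>F q in near N x. ?pxi q = 0"
    using near_points[of N x] by eventually_elim (rule phi_xi)
  have "bracket N ?pxi Z x = 0" if Z: "field_near N x Z" for Z
  proof -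
    have "D x (Z x) ?pxi = D x (Z x) (\<lambda>q. 0)"
      by (rule N.conn_cong[OF pxi zero N.field_mem[OF Z]])
    then show ?thesis
      using D_torsion[OF pxi Z] N.conn_zero[OF N.field_mem[OF Z]] N.conn_vec_zero[OF Z] phi_xi[OF x] by simp
  qed
  then have br0: "bracket N ?pxi ?pY x = 0" "bracket N ?pxi Y x = 0" using pY Y by auto
  have br1: "bracket N \<xi> Y x = B + \<beta> x *\<^sub>T \<phi> x (Y x)"
    using D_torsion[OF xif Y] by (simp add: B_def D_xi[OF Yx])
  have br2: "bracket N \<xi> ?pY x = A + \<beta> x *\<^sub>T \<phi> x (\<phi> x (Y x))"
    using D_torsion[OF xif pY] by (simp add: A_def D_xi[OF pYx])
  have phi0: "\<phi> x 0 = 0"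
    using phi_scale[OF xi, of 0] by simp
  \<comment> \<open>The value of the d\<eta>-term can stay unspecified: it multiplies \<xi>, which
    the next application of \<phi> annihilates.\<close>
  obtain r where "\<phi> x (\<phi> x (bracket N \<xi> Y x)) - \<phi> x (bracket N \<xi> ?pY x) + r *\<^sub>T \<xi> x = 0"
  proof -
    have "normal_structure N \<phi> \<xi> \<eta>" using sq by (simp add: sq_sasakian_def)
    then have "bracket N ?pxi ?pY x + \<phi> x (\<phi> x (bracket N \<xi> Y x)) - \<phi> x (bracket N ?pxi Y x)
        - \<phi> x (bracket N \<xi> ?pY x) + (2 * ext_deriv1 N \<eta> \<xi> Y x) *\<^sub>T \<xi> x = 0"
      using x xif Y unfolding normal_structure_def by blast
    then show thesis by (intro that) (simp add: br0 phi0)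
  qed
  \<comment> \<open>The derivatives of \<xi> contribute \<beta> times the third power of \<phi> on Y
    in both terms, and these cancel.\<close>
  then have 1: "\<phi> x (\<phi> x B) - \<phi> x A + r *\<^sub>T \<xi> x = 0"
    by (simp add: br1 br2 phi_add phi_scale mem fun_eq_iff)
  \<comment> \<open>Differentiating g(\<phi>Y, \<xi>) = 0 along \<xi> and using that the derivative
    of \<xi> along itself is zero shows that A has no \<xi>-component.\<close>
  have eta_A: "\<eta> x A = 0"
  proof -
    have "\<xi> x (\<lambda>q. g q (?pY q) (\<xi> q)) = \<xi> x (\<lambda>q. 0)"
    proof (rule N.tangent_cong[OF xi])
      show "\<forall>\<^sub>F q in near N x. g q (?pY q) (\<xi> q) = 0"
        using N.self.along_near_near[OF Y]
        by eventually_elim (simp add: g_xi eta_phi phi_mem N.field_mem)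
    qed
    moreover have "g x (\<phi> x (Y x)) 0 = 0"
      using lin_form_scale[OF g_lin[OF pYx] xi, of 0] by simp
    ultimately show ?thesis
      using D_metric[OF pY xif xi] by (simp add: A_def[symmetric] D_xi_xi[OF x] N.tangent_const[OF xi] g_xi[OF A])
  qed
  have "\<phi> x A = \<phi> x (\<phi> x B) + r *\<^sub>T \<xi> x" using 1 by (simp add: fun_eq_iff algebra_simps)
  \<comment> \<open>On vectors with \<eta> = 0 the square of \<phi> is minus the identity. This
    applies to A and to \<phi>B, so the equation reduces to A = \<phi>B.\<close>
  then have "\<phi> x (\<phi> x A) = \<phi> x (\<phi> x (\<phi> x B))"
    by (simp add: phi_add phi_scale mem phi_xi[OF x])
  then have "A = \<phi> x B"
    by (simp add: phi_phi[OF A] phi_phi[OF phi_mem[OF B]] eta_A eta_phi[OF B])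
  then show ?thesis by (simp add: A_def B_def)
qed

section \<open>Tangential and normal projection\<close>

abbreviation tang :: "'b \<Rightarrow> 'a tvec \<Rightarrow> 'b tvec" where "tang \<equiv> tan_part M N i g"
abbreviation nor :: "'b \<Rightarrow> 'a tvec \<Rightarrow> 'a tvec" where "nor \<equiv> nor_part M N i g"
abbreviation P :: "'b \<Rightarrow> 'b tvec \<Rightarrow> 'a tvec" where "P \<equiv> push N i"
abbreviation h :: "'b \<Rightarrow> 'b tvec \<Rightarrow> ('b \<Rightarrow> 'b tvec) \<Rightarrow> 'a tvec" where "h \<equiv> sff M N i g D"
abbreviation nab :: "'b \<Rightarrow> 'b tvec \<Rightarrow> ('b \<Rightarrow> 'b tvec) \<Rightarrow> 'b tvec" where "nab \<equiv> ind_conn M N i g D"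
abbreviation Ds :: "'a conn" where "Ds \<equiv> semisymmetric_conn \<xi> \<eta> g D"
abbreviation nabs :: "'b \<Rightarrow> 'b tvec \<Rightarrow> ('b \<Rightarrow> 'b tvec) \<Rightarrow> 'b tvec" where "nabs \<equiv> ind_conn M N i g Ds"

lemma orthogonal_unique:
  assumes "v \<in> tangent_space M p" "v' \<in> tangent_space M p" "w \<in> tangent_space N (i p)"
    and "\<And>u. u \<in> tangent_space M p \<Longrightarrow> g (i p) (w - P p v) (P p u) = 0"
    and "\<And>u. u \<in> tangent_space M p \<Longrightarrow> g (i p) (w - P p v') (P p u) = 0"
  shows "v = v'"
proof -
  let ?d = "v - v'"
  have d: "?d \<in> tangent_space M p" using M.tangent_diff_mem assms by blast
  note m = push_mem[OF assms(1)] push_mem[OF assms(2)] push_mem[OF d]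
  have "g (i p) (P p ?d) (P p ?d) = g (i p) (w - P p v') (P p ?d) - g (i p) (w - P p v) (P p ?d)"
    using g_diff_left[OF m(1,2,3)]
    by (simp add: g_diff_left[OF assms(3) m(1) m(3)] g_diff_left[OF assms(3) m(2) m(3)] flip: push_linear(4))
  then have "g (i p) (P p ?d) (P p ?d) = 0" using assms(4,5)[OF d] by simp
  then have "P p ?d = 0" using g_pos[OF m(3)] by force
  then have "P p v = P p v'" by (simp add: push_linear(4))
  then show ?thesis using push_inj assms(1,2) by blast
qed

text \<open>\<open>L\<close> is the Gram map of the induced metric in a chart. Positivity of
  \<open>g\<close> and injectivity of the differential make it injective, hence surjective in finite
  dimension, so the normal equations for the tangential part can be solved.\<close>

lemma orthogonal_exists:
  assumes p: "p \<in> points M" and w: "w \<in> tangent_space N (i p)"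
  shows "\<exists>v\<in>tangent_space M p. \<forall>u\<in>tangent_space M p. g (i p) (w - P p v) (P p u) = 0"
proof -
  obtain c where c: "c \<in> charts_at M p" using M.chart_exists[OF p] by (elim exE)
  let ?E = "\<lambda>e. P p (coord_vec M c p e)"
  have E: "?E e \<in> tangent_space N (i p)" for e by (rule push_mem[OF M.coord_vec_mem[OF c]])
  have E_lin: "?E (e + e') = ?E e + ?E e'" "?E (r *\<^sub>R e) = r *\<^sub>T ?E e" for e e' r
    by (simp_all add: M.coord_vec_linear[OF c] push_linear)
  have lin: "linear (\<lambda>e. g (i p) u (?E e))" if "u \<in> tangent_space N (i p)" for u
    using lin_form_add[OF g_lin[OF that] E E] lin_form_scale[OF g_lin[OF that] E]
    by (intro linearI) (simp_all only: E_lin real_scaleR_def)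
  define L where "L e = (\<Sum>b\<in>Basis. g (i p) (?E e) (?E b) *\<^sub>R b)" for e
  have L: "L e \<bullet> e' = g (i p) (?E e) (?E e')" for e e'
    unfolding L_def by (rule linear_functional_representation[OF lin[OF E], symmetric])
  have "linear L"
    unfolding L_def
    by (intro linearI)
      (simp_all only: E_lin g_add_left[OF E E E] g_scale_left[OF E E E] scaleR_add_left sum.distrib
        scaleR_sum_right scaleR_scaleR)
  moreover have "inj L"
  proof (subst linear_inj_iff_eq_0[OF \<open>linear L\<close>], intro allI impI)
    fix e assume "L e = 0"
    then have "g (i p) (?E e) (?E e) = 0" using L[of e e] by simp
    then have "?E e = 0" using g_pos[OF E, of e] by force
    then have "coord_vec M c p e = 0"
      using push_inj[OF M.coord_vec_mem[OF c] M.tangent_zero_mem[OF p]] by (simp add: push_linear)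
    then have "e \<bullet> b = 0" for b using M.coord_vec_coord[OF c, of e b] by simp
    then show "e = 0" by (metis inner_eq_zero_iff)
  qed
  ultimately have "surj L" by (intro linear_injective_imp_surjective refl)
  then obtain e where e: "L e = (\<Sum>b\<in>Basis. g (i p) w (?E b) *\<^sub>R b)" by (metis surjD)
  have "g (i p) (w - ?E e) (?E e') = 0" for e'
    using linear_functional_representation[OF lin[OF w], of e'] L[of e e'] e g_diff_left[OF w E E, of e e'] by simp
  then show ?thesis
    using M.coord_vec_mem[OF c] unfolding M.tangent_space_chart[OF c] by blast
qed

lemma tan_eqI:
  assumes "v \<in> tangent_space M p" "w \<in> tangent_space N (i p)"
    and "\<And>u. u \<in> tangent_space M p \<Longrightarrow> g (i p) (w - P p v) (P p u) = 0"
  shows "tang p w = v"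
  unfolding tan_part_def
proof (rule the_equality)
  show "v \<in> tangent_space M p \<and> (\<forall>v'\<in>tangent_space M p. g (i p) (w - P p v) (P p v') = 0)"
    using assms by blast
  show "v' = v" if "v' \<in> tangent_space M p \<and> (\<forall>u\<in>tangent_space M p. g (i p) (w - P p v') (P p u) = 0)" for v'
    using orthogonal_unique[of v' p v w] assms that by blast
qed

lemma tan_props:
  assumes p: "p \<in> points M" and w: "w \<in> tangent_space N (i p)"
  shows tan_mem: "tang p w \<in> tangent_space M p"
    and tan_orthogonal: "u \<in> tangent_space M p \<Longrightarrow> g (i p) (w - P p (tang p w)) (P p u) = 0"
proof -
  obtain v where v: "v \<in> tangent_space M p" "\<forall>u\<in>tangent_space M p. g (i p) (w - P p v) (P p u) = 0"
    using orthogonal_exists[OF p w] by (elim bexE)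
  have "tang p w = v" by (rule tan_eqI[OF v(1) w]) (use v(2) in simp)
  then show "tang p w \<in> tangent_space M p"
    "u \<in> tangent_space M p \<Longrightarrow> g (i p) (w - P p (tang p w)) (P p u) = 0" using v by auto
qed

lemma tan_push:
  assumes v: "v \<in> tangent_space M p"
  shows "tang p (P p v) = v"
proof (rule tan_eqI[OF v push_mem[OF v]])
  fix u assume "u \<in> tangent_space M p"
  then show "g (i p) (P p v - P p v) (P p u) = 0"
    using g_diff_left[OF push_mem[OF v] push_mem[OF v] push_mem, of u] by simp
qed

lemma tan_add:
  assumes p: "p \<in> points M" and w: "w \<in> tangent_space N (i p)" "w' \<in> tangent_space N (i p)"
  shows "tang p (w + w') = tang p w + tang p w'"
proof (rule tan_eqI)
  note t = tan_mem[OF p w(1)] tan_mem[OF p w(2)]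
  show "tang p w + tang p w' \<in> tangent_space M p" "w + w' \<in> tangent_space N (i p)"
    by (intro M.tangent_add_mem N.tangent_add_mem t w)+
  show "g (i p) (w + w' - P p (tang p w + tang p w')) (P p u) = 0" if u: "u \<in> tangent_space M p" for u
  proof -
    have eq: "w + w' - P p (tang p w + tang p w') = (w - P p (tang p w)) + (w' - P p (tang p w'))"
      by (simp only: push_linear add_diff_add)
    show ?thesis
      unfolding eq g_add_left[OF N.tangent_diff_mem[OF w(1) push_mem[OF t(1)]]
          N.tangent_diff_mem[OF w(2) push_mem[OF t(2)]] push_mem[OF u]]
      using tan_orthogonal[OF p w(1) u] tan_orthogonal[OF p w(2) u] by simp
  qed
qed

lemma tan_scale:
  assumes p: "p \<in> points M" and w: "w \<in> tangent_space N (i p)"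
  shows "tang p (r *\<^sub>T w) = r *\<^sub>T tang p w"
proof (rule tan_eqI)
  note t = tan_mem[OF p w]
  show "r *\<^sub>T tang p w \<in> tangent_space M p" "r *\<^sub>T w \<in> tangent_space N (i p)"
    by (intro M.tangent_scale_mem N.tangent_scale_mem t w)+
  show "g (i p) (r *\<^sub>T w - P p (r *\<^sub>T tang p w)) (P p u) = 0" if u: "u \<in> tangent_space M p" for u
  proof -
    have eq: "r *\<^sub>T w - P p (r *\<^sub>T tang p w) = r *\<^sub>T (w - P p (tang p w))"
      unfolding push_linear(2) by (simp add: fun_eq_iff right_diff_distrib)
    show ?thesis
      unfolding eq g_scale_left[OF N.tangent_diff_mem[OF w push_mem[OF t]] N.tangent_diff_mem[OF w push_mem[OF t]] push_mem[OF u]]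
      using tan_orthogonal[OF p w u] by simp
  qed
qed

lemma nor_push: "v \<in> tangent_space M p \<Longrightarrow> nor p (P p v) = 0"
  by (simp add: nor_part_def tan_push)

lemma nor_add:
  "p \<in> points M \<Longrightarrow> w \<in> tangent_space N (i p) \<Longrightarrow> w' \<in> tangent_space N (i p) \<Longrightarrow>
    nor p (w + w') = nor p w + nor p w'"
  by (simp only: nor_part_def tan_add push_linear add_diff_add)

lemma nor_scale:
  "p \<in> points M \<Longrightarrow> w \<in> tangent_space N (i p) \<Longrightarrow> nor p (r *\<^sub>T w) = r *\<^sub>T nor p w"
  by (simp add: nor_part_def tan_scale push_linear fun_eq_iff right_diff_distrib)

section \<open>The structure induced on the submanifold\<close>

definition xiM :: "'b \<Rightarrow> 'b tvec" where "xiM p = tang p (\<xi> (i p))"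
text \<open>By invariance the vector to which \<open>tang\<close> is applied is already tangent, so
  \<open>tang\<close> does nothing but invert the differential; the same holds for
  \<open>xiM\<close>.\<close>

definition phiM :: "'b \<Rightarrow> 'b tvec \<Rightarrow> 'b tvec" where "phiM p v = tang p (\<phi> (i p) (P p v))"
definition etaM :: "'b \<Rightarrow> 'b tvec \<Rightarrow> real" where "etaM p v = \<eta> (i p) (P p v)"

lemma
  assumes p: "p \<in> points M"
  shows xiM_mem: "xiM p \<in> tangent_space M p" and push_xiM: "P p (xiM p) = \<xi> (i p)"
proof -
  obtain v where v: "v \<in> tangent_space M p" "\<xi> (i p) = P p v"
    using inv p unfolding invariant_submanifold_def by blast
  then show "xiM p \<in> tangent_space M p" "P p (xiM p) = \<xi> (i p)"
    by (simp_all add: xiM_def tan_push)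
qed

lemma
  assumes v: "v \<in> tangent_space M p"
  shows phiM_mem: "phiM p v \<in> tangent_space M p" and push_phiM: "P p (phiM p v) = \<phi> (i p) (P p v)"
proof -
  obtain w where w: "w \<in> tangent_space M p" "\<phi> (i p) (P p v) = P p w"
    using inv M.tangent_points[OF v] v unfolding invariant_submanifold_def by blast
  then show "phiM p v \<in> tangent_space M p" "P p (phiM p v) = \<phi> (i p) (P p v)"
    by (simp_all add: phiM_def tan_push)
qed

lemma etaM_xiM: "p \<in> points M \<Longrightarrow> etaM p (xiM p) = 1"
  by (simp add: etaM_def push_xiM eta_xi map_points)

lemma phiM_phiM:
  assumes v: "v \<in> tangent_space M p"
  shows "phiM p (phiM p v) = - v + etaM p v *\<^sub>T xiM p"
proof -
  have p: "p \<in> points M" using M.tangent_points[OF v] .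
  show ?thesis
  proof (rule push_inj)
    show "P p (phiM p (phiM p v)) = P p (- v + etaM p v *\<^sub>T xiM p)"
      by (simp only: push_phiM[OF phiM_mem[OF v]] push_phiM[OF v] phi_phi[OF push_mem[OF v]]
          push_linear push_xiM[OF p] etaM_def)
  qed (intro phiM_mem v M.tangent_add_mem M.tangent_minus_mem M.tangent_scale_mem xiM_mem p)+
qed

lemma xiM_field:
  assumes p: "p \<in> points M"
  shows "field_near M p xiM"
proof (rule field_of_push[OF along_field[OF p xi_field[OF map_points[OF p]]]])
  show "\<forall>\<^sub>F q in near M p. xiM q \<in> tangent_space M q \<and> P q (xiM q) = \<xi> (i q)"
    using near_points[of M p] by eventually_elim (simp add: xiM_mem push_xiM)
qed

lemma phiM_field:
  assumes X: "field_near M p X"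
  shows "field_near M p (\<lambda>q. phiM q (X q))"
proof (rule field_of_push[OF along_tensor[OF tensor along_push[OF X]]])
  show "\<forall>\<^sub>F q in near M p. phiM q (X q) \<in> tangent_space M q \<and> P q (phiM q (X q)) = \<phi> (i q) (P q (X q))"
    using M.self.along_near_near[OF X] by eventually_elim (simp add: phiM_mem push_phiM M.field_mem)
qed

lemma etaM_smooth: "field_near M p X \<Longrightarrow> smooth_near M p (\<lambda>q. etaM q (X q))"
  unfolding etaM_def by (rule along_one_form[OF form along_push])

section \<open>The semisymmetric connection along the submanifold\<close>

lemma pullback_Ds:
  assumes v: "v \<in> tangent_space M p" and W: "W p \<in> tangent_space N (i p)"
  shows "pullback_conn N i Ds p v W =
    pb p v W + \<eta> (i p) (W p) *\<^sub>T P p v - g (i p) (P p v) (W p) *\<^sub>T \<xi> (i p)"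
proof -
  have p: "p \<in> points M" using M.tangent_points[OF v] .
  let ?c = "base_chart p"
  let ?x = "\<lambda>b. W p (\<lambda>r. snd ?c r \<bullet> b)" and ?e = "\<lambda>b. coord_vec N ?c (i p) b"
  \<comment> \<open>The pullback applies the semisymmetric connection to coordinate fields, weighted
    by the components of \<open>W\<close>. Its correction terms are linear in the value of the
    differentiated field, so the weighted sums reassemble to their values on
    \<open>W p\<close>.\<close>
  have expand: "f (W p) = (\<Sum>b\<in>Basis. ?x b * f (?e b))" if f: "lin_form (tangent_space N (i p)) f" for f
  proof -
    have "f (W p) = f (\<Sum>b\<in>Basis. ?x b *\<^sub>T ?e b)"
      by (rule arg_cong[OF N.tangent_expand(2)[OF base_chart[OF p] W]])
    also have "\<dots> = (\<Sum>b\<in>Basis. ?x b * f (?e b))"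
      by (rule N.lin_form_sum[OF f map_points[OF p] N.coord_vec_mem[OF base_chart[OF p]]])
    finally show ?thesis .
  qed
  show ?thesis
    unfolding pullback_conn_eq expand[OF eta_lin[OF map_points[OF p]]] expand[OF g_lin[OF push_mem[OF v]]]
      semisymmetric_conn_def
    by (simp add: fun_eq_iff sum_fun_apply sum.distrib sum_subtractf sum_distrib_right sum_distrib_left algebra_simps)
qed

lemma pullback_Ds_mem:
  assumes v: "v \<in> tangent_space M p" and W: "W p \<in> tangent_space N (i p)"
  shows "pullback_conn N i Ds p v W \<in> tangent_space N (i p)"
  unfolding pullback_Ds[where W = W, OF assms]
  by (intro N.tangent_diff_mem N.tangent_add_mem N.tangent_scale_mem pull_mem push_mem v
      xi_mem map_points M.tangent_points[OF v])

text \<open>It is used for fields of values of the second fundamental form that vanish near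
  \<open>p\<close>; vanishing at the single point \<open>p\<close> would not determine the
  derivative.\<close>

lemma normal_conn_zero:
  assumes v: "v \<in> tangent_space M p" and S: "\<forall>\<^sub>F q in near M p. S q = 0"
  shows "normal_conn M N i g Ds p v S = 0"
proof -
  have p: "p \<in> points M" using M.tangent_points[OF v] .
  note m = N.tangent_zero_mem[OF map_points[OF p]]
  have "pullback_conn N i Ds p v S = pullback_conn N i Ds p v (\<lambda>q. 0)"
    by (rule pullback_conn_cong[OF v S])
  also have "\<dots> = P p 0"
    using pullback_Ds[of v p "\<lambda>q. 0", OF v m] lin_form_scale[OF eta_lin[OF map_points[OF p]] m, of 0]
      lin_form_scale[OF g_lin[OF push_mem[OF v]] m, of 0]
    by (simp add: pull_zero[OF v] push_linear)
  finally show ?thesis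
    by (simp only: normal_conn_def nor_push[OF M.tangent_zero_mem[OF p]])
qed

lemma nabs_eq:
  assumes v: "v \<in> tangent_space M p" and Y: "Y p \<in> tangent_space M p"
  shows "nabs p v Y = nab p v Y + etaM p (Y p) *\<^sub>T v - g (i p) (P p v) (P p (Y p)) *\<^sub>T xiM p"
proof -
  have p: "p \<in> points M" using M.tangent_points[OF v] .
  let ?a = "\<eta> (i p) (P p (Y p))" and ?b = "- g (i p) (P p v) (P p (Y p))"
  let ?W = "\<lambda>q. P q (Y q)"
  have 1: "?a *\<^sub>T v + ?b *\<^sub>T xiM p \<in> tangent_space M p"
    by (intro M.tangent_add_mem M.tangent_scale_mem v xiM_mem p)
  have "pullback_conn N i Ds p v ?W = pb p v ?W + P p (?a *\<^sub>T v + ?b *\<^sub>T xiM p)"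
    unfolding pullback_Ds[of v p ?W, OF v push_mem[OF Y]] push_linear push_xiM[OF p]
    by (simp add: fun_eq_iff)
  then have "nabs p v Y = nab p v Y + (?a *\<^sub>T v + ?b *\<^sub>T xiM p)"
    by (simp only: ind_conn_def tan_add[OF p pull_mem[OF v] push_mem[OF 1]] tan_push[OF 1])
  then show ?thesis by (simp add: etaM_def fun_eq_iff)
qed

lemma nab_mem: "v \<in> tangent_space M p \<Longrightarrow> nab p v Y \<in> tangent_space M p"
  unfolding ind_conn_def by (rule tan_mem[OF M.tangent_points pull_mem])

text \<open>Only the value of the differentiated field at \<open>p\<close> has to be tangent. In
  this form the lemma applies to iterated covariant derivatives before their smoothness is
  known.\<close>

lemma nabs_mem:
  assumes v: "v \<in> tangent_space M p" and Y: "Y p \<in> tangent_space M p"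
  shows "nabs p v Y \<in> tangent_space M p"
  unfolding ind_conn_def by (rule tan_mem[OF M.tangent_points[OF v] pullback_Ds_mem[of v p "\<lambda>q. P q (Y q)", OF v push_mem[OF Y]]])

lemma nabs_cong:
  assumes v: "v \<in> tangent_space M p" and eq: "\<forall>\<^sub>F q in near M p. Y q = Y' q"
  shows "nabs p v Y = nabs p v Y'"
  unfolding ind_conn_def
  by (rule arg_cong[OF pullback_conn_cong[OF v]]) (use eq in \<open>eventually_elim, simp\<close>)

text \<open>The two correction terms are multiples of the direction \<open>v\<close> and of \<xi>.
  Both are tangent to \<open>M\<close>, so the normal part is unchanged.\<close>

lemma sff_Ds:
  assumes v: "v \<in> tangent_space M p" and Y: "Y p \<in> tangent_space M p"
  shows "sff M N i g Ds p v Y = h p v Y"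
proof -
  have p: "p \<in> points M" using M.tangent_points[OF v] .
  let ?a = "\<eta> (i p) (P p (Y p))" and ?b = "- g (i p) (P p v) (P p (Y p))"
  let ?W = "\<lambda>q. P q (Y q)"
  have 1: "?a *\<^sub>T v + ?b *\<^sub>T xiM p \<in> tangent_space M p"
    by (intro M.tangent_add_mem M.tangent_scale_mem v xiM_mem p)
  have "pullback_conn N i Ds p v ?W = pb p v ?W + P p (?a *\<^sub>T v + ?b *\<^sub>T xiM p)"
    unfolding pullback_Ds[of v p ?W, OF v push_mem[OF Y]] push_linear push_xiM[OF p]
    by (simp add: fun_eq_iff)
  then show ?thesis
    by (simp only: sff_def nor_add[OF p pull_mem[OF v] push_mem[OF 1]] nor_push[OF 1] add_0_right)
qed

section \<open>The second fundamental form and the direction \<xi>\<close>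

lemma sff_add:
  assumes "v \<in> tangent_space M p" "w \<in> tangent_space M p"
  shows "h p (v + w) Y = h p v Y + h p w Y"
  using M.tangent_points[OF assms(1)] assms
  by (simp only: sff_def pull_vec_add nor_add pull_mem)

lemma sff_scale:
  assumes "v \<in> tangent_space M p"
  shows "h p (r *\<^sub>T v) Y = r *\<^sub>T h p v Y"
  using M.tangent_points[OF assms(1)] assms
  by (simp only: sff_def pull_vec_scale nor_scale pull_mem)

lemma sff_minus:
  assumes "v \<in> tangent_space M p"
  shows "h p (- v) Y = - h p v Y"
proof -
  have "- v = (-1) *\<^sub>T v" "- h p v Y = (-1) *\<^sub>T h p v Y" by (simp_all add: fun_eq_iff)
  then show ?thesis using sff_scale[OF assms] by simp
qed

lemma pull_eq_add_bracket:
  assumes X: "field_near M p X" and Y: "field_near M p Y"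
  shows "pb p (X p) (\<lambda>q. P q (Y q)) = pb p (Y p) (\<lambda>q. P q (X q)) + P p (bracket M X Y p)"
proof -
  have "pb p (X p) (\<lambda>q. P q (Y q)) - pb p (Y p) (\<lambda>q. P q (X q)) = P p (bracket M X Y p)"
    by (rule pull_torsion[OF _ X Y]) (rule D_torsion)
  then show ?thesis by (simp only: diff_eq_eq add.commute)
qed

lemma sff_symmetric:
  assumes X: "field_near M p X" and Y: "field_near M p Y"
  shows "h p (X p) Y = h p (Y p) X"
proof -
  have p: "p \<in> points M" using M.self.along_points[OF X] .
  show ?thesis
    unfolding sff_def pull_eq_add_bracket[OF X Y]
    by (simp only: nor_add[OF p pull_mem[OF M.field_mem[OF Y]] push_mem[OF M.bracket_mem[OF X Y]]]
        nor_push[OF M.bracket_mem[OF X Y]] add_0_right)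
qed

lemma pull_xiM:
  assumes v: "v \<in> tangent_space M p"
  shows "pb p v (\<lambda>q. P q (xiM q)) = P p (- (\<beta> (i p) *\<^sub>T phiM p v))"
proof -
  have p: "p \<in> points M" using M.tangent_points[OF v] .
  have "pb p v (\<lambda>q. P q (xiM q)) = pb p v (\<lambda>q. \<xi> (i q))"
    by (rule pullback_conn_cong[OF v]) (use near_points[of M p] in \<open>eventually_elim, simp add: push_xiM\<close>)
  also have "\<dots> = D (i p) (P p v) \<xi>" by (rule pull_field[OF v xi_field[OF map_points[OF p]]])
  also have "\<dots> = P p (- (\<beta> (i p) *\<^sub>T phiM p v))"
    by (simp only: D_xi[OF push_mem[OF v]] push_linear push_phiM[OF v])
  finally show ?thesis .
qed

lemma
  assumes v: "v \<in> tangent_space M p"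
  shows sff_xiM: "h p v xiM = 0" and nab_xiM: "nab p v xiM = - (\<beta> (i p) *\<^sub>T phiM p v)"
proof -
  have m: "- (\<beta> (i p) *\<^sub>T phiM p v) \<in> tangent_space M p"
    by (intro M.tangent_minus_mem M.tangent_scale_mem phiM_mem v)
  show "h p v xiM = 0" "nab p v xiM = - (\<beta> (i p) *\<^sub>T phiM p v)"
    by (simp_all only: sff_def ind_conn_def pull_xiM[OF v] nor_push[OF m] tan_push[OF m])
qed

lemma nabs_xiM:
  assumes v: "v \<in> tangent_space M p"
  shows "nabs p v xiM = - (\<beta> (i p) *\<^sub>T phiM p v) + v - etaM p v *\<^sub>T xiM p"
proof -
  have p: "p \<in> points M" using M.tangent_points[OF v] .
  show ?thesis
    by (simp only: nabs_eq[where Y = xiM, OF v xiM_mem[OF p]] nab_xiM[OF v] etaM_xiM[OF p] tscale_one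
        push_xiM[OF p] g_xi[OF push_mem[OF v]] etaM_def[of p v])
qed

lemma sff_xi: "field_near M p Z \<Longrightarrow> h p (xiM p) Z = 0"
  using sff_symmetric[OF xiM_field, of p Z] sff_xiM[OF M.field_mem, of p Z]
    M.self.along_points[of p Z] by simp

lemma sff_Ds_xiM_near:
  assumes Y: "field_near M p Y"
  shows "\<forall>\<^sub>F q in near M p. sff M N i g Ds q (Y q) xiM = 0"
  using M.self.along_near_near[OF Y] near_points[of M p]
  by eventually_elim (simp add: sff_Ds[where Y = xiM] M.field_mem xiM_mem sff_xiM)

lemma nabs_xiM_near:
  assumes X: "field_near M p X"
  shows "\<forall>\<^sub>F q in near M p. nabs q (X q) xiM = - (\<beta> (i q) *\<^sub>T phiM q (X q)) + X q - etaM q (X q) *\<^sub>T xiM q"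
  using M.self.along_near_near[OF X] by eventually_elim (rule nabs_xiM[OF M.field_mem])

lemma beta_smooth_M: "p \<in> points M \<Longrightarrow> smooth_near M p (\<lambda>q. \<beta> (i q))"
  by (rule map_smooth[OF _ beta_smooth[OF map_points]])

text \<open>Smoothness of the derivative of \<xi> is read off its explicit formula; it permits the
  symmetry of the second fundamental form with this derivative as second argument.\<close>

lemma nabs_xiM_field:
  assumes X: "field_near M p X"
  shows "field_near M p (\<lambda>q. - (\<beta> (i q) *\<^sub>T phiM q (X q)) + X q - etaM q (X q) *\<^sub>T xiM q)"
proof -
  have p: "p \<in> points M" using M.self.along_points[OF X] .
  show ?thesis
    by (intro M.self.along_diff M.self.along_add M.self.along_minus M.self.along_scale beta_smooth_M
        phiM_field X etaM_smooth xiM_field p)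
qed

text \<open>Since h(Y, \<xi>) = 0 near \<open>p\<close>, only the term with the derivative of \<xi>
  in the last slot survives. Its \<xi>-component drops out again, and the summand - h(X, Y) stems
  from the semisymmetric correction \<eta>(\<xi>) X.\<close>

lemma cov_deriv_sff_xi:
  assumes X: "field_near M p X" and Y: "field_near M p Y"
  shows "cov_deriv_sff M N i g Ds X Y xiM p = \<beta> (i p) *\<^sub>T h p (phiM p (X p)) Y - h p (X p) Y"
proof -
  have p: "p \<in> points M" using M.self.along_points[OF X] .
  note Xp = M.field_mem[OF X] and Yp = M.field_mem[OF Y]
  define A where "A = (\<lambda>q. nabs q (X q) xiM)"
  have Af: "field_near M p A"
  proof (rule M.self.along_cong[OF nabs_xiM_field[OF X]])
    show "\<forall>\<^sub>F q in near M p. - (\<beta> (i q) *\<^sub>T phiM q (X q)) + X q - etaM q (X q) *\<^sub>T xiM q = A q"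
      unfolding A_def using nabs_xiM_near[OF X] by eventually_elim (rule sym)
  qed
  have "A p = - (\<beta> (i p) *\<^sub>T phiM p (X p)) + X p + - (etaM p (X p) *\<^sub>T xiM p)"
    unfolding A_def nabs_xiM[OF Xp] by (rule diff_conv_add_uminus)
  then have "h p (A p) Y = - (\<beta> (i p) *\<^sub>T h p (phiM p (X p)) Y) + h p (X p) Y + - (etaM p (X p) *\<^sub>T h p (xiM p) Y)"
    by (simp only: sff_add sff_minus sff_scale M.tangent_add_mem M.tangent_minus_mem M.tangent_scale_mem
        phiM_mem xiM_mem p Xp)
  then have hA: "h p (A p) Y = - (\<beta> (i p) *\<^sub>T h p (phiM p (X p)) Y) + h p (X p) Y"
    by (simp add: sff_xi[OF Y])
  have "sff M N i g Ds p (Y p) A = h p (A p) Y"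
    by (rule trans[OF sff_Ds[of "Y p" p A, OF Yp M.field_mem[OF Af]] sff_symmetric[OF Y Af]])
  moreover have "sff M N i g Ds p (nabs p (X p) Y) xiM = 0"
    by (simp only: sff_Ds[where Y = xiM, OF nabs_mem[where Y = Y, OF Xp Yp] xiM_mem[OF p]]
        sff_xiM[OF nabs_mem[where Y = Y, OF Xp Yp]])
  ultimately show ?thesis
    unfolding cov_deriv_sff_def A_def[symmetric] normal_conn_zero[OF Xp sff_Ds_xiM_near[OF Y]]
    by (simp add: hA)
qed

section \<open>Curvature in the direction of \<xi>\<close>

lemma pull_phi:
  assumes W: "along_near M N i p W"
  shows "pb p (xiM p) (\<lambda>q. \<phi> (i q) (W q)) = \<phi> (i p) (pb p (xiM p) W)"
proof -
  have p: "p \<in> points M" using along_points[OF W] .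
  obtain d where d: "d \<in> charts_at N (i p)" using N.chart_exists[OF map_points[OF p]] by (elim exE)
  let ?x = "\<lambda>b q. W q (\<lambda>r. snd d r \<bullet> b)" and ?E = "\<lambda>b r. coord_vec N d r b"
  note xi = xiM_mem[OF p] and E = N.coord_field[OF d] and x = along_component[OF W d]
  have e: "coord_vec N d (i p) b \<in> tangent_space N (i p)" for b by (rule N.coord_vec_mem[OF d])
  have De: "D (i p) (\<xi> (i p)) (?E b) \<in> tangent_space N (i p)" for b
    by (rule N.conn_mem[OF E xi_mem[OF map_points[OF p]]])
  have sum: "\<phi> (i p) (\<Sum>j\<in>J. r j *\<^sub>T v j) = (\<Sum>j\<in>J. r j *\<^sub>T \<phi> (i p) (v j))"
    if "\<And>j. j \<in> J \<Longrightarrow> v j \<in> tangent_space N (i p)" for J r and v :: "'e \<Rightarrow> 'a tvec"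
    using N.lin_map_sum[OF phi_lin[OF map_points[OF p]] map_points[OF p] that] .
  \<comment> \<open>Parallelism of \<phi> along \<xi> is known for fields on \<open>N\<close>.
    Expanding \<open>W\<close> in coordinate fields reduces the claim to these, as the derivatives
    of the coefficients commute with \<phi> by linearity.\<close>
  have "pb p (xiM p) (\<lambda>q. \<phi> (i q) (W q)) =
      pb p (xiM p) (\<lambda>q. \<Sum>b\<in>Basis. ?x b q *\<^sub>T \<phi> (i q) (?E b (i q)))"
    by (rule pullback_conn_cong[OF xi along_tensor_expand[OF tensor W d], symmetric])
  also have "\<dots> = (\<Sum>b\<in>Basis. xiM p (?x b) *\<^sub>T \<phi> (i p) (?E b (i p)) +
      ?x b p *\<^sub>T D (i p) (P p (xiM p)) (\<lambda>x. \<phi> x (?E b x)))"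
    by (rule pull_sum_leibniz[OF x phi_field[OF E] xi])
  also have "\<dots> = (\<Sum>b\<in>Basis. xiM p (?x b) *\<^sub>T \<phi> (i p) (?E b (i p))) +
      (\<Sum>b\<in>Basis. ?x b p *\<^sub>T \<phi> (i p) (D (i p) (\<xi> (i p)) (?E b)))"
    by (simp only: push_xiM[OF p] phi_parallel_xi[OF E] sum.distrib)
  also have "\<dots> = \<phi> (i p) ((\<Sum>b\<in>Basis. xiM p (?x b) *\<^sub>T ?E b (i p)) +
      (\<Sum>b\<in>Basis. ?x b p *\<^sub>T D (i p) (\<xi> (i p)) (?E b)))"
  proof -
    have "(\<Sum>b\<in>Basis. xiM p (?x b) *\<^sub>T ?E b (i p)) \<in> tangent_space N (i p)"
      "(\<Sum>b\<in>Basis. ?x b p *\<^sub>T D (i p) (\<xi> (i p)) (?E b)) \<in> tangent_space N (i p)"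
      by (intro N.tangent_sum_mem map_points p N.tangent_scale_mem e De)+
    from phi_add[OF this] show ?thesis
      by (simp only: sum[of Basis "\<lambda>b. ?E b (i p)", OF e] sum[of Basis "\<lambda>b. D (i p) (\<xi> (i p)) (?E b)", OF De])
  qed
  also have "\<dots> = \<phi> (i p) (pb p (xiM p) W)"
    by (simp only: pull_in_chart[OF xi W d] push_xiM[OF p] sum.distrib)
  finally show ?thesis .
qed

lemma phiM_add:
  assumes "v \<in> tangent_space M p" "w \<in> tangent_space M p"
  shows "phiM p (v + w) = phiM p v + phiM p w"
  using M.tangent_points[OF assms(1)] assms
  by (simp only: phiM_def push_linear phi_add push_mem tan_add phi_mem)

lemma phiM_scale:
  assumes "v \<in> tangent_space M p"
  shows "phiM p (r *\<^sub>T v) = r *\<^sub>T phiM p v"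
  using M.tangent_points[OF assms(1)] assms
  by (simp only: phiM_def push_linear phi_scale push_mem tan_scale phi_mem)

lemma nabs_xi_nabs_xi:
  fixes Y :: "'b \<Rightarrow> 'b tvec" and p :: 'b
  defines "B \<equiv> bracket M xiM Y p" and "r \<equiv> \<beta> (i p)" and "e \<equiv> etaM p (Y p)"
  defines "s \<equiv> xiM p (\<lambda>q. etaM q (Y q))"
  assumes Y: "field_near M p Y"
  shows "nabs p (xiM p) (\<lambda>q. nabs q (Y q) xiM) =
    (- r) *\<^sub>T phiM p ((- r) *\<^sub>T phiM p (Y p) + B) + ((- r) *\<^sub>T phiM p (Y p) + B) + (- s) *\<^sub>T xiM p"
proof -
  have p: "p \<in> points M" using M.self.along_points[OF Y] .
  note xi = xiM_mem[OF p] and Yp = M.field_mem[OF Y]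
  have B: "B \<in> tangent_space M p" unfolding B_def by (rule M.bracket_mem[OF xiM_field[OF p] Y])
  \<comment> \<open>By vanishing torsion this is the Levi-Civita derivative of Y along \<xi>: the
    derivative of \<xi> along Y plus the bracket. Both summands are tangent, so no normal part
    arises in the computation.\<close>
  define u where "u = (- r) *\<^sub>T phiM p (Y p) + B"
  have u: "u \<in> tangent_space M p"
    unfolding u_def by (intro M.tangent_add_mem M.tangent_scale_mem phiM_mem Yp B)
  define A where "A = (\<lambda>q. - (\<beta> (i q) *\<^sub>T phiM q (Y q)) + Y q - etaM q (Y q) *\<^sub>T xiM q)"
  have Af: "field_near M p A" unfolding A_def by (rule nabs_xiM_field[OF Y])
  define W where "W = (\<lambda>q. P q (Y q))"
  have W: "along_near M N i p W" unfolding W_def by (rule along_push[OF Y])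
  have pW: "along_near M N i p (\<lambda>q. \<phi> (i q) (W q))" by (rule along_tensor[OF tensor W])
  have xiN: "along_near M N i p (\<lambda>q. \<xi> (i q))" by (rule along_field[OF p xi_field[OF map_points[OF p]]])
  have f1: "smooth_near M p (\<lambda>q. - \<beta> (i q))" by (rule M.smooth_near_minus[OF beta_smooth_M[OF p]])
  have f3: "smooth_near M p (\<lambda>q. - etaM q (Y q))" by (rule M.smooth_near_minus[OF etaM_smooth[OF Y]])
  \<comment> \<open>The condition \<xi>\<beta> = 0 enters here; it removes the term in which \<beta>
    would be differentiated.\<close>
  have "xiM p (\<lambda>q. \<beta> (i q)) = 0"
    using push_apply[OF beta_smooth[OF map_points[OF p]], of "xiM p"] xi_beta[OF map_points[OF p]]
    by (simp add: push_xiM[OF p])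
  then have v1: "xiM p (\<lambda>q. - \<beta> (i q)) = 0" using M.tangent_minus[OF xi beta_smooth_M[OF p]] by simp
  have v3: "xiM p (\<lambda>q. - etaM q (Y q)) = - s" unfolding s_def by (rule M.tangent_minus[OF xi etaM_smooth[OF Y]])
  have pbW: "pb p (xiM p) W = P p u"
  proof -
    have "pb p (xiM p) W = P p (- (r *\<^sub>T phiM p (Y p))) + P p B"
      unfolding W_def B_def r_def
      using pull_eq_add_bracket[OF xiM_field[OF p] Y] unfolding pull_xiM[OF Yp] .
    also have "\<dots> = P p u"
      unfolding u_def push_linear by (simp add: fun_eq_iff)
    finally show ?thesis .
  qed
  have "pb p (xiM p) (\<lambda>q. P q (A q)) = pb p (xiM p) (\<lambda>q. (- \<beta> (i q)) *\<^sub>T \<phi> (i q) (W q) + W q + (- etaM q (Y q)) *\<^sub>T \<xi> (i q))"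
  proof (rule pullback_conn_cong[OF xi])
    show "\<forall>\<^sub>F q in near M p. P q (A q) = (- \<beta> (i q)) *\<^sub>T \<phi> (i q) (W q) + W q + (- etaM q (Y q)) *\<^sub>T \<xi> (i q)"
      using M.self.along_near_near[OF Y] near_points[of M p]
    proof eventually_elim
      case (elim q)
      show ?case
        unfolding A_def W_def push_linear push_phiM[OF M.field_mem[OF elim(1)]] push_xiM[OF elim(2)]
        by (simp add: fun_eq_iff)
    qed
  qed
  also have "\<dots> = pb p (xiM p) (\<lambda>q. (- \<beta> (i q)) *\<^sub>T \<phi> (i q) (W q)) + pb p (xiM p) W +
      pb p (xiM p) (\<lambda>q. (- etaM q (Y q)) *\<^sub>T \<xi> (i q))"
    by (simp only: pull_add[OF xi along_add[OF along_scale[OF f1 pW] W] along_scale[OF f3 xiN]]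
        pull_add[OF xi along_scale[OF f1 pW] W])
  also have "\<dots> = (- r) *\<^sub>T \<phi> (i p) (P p u) + P p u + (- s) *\<^sub>T \<xi> (i p)"
    by (simp only: pull_leibniz[OF xi f1 pW] pull_leibniz[OF xi f3 xiN] v1 v3 pull_phi[OF W] pbW
        pull_field[OF xi xi_field[OF map_points[OF p]]] push_xiM[OF p] D_xi_xi[OF map_points[OF p]]
        tscale_zero add_0_left add_0_right r_def)
  also have "\<dots> = P p ((- r) *\<^sub>T phiM p u + u + (- s) *\<^sub>T xiM p)"
    by (simp only: push_linear push_phiM[OF u] push_xiM[OF p])
  finally have pbA: "pb p (xiM p) (\<lambda>q. P q (A q)) = P p ((- r) *\<^sub>T phiM p u + u + (- s) *\<^sub>T xiM p)" .
  have "nabs p (xiM p) (\<lambda>q. nabs q (Y q) xiM) = nabs p (xiM p) A"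
    unfolding A_def by (rule nabs_cong[OF xi nabs_xiM_near[OF Y]])
  \<comment> \<open>For the direction \<xi> the correction terms \<eta>(A) \<xi> and g(\<xi>, A)
    \<xi> cancel, so both connections give the same derivative.\<close>
  also have "\<dots> = nab p (xiM p) A"
    unfolding nabs_eq[of "xiM p" p A, OF xi M.field_mem[OF Af]] push_xiM[OF p]
      g_xi_left[OF push_mem[OF M.field_mem[OF Af]]] etaM_def
    by simp
  also have "\<dots> = (- r) *\<^sub>T phiM p u + u + (- s) *\<^sub>T xiM p"
    unfolding ind_conn_def pbA
    by (rule tan_push) (intro M.tangent_add_mem M.tangent_scale_mem phiM_mem u xi)
  finally show ?thesis unfolding u_def .
qed

lemma nabs_zero:
  assumes v: "v \<in> tangent_space M p"
  shows "nabs p v (\<lambda>q. 0) = 0"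
proof -
  have p: "p \<in> points M" using M.tangent_points[OF v] .
  note z = M.tangent_zero_mem[OF p]
  have 1: "etaM p 0 = 0"
    using lin_form_scale[OF eta_lin[OF map_points[OF p]] push_mem[OF z], of 0] by (simp add: etaM_def push_linear)
  have 2: "g (i p) (P p v) (P p 0) = 0"
    using lin_form_scale[OF g_lin[OF push_mem[OF v]] push_mem[OF z], of 0] by (simp add: push_linear)
  have "pb p v (\<lambda>q. P q 0) = P p 0" by (simp add: push_linear pull_zero[OF v])
  then have "nab p v (\<lambda>q. 0) = 0" unfolding ind_conn_def by (simp add: tan_push[OF z])
  then show ?thesis
    unfolding nabs_eq[of v p "\<lambda>q. 0", OF v z] by (simp add: 1 2)
qed

lemma phiM_xiM: "p \<in> points M \<Longrightarrow> phiM p (xiM p) = 0"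
  using tan_push[OF M.tangent_zero_mem, of p]
  by (simp add: phiM_def push_xiM phi_xi map_points push_linear)

text \<open>All bracket contributions apart from a multiple of \<xi> cancel. The coefficient of
  \<xi> is kept explicit because its smoothness is needed when the curvature is inserted into the
  second fundamental form as a field.\<close>

lemma curvature_xi:
  assumes Y: "field_near M p Y"
  shows "curvature M nabs xiM Y xiM p =
    - ((\<beta> (i p))\<^sup>2 *\<^sub>T Y p) + - (\<beta> (i p) *\<^sub>T phiM p (Y p)) +
    ((\<beta> (i p))\<^sup>2 * etaM p (Y p) - xiM p (\<lambda>q. etaM q (Y q)) + etaM p (bracket M xiM Y p)) *\<^sub>T xiM p"
proof -
  have p: "p \<in> points M" using M.self.along_points[OF Y] .
  note xi = xiM_mem[OF p] and Yp = M.field_mem[OF Y]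
  note B = M.bracket_mem[OF xiM_field[OF p] Y]
  \<comment> \<open>The semisymmetric derivative of \<xi> along itself is zero, since \<phi>\<xi> =
    0 and the corrections \<xi> and \<eta>(\<xi>) \<xi> cancel.\<close>
  have "nabs p (Y p) (\<lambda>q. nabs q (xiM q) xiM) = nabs p (Y p) (\<lambda>q. 0)"
  proof (rule nabs_cong[OF Yp])
    show "\<forall>\<^sub>F q in near M p. nabs q (xiM q) xiM = 0"
      using near_points[of M p]
      by eventually_elim (simp add: nabs_xiM[OF xiM_mem] phiM_xiM etaM_xiM)
  qed
  then have 2: "nabs p (Y p) (\<lambda>q. nabs q (xiM q) xiM) = 0" by (simp only: nabs_zero[OF Yp])
  show ?thesis
    unfolding curvature_def 2 nabs_xiM[OF B] nabs_xi_nabs_xi[OF Y]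
      phiM_add[OF M.tangent_scale_mem[OF phiM_mem[OF Yp]] B] phiM_scale[OF phiM_mem[OF Yp]] phiM_phiM[OF Yp]
    by (simp add: fun_eq_iff algebra_simps power2_eq_square)
qed

lemma curvature_mem:
  assumes X: "field_near M p X" and Y: "field_near M p Y" and Z: "field_near M p Z"
  shows "curvature M nabs X Y Z p \<in> tangent_space M p"
  unfolding curvature_def
  by (intro M.tangent_diff_mem nabs_mem M.field_mem X Y Z M.bracket_mem)

lemma curvature_normal_zero:
  assumes X: "field_near M p X" and Y: "field_near M p Y" and S: "\<forall>\<^sub>F q in near M p. S q = 0"
  shows "curvature M (normal_conn M N i g Ds) X Y S p = 0"
proof -
  have p: "p \<in> points M" using M.self.along_points[OF X] .
  have 1: "\<forall>\<^sub>F q in near M p. normal_conn M N i g Ds q (Z q) S = 0" if Z: "field_near M p Z" for Z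
    using M.self.along_near_near[OF Z] near_near[OF S p]
    by eventually_elim (rule normal_conn_zero[OF M.field_mem])
  show ?thesis
    unfolding curvature_def normal_conn_zero[OF M.field_mem[OF X] 1[OF Y]]
      normal_conn_zero[OF M.field_mem[OF Y] 1[OF X]] normal_conn_zero[OF M.bracket_mem[OF X Y] S]
    by simp
qed

text \<open>The normal curvature acts on h(Z, \<xi>), which vanishes near \<open>p\<close>, and the
  second term has \<xi> as last argument. What remains is - h(Z, R(\<xi>, Y) \<xi>), to which the
  \<xi>-component of the curvature contributes nothing.\<close>

lemma curv_dot_sff_xi:
  assumes Y: "field_near M p Y" and Z: "field_near M p Z"
  shows "curv_dot_sff M N i g Ds xiM Y Z xiM p =
    (\<beta> (i p))\<^sup>2 *\<^sub>T h p (Y p) Z + \<beta> (i p) *\<^sub>T h p (phiM p (Y p)) Z"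
proof -
  have p: "p \<in> points M" using M.self.along_points[OF Y] .
  note xif = xiM_field[OF p] and xi = xiM_mem[OF p] and Yp = M.field_mem[OF Y] and Zp = M.field_mem[OF Z]
  define K where "K = curvature M nabs xiM Y xiM"
  \<comment> \<open>Although the term with \<open>f\<close> disappears under h, smoothness of
    \<open>f\<close> is required for \<open>K\<close> to be a field, and thus for exchanging the
    arguments of h.\<close>
  define f where "f q = (\<beta> (i q))\<^sup>2 * etaM q (Y q) - xiM q (\<lambda>q. etaM q (Y q)) + etaM q (bracket M xiM Y q)" for q
  have f: "smooth_near M p f"
    unfolding f_def power2_eq_square
    by (intro M.smooth_near_add M.smooth_near_diff M.smooth_near_mult beta_smooth_M p etaM_smooth Y
        M.bracket_field xif M.field_smooth[OF xif etaM_smooth[OF Y]])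
  have K: "\<forall>\<^sub>F q in near M p. - ((\<beta> (i q))\<^sup>2 *\<^sub>T Y q) + - (\<beta> (i q) *\<^sub>T phiM q (Y q)) + f q *\<^sub>T xiM q = K q"
    using M.self.along_near_near[OF Y] unfolding K_def f_def by eventually_elim (simp only: curvature_xi)
  have Kf: "field_near M p K"
  proof (rule M.self.along_cong[OF _ K])
    show "field_near M p (\<lambda>q. - ((\<beta> (i q))\<^sup>2 *\<^sub>T Y q) + - (\<beta> (i q) *\<^sub>T phiM q (Y q)) + f q *\<^sub>T xiM q)"
      unfolding power2_eq_square
      by (intro M.self.along_add M.self.along_minus M.self.along_scale M.smooth_near_mult f
          beta_smooth_M phiM_field Y xif p)
  qed
  have hK: "h p (K p) Z = - ((\<beta> (i p))\<^sup>2 *\<^sub>T h p (Y p) Z) + - (\<beta> (i p) *\<^sub>T h p (phiM p (Y p)) Z)"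
    unfolding near_self[OF K p, symmetric]
    by (simp only: sff_add sff_minus sff_scale M.tangent_add_mem M.tangent_minus_mem M.tangent_scale_mem
        phiM_mem xi Yp sff_xi[OF Z] tscale_zero add_0_right)
  have "sff M N i g Ds p (Z p) K = h p (K p) Z"
    by (rule trans[OF sff_Ds[of "Z p" p K, OF Zp M.field_mem[OF Kf]] sff_symmetric[OF Z Kf]])
  moreover have "sff M N i g Ds p (curvature M nabs xiM Y Z p) xiM = 0"
    by (simp only: sff_Ds[where Y = xiM, OF curvature_mem[OF xif Y Z] xi] sff_xiM[OF curvature_mem[OF xif Y Z]])
  ultimately show ?thesis
    unfolding curv_dot_sff_def K_def[symmetric] curvature_normal_zero[OF xif Y sff_Ds_xiM_near[OF Z]]
    by (simp add: hK)
qed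

section \<open>From the linear relation to total geodesicity\<close>

text \<open>Since \<open>\<phi>\<^sup>2 = - id\<close> modulo \<open>\<xi>\<close> and \<open>h(\<xi>, \<cdot>) = 0\<close>, the relation \<open>a h + b h(\<phi> \<cdot>, \<cdot>) = 0\<close>
  applied to \<open>X\<close> and to \<open>\<phi> X\<close> is a linear system of determinant \<open>a\<^sup>2 + b\<^sup>2\<close>.\<close>

lemma sff_eq_zero:
  assumes rel: "\<And>X Y. field_near M p X \<Longrightarrow> field_near M p Y \<Longrightarrow>
      a *\<^sub>T h p (X p) Y + b *\<^sub>T h p (phiM p (X p)) Y = 0"
    and ab: "a\<^sup>2 + b\<^sup>2 \<noteq> 0" and X: "field_near M p X" and Y: "field_near M p Y"
  shows "h p (X p) Y = 0"
proof -
  have p: "p \<in> points M" using M.self.along_points[OF X] .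
  note Xp = M.field_mem[OF X]
  have 1: "a *\<^sub>T h p (X p) Y + b *\<^sub>T h p (phiM p (X p)) Y = 0" by (rule rel[OF X Y])
  have "h p (phiM p (phiM p (X p))) Y = - h p (X p) Y"
    unfolding phiM_phiM[OF Xp]
    by (simp only: sff_add sff_minus sff_scale M.tangent_minus_mem M.tangent_scale_mem Xp xiM_mem[OF p]
        sff_xi[OF Y] tscale_zero add_0_right)
  then have 2: "a *\<^sub>T h p (phiM p (X p)) Y + b *\<^sub>T (- h p (X p) Y) = 0"
    using rel[OF phiM_field[OF X] Y] by simp
  show ?thesis
  proof
    fix u
    define s t where "s = h p (X p) Y u" and "t = h p (phiM p (X p)) Y u"
    have "a * s + b * t = 0" "a * t - b * s = 0"
      using fun_cong[OF 1, of u] fun_cong[OF 2, of u] by (simp_all add: s_def t_def)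
    then have "a * (a * s + b * t) - b * (a * t - b * s) = 0" by simp
    then have "(a\<^sup>2 + b\<^sup>2) * s = 0" by (simp add: algebra_simps power2_eq_square)
    then show "h p (X p) Y u = 0 u" using ab by (auto simp: s_def)
  qed
qed

lemma etaM_form: "one_form M etaM"
  unfolding one_form_def
proof (intro ballI conjI allI impI)
  fix p assume p: "p \<in> points M"
  show "lin_form (tangent_space M p) (etaM p)"
    unfolding lin_form_def etaM_def push_linear
    by (auto simp: eta_add eta_scale push_mem)
qed (rule etaM_smooth)

lemma g_xiM: "p \<in> points M \<Longrightarrow> induced_metric N i g p (xiM p) (xiM p) = 1"
  by (simp add: induced_metric_def push_xiM g_xi xi_mem map_points eta_xi)

lemma totally_geodesicI:
  assumes "\<And>p X Y. p \<in> points M \<Longrightarrow> field_near M p X \<Longrightarrow> field_near M p Y \<Longrightarrow> h p (X p) Y = 0"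
  shows "totally_geodesic M N i g D"
  using assms by (simp add: totally_geodesic_def)

text \<open>The function \<open>a\<close> stands for \<alpha>(\<xi>), the only coefficient that
  survives when the last argument is \<xi>; the constant 0 covers the parallel case.\<close>

lemma totally_geodesic_if_chaki:
  assumes cov: "\<And>p X Y. p \<in> points M \<Longrightarrow> field_near M p X \<Longrightarrow> field_near M p Y \<Longrightarrow>
      cov_deriv_sff M N i g Ds X Y xiM p = a p *\<^sub>T h p (X p) Y"
    and a: "\<And>p. p \<in> points M \<Longrightarrow> (a p + 1)\<^sup>2 + (\<beta> (i p))\<^sup>2 \<noteq> 0"
  shows "totally_geodesic M N i g D"
proof (rule totally_geodesicI)
  fix p X Y assume p: "p \<in> points M" and XY: "field_near M p X" "field_near M p Y"
  show "h p (X p) Y = 0"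
  proof (rule sff_eq_zero[OF _ _ XY])
    show "(a p + 1)\<^sup>2 + (- \<beta> (i p))\<^sup>2 \<noteq> 0" using a[OF p] by simp
    fix X Y assume "field_near M p X" "field_near M p Y"
    from cov[OF p this, unfolded cov_deriv_sff_xi[OF this]]
    show "(a p + 1) *\<^sub>T h p (X p) Y + (- \<beta> (i p)) *\<^sub>T h p (phiM p (X p)) Y = 0"
      by (simp add: fun_eq_iff algebra_simps)
  qed
qed

text \<open>Formulated at a single point, since the Deszcz condition is imposed only on the
  non-umbilical set; \<open>L = 0\<close> covers the semiparallel case.\<close>

lemma sff_eq_zero_if_curv_dot:
  assumes curv: "\<And>Y Z. field_near M p Y \<Longrightarrow> field_near M p Z \<Longrightarrow>
      curv_dot_sff M N i g Ds xiM Y Z xiM p = - (L *\<^sub>T h p (Y p) Z)"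
    and L: "(L + (\<beta> (i p))\<^sup>2)\<^sup>2 + (\<beta> (i p))\<^sup>2 \<noteq> 0" and XY: "field_near M p X" "field_near M p Y"
  shows "h p (X p) Y = 0"
proof (rule sff_eq_zero[OF _ L XY])
  fix X Y assume "field_near M p X" "field_near M p Y"
  from curv[OF this, unfolded curv_dot_sff_xi[OF this]]
  show "(L + (\<beta> (i p))\<^sup>2) *\<^sub>T h p (X p) Y + \<beta> (i p) *\<^sub>T h p (phiM p (X p)) Y = 0"
    by (simp add: fun_eq_iff algebra_simps)
qed

lemma sff_eq_zero_if_umbilical:
  assumes p: "p \<in> points M" "p \<notin> non_umbilical_set M N i g D"
    and XY: "field_near M p X" "field_near M p Y"
  shows "h p (X p) Y = 0"
proof -
  let ?H = "mean_curvature M N i g D p"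
  have umb: "h p (X p) Y = induced_metric N i g p (X p) (Y p) *\<^sub>T ?H"
    if "field_near M p X" "field_near M p Y" for X Y
    using p that by (auto simp: non_umbilical_set_def)
  have "?H = 0"
    using umb[OF xiM_field[OF p(1)] xiM_field[OF p(1)]] g_xiM[OF p(1)] sff_xiM[OF xiM_mem[OF p(1)]] by simp
  then show ?thesis using umb[OF XY] by simp
qed

text \<open>Three of the four terms contain the second fundamental form with \<xi> as an argument
  and vanish. The fourth has the weight g(\<xi>, \<xi>) = 1.\<close>

lemma Q_sff_xi:
  assumes Y: "field_near M p Y" and Z: "field_near M p Z"
  shows "Q_sff M N i g Ds Z xiM xiM Y p = - h p (Y p) Z"
proof -
  have p: "p \<in> points M" using M.self.along_points[OF Y] .
  note xi = xiM_mem[OF p] and Yp = M.field_mem[OF Y] and Zp = M.field_mem[OF Z]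
  show ?thesis
    unfolding Q_sff_def
    by (simp add: sff_Ds[where Y = xiM, OF _ xi] sff_Ds[where Y = Z, OF _ Zp] xi Yp sff_xiM sff_xi[OF Z] g_xiM[OF p])
qed

section \<open>Consequences of total geodesicity\<close>

context
  assumes geodesic: "totally_geodesic M N i g D"
begin

text \<open>Total geodesicity speaks of values of fields in the direction slot; a single vector such
  as \<open>nabs p (X p) Y\<close> is first extended to a field.\<close>

lemma sff_vanishes:
  assumes v: "v \<in> tangent_space M p" and Y: "field_near M p Y"
  shows "sff M N i g D p v Y = 0" "sff M N i g Ds p v Y = 0"
proof -
  obtain X where X: "field_near M p X" "X p = v" using v by (rule M.field_extend)
  show 1: "sff M N i g D p v Y = 0"
    using geodesic X Y M.tangent_points[OF v] unfolding totally_geodesic_def by blast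
  show "sff M N i g Ds p v Y = 0"
    unfolding sff_Ds[of v p Y, OF v M.field_mem[OF Y]] by (rule 1)
qed

text \<open>Because h = 0, the smooth field given by the ambient derivative is itself the
  pushforward of the induced derivative. \<open>field_of_push\<close> then applies, and smoothness
  of the orthogonal projection need not be established.\<close>

lemma nabs_field:
  assumes X: "field_near M p X" and Z: "field_near M p Z"
  shows "field_near M p (\<lambda>q. nabs q (X q) Z)"
proof -
  have p: "p \<in> points M" using M.self.along_points[OF X] .
  have XZ: "\<forall>\<^sub>F q in near M p. field_near M q X \<and> field_near M q Z"
    using M.self.along_near_near[OF X] M.self.along_near_near[OF Z] by eventually_elim simp
  have nab: "field_near M p (\<lambda>q. nab q (X q) Z)"
  proof (rule field_of_push[OF pull_smooth[OF X along_push[OF Z]]])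
    show "\<forall>\<^sub>F q in near M p. nab q (X q) Z \<in> tangent_space M q \<and>
        P q (nab q (X q) Z) = pb q (X q) (\<lambda>q. P q (Z q))"
      using XZ
    proof eventually_elim
      case (elim q)
      have "sff M N i g D q (X q) Z = 0" using elim by (intro sff_vanishes M.field_mem) auto
      then show ?case
        using nab_mem[OF M.field_mem[OF conjunct1[OF elim]], of Z]
        by (simp add: sff_def nor_part_def ind_conn_def)
    qed
  qed
  have "field_near M p (\<lambda>q. nab q (X q) Z + etaM q (Z q) *\<^sub>T X q - g (i q) (P q (X q)) (P q (Z q)) *\<^sub>T xiM q)"
    by (intro M.self.along_diff M.self.along_add M.self.along_scale nab etaM_smooth X Z xiM_field p
        along_metric[OF metric along_push[OF X] along_push[OF Z]])
  then show ?thesis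
  proof (rule M.self.along_cong)
    show "\<forall>\<^sub>F q in near M p. nab q (X q) Z + etaM q (Z q) *\<^sub>T X q -
        g (i q) (P q (X q)) (P q (Z q)) *\<^sub>T xiM q = nabs q (X q) Z"
      using XZ by eventually_elim (rule nabs_eq[symmetric], auto intro: M.field_mem)
  qed
qed

lemma curvature_field:
  assumes X: "field_near M p X" and Y: "field_near M p Y" and Z: "field_near M p Z"
  shows "field_near M p (curvature M nabs X Y Z)"
proof -
  have "curvature M nabs X Y Z = (\<lambda>q. nabs q (X q) (\<lambda>r. nabs r (Y r) Z) - nabs q (Y q) (\<lambda>r. nabs r (X r) Z)
      - nabs q (bracket M X Y q) Z)"
    by (rule ext) (rule curvature_def)
  then show ?thesis
    by (simp only:) (intro M.self.along_diff nabs_field M.bracket_field X Y Z)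
qed

lemma sff_vanishes_near:
  assumes Y: "field_near M p Y" and Z: "field_near M p Z"
  shows "\<forall>\<^sub>F q in near M p. sff M N i g Ds q (Y q) Z = 0"
  using M.self.along_near_near[OF Y] M.self.along_near_near[OF Z]
  by eventually_elim (rule sff_vanishes(2)[OF M.field_mem])

lemma cov_deriv_sff_vanishes:
  assumes X: "field_near M p X" and Y: "field_near M p Y" and Z: "field_near M p Z"
  shows "cov_deriv_sff M N i g Ds X Y Z p = 0"
  unfolding cov_deriv_sff_def normal_conn_zero[OF M.field_mem[OF X] sff_vanishes_near[OF Y Z]]
    sff_vanishes(2)[OF nabs_mem[of "X p" p Y, OF M.field_mem[OF X] M.field_mem[OF Y]] Z]
    sff_vanishes(2)[OF M.field_mem[OF Y] nabs_field[OF X Z]]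
  by simp

lemma curv_dot_sff_vanishes:
  assumes X: "field_near M p X" and Y: "field_near M p Y" and Z: "field_near M p Z" and U: "field_near M p U"
  shows "curv_dot_sff M N i g Ds X Y Z U p = 0"
  unfolding curv_dot_sff_def curvature_normal_zero[OF X Y sff_vanishes_near[OF Z U]]
    sff_vanishes(2)[OF curvature_mem[OF X Y Z] U]
    sff_vanishes(2)[OF M.field_mem[OF Z] curvature_field[OF X Y U]]
  by simp

lemma parallel_if_geodesic: "parallel_sff M N i g Ds"
  by (simp add: parallel_sff_def cov_deriv_sff_vanishes)

lemma semiparallel_if_geodesic: "semiparallel_sff M N i g Ds"
  by (simp add: semiparallel_sff_def curv_dot_sff_vanishes)

text \<open>Both sides of the Chaki equation are zero, so any nowhere vanishing form would satisfy
  it. The restriction of \<eta> is one, as it takes the value 1 on \<xi>.\<close>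

lemma chaki_if_geodesic: "chaki_pseudo_parallel M N i g Ds etaM"
  unfolding chaki_pseudo_parallel_def
proof (intro conjI ballI allI impI etaM_form)
  show "\<exists>v\<in>tangent_space M p. etaM p v \<noteq> 0" if "p \<in> points M" for p
    by (rule bexI[OF _ xiM_mem[OF that]]) (simp add: etaM_xiM[OF that])
qed (simp add: cov_deriv_sff_vanishes sff_vanishes M.field_mem)

lemma deszcz_if_geodesic:
  "deszcz_pseudo_parallel M N i g W Ds L"
  unfolding deszcz_pseudo_parallel_def
  by (intro ballI allI impI) (simp add: curv_dot_sff_vanishes Q_sff_def sff_vanishes M.field_mem)

end

section \<open>From the parallelity conditions to total geodesicity\<close>

lemma geodesic_if_parallel:
  assumes "parallel_sff M N i g Ds"
  shows "totally_geodesic M N i g D"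
proof (rule totally_geodesic_if_chaki[of "\<lambda>_. 0"])
  show "cov_deriv_sff M N i g Ds X Y xiM p = 0 *\<^sub>T h p (X p) Y"
    if "p \<in> points M" "field_near M p X" "field_near M p Y" for p X Y
    using assms that xiM_field[OF that(1)] by (simp add: parallel_sff_def)
  show "(0 + 1)\<^sup>2 + (\<beta> (i p))\<^sup>2 \<noteq> 0" for p by (simp add: add_nonneg_eq_0_iff)
qed

lemma geodesic_if_chaki:
  assumes chaki: "chaki_pseudo_parallel M N i g Ds \<alpha>"
    and \<alpha>: "\<forall>p\<in>points M. (\<alpha> p (tang p (\<xi> (i p))) + 1)\<^sup>2 + (\<beta> (i p))\<^sup>2 \<noteq> 0"
  shows "totally_geodesic M N i g D"
proof (rule totally_geodesic_if_chaki[of "\<lambda>p. \<alpha> p (xiM p)"])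
  show "cov_deriv_sff M N i g Ds X Y xiM p = \<alpha> p (xiM p) *\<^sub>T h p (X p) Y"
    if p: "p \<in> points M" and X: "field_near M p X" and Y: "field_near M p Y" for p X Y
  proof -
    note xi = xiM_mem[OF p] and Xp = M.field_mem[OF X] and Yp = M.field_mem[OF Y]
    have "cov_deriv_sff M N i g Ds X Y xiM p =
        (2 * \<alpha> p (X p)) *\<^sub>T sff M N i g Ds p (Y p) xiM + \<alpha> p (Y p) *\<^sub>T sff M N i g Ds p (X p) xiM
        + \<alpha> p (xiM p) *\<^sub>T sff M N i g Ds p (X p) Y"
      using chaki p X Y xiM_field[OF p] unfolding chaki_pseudo_parallel_def by simp
    then show ?thesis
      by (simp add: sff_Ds[where Y = xiM, OF _ xi] sff_Ds[where Y = Y, OF _ Yp] Xp Yp sff_xiM)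
  qed
  show "(\<alpha> p (xiM p) + 1)\<^sup>2 + (\<beta> (i p))\<^sup>2 \<noteq> 0" if "p \<in> points M" for p
    using \<alpha> that by (simp add: xiM_def)
qed

lemma geodesic_if_deszcz:
  assumes deszcz: "deszcz_pseudo_parallel M N i g (non_umbilical_set M N i g D) Ds L"
    and L: "\<forall>p\<in>non_umbilical_set M N i g D. (L p + (\<beta> (i p))\<^sup>2)\<^sup>2 + (\<beta> (i p))\<^sup>2 \<noteq> 0"
  shows "totally_geodesic M N i g D"
proof (rule totally_geodesicI)
  fix p X Y assume p: "p \<in> points M" and XY: "field_near M p X" "field_near M p Y"
  show "h p (X p) Y = 0"
  proof (cases "p \<in> non_umbilical_set M N i g D")
    case True
    show ?thesis
    proof (rule sff_eq_zero_if_curv_dot[OF _ bspec[OF L True] XY])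
      fix Y Z assume YZ: "field_near M p Y" "field_near M p Z"
      have "curv_dot_sff M N i g Ds xiM Y Z xiM p = L p *\<^sub>T Q_sff M N i g Ds Z xiM xiM Y p"
        using deszcz True YZ xiM_field[OF p] unfolding deszcz_pseudo_parallel_def by simp
      then show "curv_dot_sff M N i g Ds xiM Y Z xiM p = - (L p *\<^sub>T h p (Y p) Z)"
        unfolding Q_sff_xi[OF YZ] by (simp add: fun_eq_iff)
    qed
  qed (rule sff_eq_zero_if_umbilical[OF p _ XY])
qed

text \<open>With L = 0 the determinant is \<beta>^4 + \<beta>^2. At a zero of \<beta> the relation
  tested here degenerates to 0 = 0, which the assumption on \<beta> excludes.\<close>

lemma geodesic_if_semiparallel:
  assumes semi: "semiparallel_sff M N i g Ds" and \<beta>: "\<forall>p\<in>points M. \<beta> (i p) \<noteq> 0"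
  shows "totally_geodesic M N i g D"
proof (rule totally_geodesicI)
  fix p X Y assume p: "p \<in> points M" and XY: "field_near M p X" "field_near M p Y"
  show "h p (X p) Y = 0"
  proof (rule sff_eq_zero_if_curv_dot[of p 0, OF _ _ XY])
    show "(0 + (\<beta> (i p))\<^sup>2)\<^sup>2 + (\<beta> (i p))\<^sup>2 \<noteq> 0" using \<beta> p by (simp add: add_nonneg_eq_0_iff)
    show "curv_dot_sff M N i g Ds xiM Y Z xiM p = - (0 *\<^sub>T h p (Y p) Z)"
      if "field_near M p Y" "field_near M p Z" for Y Z
      using semi p that xiM_field[OF p] unfolding semiparallel_sff_def by simp
  qed
qed

end

theorem theorem3p7:
  fixes N :: "('a, 'e::euclidean_space) manifold"
    and M :: "('b, 'f::euclidean_space) manifold"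
    and i :: "'b \<Rightarrow> 'a"
    and \<phi> :: "'a \<Rightarrow> 'a tvec \<Rightarrow> 'a tvec" and \<xi> :: "'a \<Rightarrow> 'a tvec"
    and \<eta> :: "'a \<Rightarrow> 'a tvec \<Rightarrow> real" and g :: "'a \<Rightarrow> 'a tvec \<Rightarrow> 'a tvec \<Rightarrow> real"
    and \<beta> :: "'a \<Rightarrow> real" and nabla nabla_s :: "'a conn" and n m :: nat
  assumes "DIM('e) = 2 * n + 1" and "2 * n + 1 > 3"
    and "DIM('f) = 2 * m + 1" and "m < n"
    and "sq_sasakian N \<phi> \<xi> \<eta> g nabla \<beta>"
    and "invariant_submanifold M N i \<phi> \<xi>"
    and "nabla_s = semisymmetric_conn \<xi> \<eta> g nabla"
  shows
    "let I = totally_geodesic M N i g nabla;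
         II = (parallel_sff M N i g nabla_s \<and> (\<forall>p\<in>points M. (\<beta> (i p))\<^sup>2 + 1 \<noteq> 0));
         III = (semiparallel_sff M N i g nabla_s \<and> (\<forall>p\<in>points M. (\<beta> (i p))\<^sup>2 + 1 \<noteq> 0));
         IV = (\<exists>\<alpha>. chaki_pseudo_parallel M N i g nabla_s \<alpha> \<and>
                 (\<forall>p\<in>points M. (\<alpha> p (tan_part M N i g p (\<xi> (i p))) + 1)\<^sup>2 + (\<beta> (i p))\<^sup>2 \<noteq> 0));
         V = (\<exists>L. deszcz_pseudo_parallel M N i g (non_umbilical_set M N i g nabla) nabla_s L \<and>
                 (\<forall>p\<in>non_umbilical_set M N i g nabla. (L p + (\<beta> (i p))\<^sup>2)\<^sup>2 + (\<beta> (i p))\<^sup>2 \<noteq> 0))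
     in (I \<longleftrightarrow> II) \<and> (I \<longleftrightarrow> IV) \<and> (I \<longleftrightarrow> V) \<and> (I \<longrightarrow> III) \<and>
        ((\<forall>p\<in>points M. \<beta> (i p) \<noteq> 0) \<longrightarrow> III \<longrightarrow> I)"
proof -
  interpret sq_immersion N M i \<phi> \<xi> \<eta> g \<beta> nabla
    by (rule sq_immersion.intro) fact+
  have pos: "r\<^sup>2 + 1 \<noteq> 0" for r :: real by (simp add: add_nonneg_eq_0_iff)
  have chaki: "\<exists>\<alpha>. chaki_pseudo_parallel M N i g nabla_s \<alpha> \<and>
      (\<forall>p\<in>points M. (\<alpha> p (tan_part M N i g p (\<xi> (i p))) + 1)\<^sup>2 + (\<beta> (i p))\<^sup>2 \<noteq> 0)"
    if "totally_geodesic M N i g nabla"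
  \<comment> \<open>For \<alpha> = \<eta> on \<open>M\<close> the value on \<xi> is 1, so the side
    condition reads 4 + \<beta>^2 \<noteq> 0.\<close>
  proof (intro exI[of _ etaM] conjI ballI)
    show "chaki_pseudo_parallel M N i g nabla_s etaM"
      using chaki_if_geodesic[OF that] assms(7) by simp
    show "(etaM p (tan_part M N i g p (\<xi> (i p))) + 1)\<^sup>2 + (\<beta> (i p))\<^sup>2 \<noteq> 0" if "p \<in> points M" for p
      using etaM_xiM[OF that] by (simp add: xiM_def add_nonneg_eq_0_iff)
  qed
  have deszcz: "\<exists>L. deszcz_pseudo_parallel M N i g (non_umbilical_set M N i g nabla) nabla_s L \<and>
      (\<forall>p\<in>non_umbilical_set M N i g nabla. (L p + (\<beta> (i p))\<^sup>2)\<^sup>2 + (\<beta> (i p))\<^sup>2 \<noteq> 0)"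
    if "totally_geodesic M N i g nabla"
  \<comment> \<open>Any L satisfies the equation once h vanishes; this one makes L + \<beta>^2 equal
    to 1, so that the side condition becomes 1 + \<beta>^2 \<noteq> 0.\<close>
  proof (intro exI[of _ "\<lambda>p. 1 - (\<beta> (i p))\<^sup>2"] conjI ballI)
    show "deszcz_pseudo_parallel M N i g (non_umbilical_set M N i g nabla) nabla_s (\<lambda>p. 1 - (\<beta> (i p))\<^sup>2)"
      using deszcz_if_geodesic[OF that] assms(7) by simp
    show "(1 - (\<beta> (i p))\<^sup>2 + (\<beta> (i p))\<^sup>2)\<^sup>2 + (\<beta> (i p))\<^sup>2 \<noteq> 0" for p
      by (simp add: add_nonneg_eq_0_iff)
  qed
  show ?thesis
    unfolding Let_def
    using parallel_if_geodesic semiparallel_if_geodesic chaki deszcz pos geodesic_if_parallel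
      geodesic_if_chaki geodesic_if_deszcz geodesic_if_semiparallel
    unfolding assms(7) by metis
qed

end
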